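(* Let $u:\mathbb{R}^2\to\mathbb{R}$ be a solution of the Liouville equation $-\Delta u=e^{2u}$ in $\mathbb{R}^2$. Then: (1) $\lim_{|z|\to\infty}u(z)=-\infty$ if and only if $u$ is radial about a point. (2) If $u$ is symmetric with respect to both the $x$-axis and the $y$-axis (that is, $u(x,y)=u(x,-y)=u(-x,y)$ for all $x,y$), and $u_x<0$, $u_y<0$ in the first quadrant $\{x>0,\,y>0\}$, then $u$ is radially symmetric (about the origin). (3) If $u$ is concave and bounded from above, then there exist $\lambda\in\mathbb{C}\setminus\{0\}$ and $z_0\in\mathbb{C}$ such that $u(z)=\ln|\lambda|+U(\lambda z+z_0)$ for all $z\in\mathbb{C}$, where $U(x,y)=\ln(\operatorname{sech} y)$. (4) If $u$ is bounded from above, then the diameter of $\mathbb{R}^2$ under the metric $e^{2u}\delta$ belongs to $[\pi,2\pi)$; every value in $[\pi,2\pi)$ is attained as this diameter for some solution bounded from above. Moreover, for $u$ bounded from above, this diameter is equal to $\pi$ if and only if either $u$ is radial about some point or $u$ is one-dimensional.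
   Context: $\mathbb{R}^2$ is identified with $\mathbb{C}$ via $z=x+iy$. A solution means a classical ($C^2$) real-valued solution on all of $\mathbb{R}^2$. A function $u$ is radial about a point $p\in\mathbb{R}^2$ if $u(z)$ depends only on $|z-p|$. A function $u$ is one-dimensional if there are a unit vector $\omega\in\mathbb{S}^1$ and a function $g:\mathbb{R}\to\mathbb{R}$ with $u(x,y)=g(\omega\cdot(x,y))$ for all $(x,y)$. $\delta$ denotes the Euclidean metric on $\mathbb{R}^2$, so $e^{2u}\delta$ is the conformal Riemannian metric with length element $e^{u(z)}|dz|$; the diameter of $\mathbb{R}^2$ under $e^{2u}\delta$ is the supremum over pairs of points of the associated Riemannian distance (the infimum of the lengths $\int_\gamma e^{u}|dz|$ over piecewise smooth curves $\gamma$ joining the two points). *)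

theory Defs
  imports "HOL-Analysis.Analysis"
begin

text \<open>The plane is the type \<^typ>\<open>complex\<close>; the point $(x,y)$ is \<^term>\<open>Complex x y\<close>.\<close>

definition C2_fun :: "('a::real_normed_vector \<Rightarrow> 'b::real_normed_vector) \<Rightarrow> bool" where
  "C2_fun f \<longleftrightarrow> (\<exists>(f' :: 'a \<Rightarrow> 'a \<Rightarrow>\<^sub>L 'b) (f'' :: 'a \<Rightarrow> 'a \<Rightarrow>\<^sub>L 'a \<Rightarrow>\<^sub>L 'b).
     (\<forall>x. (f has_derivative blinfun_apply (f' x)) (at x)) \<and>
     (\<forall>x. (f' has_derivative blinfun_apply (f'' x)) (at x)) \<and>
     continuous_on UNIV f'')"

definition partial_x :: "(complex \<Rightarrow> real) \<Rightarrow> complex \<Rightarrow> real" where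
  "partial_x u z = deriv (\<lambda>t. u (Complex t (Im z))) (Re z)"

definition partial_y :: "(complex \<Rightarrow> real) \<Rightarrow> complex \<Rightarrow> real" where
  "partial_y u z = deriv (\<lambda>t. u (Complex (Re z) t)) (Im z)"

definition laplacian :: "(complex \<Rightarrow> real) \<Rightarrow> complex \<Rightarrow> real" where
  "laplacian u z = partial_x (partial_x u) z + partial_y (partial_y u) z"

definition liouville_solution :: "(complex \<Rightarrow> real) \<Rightarrow> bool" where
  "liouville_solution u \<longleftrightarrow> C2_fun u \<and> (\<forall>z. - laplacian u z = exp (2 * u z))"

definition radial_about :: "complex \<Rightarrow> (complex \<Rightarrow> real) \<Rightarrow> bool" where
  "radial_about p u \<longleftrightarrow> (\<exists>g :: real \<Rightarrow> real. \<forall>z. u z = g (cmod (z - p)))"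

definition one_dimensional :: "(complex \<Rightarrow> real) \<Rightarrow> bool" where
  "one_dimensional u \<longleftrightarrow>
     (\<exists>\<omega> :: complex. cmod \<omega> = 1 \<and> (\<exists>g :: real \<Rightarrow> real. \<forall>z. u z = g (\<omega> \<bullet> z)))"

definition log_sech :: "complex \<Rightarrow> real" where
  "log_sech z = ln (1 / cosh (Im z))"

text \<open>
  Lengths are extended nonnegative reals: the derivative of a \<^const>\<open>valid_path\<close>
  (a continuous, piecewise C1 curve on the unit interval) may be unbounded near the finitely
  many exceptional parameters, so the length integral may diverge, and it must then be
  infinite rather than a default value. At the exceptional parameters themselves the integrand
  is arbitrary, but these form a null set.
\<close>

definition conformal_length :: "(complex \<Rightarrow> real) \<Rightarrow> (real \<Rightarrow> complex) \<Rightarrow> ennreal" where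
  "conformal_length u \<gamma> =
     (\<integral>\<^sup>+ t \<in> {0..1}. ennreal (exp (u (\<gamma> t)) * cmod (vector_derivative \<gamma> (at t))) \<partial>lborel)"

definition conformal_dist :: "(complex \<Rightarrow> real) \<Rightarrow> complex \<Rightarrow> complex \<Rightarrow> ennreal" where
  "conformal_dist u p q =
     (INF \<gamma> \<in> {\<gamma>. valid_path \<gamma> \<and> pathstart \<gamma> = p \<and> pathfinish \<gamma> = q}. conformal_length u \<gamma>)"

definition conformal_diameter :: "(complex \<Rightarrow> real) \<Rightarrow> ennreal" where
  "conformal_diameter u = (SUP p. SUP q. conformal_dist u p q)"

end

theory Submission
  imports Defs "HOL-Complex_Analysis.Complex_Analysis" "HOL-Real_Asymp.Real_Asymp"
begin

text \<open>
  The Liouville equation says that the metric with density \<open>e^(2u)\<close> has curvature 1. All four claims are read off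
  from a classification of the solutions that are bounded above (\<open>bounded_liouville_classification\<close>): up to a
  complex affine change of the variable, the metric is that of the sphere without a point (\<open>bubble\<close>) or of
  the universal cover of the sphere without two points (\<open>periodic_profile\<close>).

  Write \<open>g = u_z\<close> and \<open>p = u_zz\<close>. The equation prescribes the derivative of \<open>g\<close> with respect to the conjugate variable, and
  it makes the Schwarzian \<open>Q = p - g^2\<close> holomorphic. Third derivatives of \<open>u\<close> are avoided by
  constructing a primitive of \<open>Q\<close> instead (\<open>schwarzian_entire\<close>).

  If \<open>u \<le> M\<close>, the Laplacian is bounded. Comparing circle means and first Fourier coefficients of \<open>u\<close> bounds
  \<open>\<bar>g\<bar>\<close> by a multiple of the square root of \<open>M + 1 - u\<close> (\<open>gradient_bound\<close>). So this root is Lipschitz continuous and \<open>g\<close>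
  grows at most linearly. Where \<open>\<bar>g\<bar> \<le> A\<close> on a disc of fixed radius, the same comparison shows that \<open>g\<close> changes by a
  bounded amount over the distance \<open>1/A\<close>, and Cauchy's inequality for the primitive of \<open>Q\<close> yields \<open>\<bar>p\<bar> \<le> C A\<close> at the center
  (\<open>second_derivative_bound\<close>). Consequently \<open>Q\<close> is a polynomial of degree at most 2, and \<open>- g^2\<close> equals \<open>Q\<close> up
  to an error of smaller order. A quadratic \<open>Q\<close> would make \<open>u\<close> grow along some ray
  (\<open>schwarzian_not_quadratic\<close>). A linear \<open>Q\<close> would provide a continuous square root of a linear function on a large
  circle (\<open>schwarzian_not_linear\<close>). So \<open>Q\<close> is constant, the equation \<open>\<Phi>_zz = - Q \<Phi>\<close> for \<open>\<Phi> = e^(-u)\<close> has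
  constant coefficients, and it is solved explicitly.

  Bubbles are radial and tend to \<open>-\<infinity>\<close>; the other solutions are periodic, which excludes them where a solution is
  radial, tends to \<open>-\<infinity>\<close> or is monotone in a quadrant, and restricts them where it is concave.

  For the diameters, lengths are bounded from below by a height function \<open>T\<close> on the sphere, whose angle \<open>arcsin T\<close> has
  Lipschitz constant 1 (\<open>length_ge_height_angles\<close>), and from above by explicit polygons through far points. The
  diameter is \<open>pi\<close> for the bubble and \<open>pi + 2 arctan S\<close> for the periodic profile with parameter \<open>S\<close>.
\<close>

section \<open>Wirtinger derivatives\<close>

text \<open>
  Differentiating under the integral sign, the increment of the \<open>h\<close>-derivative of \<open>f\<close> along the
  segment from \<open>x\<close> to \<open>x + t k\<close> is the integral of the mixed derivative along that segment.
  Differentiating this identity in \<open>t\<close> at 0 gives the symmetry.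
\<close>
lemma second_derivative_symmetric:
  fixes f :: "'a::real_normed_vector \<Rightarrow> 'b::banach"
  assumes f': "\<And>x. (f has_derivative blinfun_apply (f' x)) (at x)"
    and f'': "\<And>x. (f' has_derivative blinfun_apply (f'' x)) (at x)"
    and cont: "continuous_on UNIV f''"
  shows "blinfun_apply (f'' x h) k = blinfun_apply (f'' x k) h"
proof -
  have d1: "((\<lambda>s. f (a + s *\<^sub>R b)) has_vector_derivative f' (a + s *\<^sub>R b) b) (at s within S)" for a b s S
  proof -
    have "((\<lambda>s. f (a + s *\<^sub>R b)) has_derivative (\<lambda>t. f' (a + s *\<^sub>R b) (t *\<^sub>R b))) (at s within S)"
      by (rule has_derivative_compose[OF _ f']) (auto intro!: derivative_eq_intros)
    then show ?thesis
      by (simp add: has_vector_derivative_def blinfun.scaleR_right)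
  qed
  have d2: "((\<lambda>s. f' (a + s *\<^sub>R b) c) has_vector_derivative f'' (a + s *\<^sub>R b) b c) (at s within S)" for a b c s S
  proof -
    have "((\<lambda>s. f' (a + s *\<^sub>R b)) has_derivative (\<lambda>t. f'' (a + s *\<^sub>R b) (t *\<^sub>R b))) (at s within S)"
      by (rule has_derivative_compose[OF _ f'']) (auto intro!: derivative_eq_intros)
    then have "((\<lambda>s. f' (a + s *\<^sub>R b)) has_vector_derivative f'' (a + s *\<^sub>R b) b) (at s within S)"
      by (simp add: has_vector_derivative_def blinfun.scaleR_right)
    then show ?thesis
      by (rule bounded_linear.has_vector_derivative[OF blinfun.bounded_linear_left])
  qed
  have contf': "continuous_on UNIV f'"
    by (meson continuous_at_imp_continuous_on f'' has_derivative_continuous)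
  have key: "f' (x + t *\<^sub>R k) h - f' x h = integral {0..t} (\<lambda>\<tau>. f'' (x + \<tau> *\<^sub>R k) h k)" if "t \<ge> 0" for t
  proof -
    have "((\<lambda>s. integral (cbox 0 t) (\<lambda>\<tau>. f' (x + \<tau> *\<^sub>R k + s *\<^sub>R h) k)) has_vector_derivative
        integral (cbox 0 t) (\<lambda>\<tau>. f'' (x + \<tau> *\<^sub>R k + 0 *\<^sub>R h) h k)) (at 0 within UNIV)"
    proof (rule leibniz_rule_vector_derivative)
      show "((\<lambda>s. f' (x + \<tau> *\<^sub>R k + s *\<^sub>R h) k) has_vector_derivative f'' (x + \<tau> *\<^sub>R k + s *\<^sub>R h) h k) (at s within UNIV)" for s \<tau>
        by (rule d2)
      show "(\<lambda>\<tau>. f' (x + \<tau> *\<^sub>R k + s *\<^sub>R h) k) integrable_on cbox 0 t" for s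
        by (intro integrable_continuous continuous_intros continuous_on_compose2[OF contf']) auto
      show "continuous_on (UNIV \<times> cbox 0 t) (\<lambda>(s, \<tau>). f'' (x + \<tau> *\<^sub>R k + s *\<^sub>R h) h k)"
        unfolding split_beta
        by (intro continuous_intros continuous_on_compose2[OF cont]) auto
    qed auto
    moreover have "integral (cbox 0 t) (\<lambda>\<tau>. f' (x + \<tau> *\<^sub>R k + s *\<^sub>R h) k) = f (x + s *\<^sub>R h + t *\<^sub>R k) - f (x + s *\<^sub>R h)" for s
    proof -
      have "((\<lambda>\<tau>. f' (x + s *\<^sub>R h + \<tau> *\<^sub>R k) k) has_integral f (x + s *\<^sub>R h + t *\<^sub>R k) - f (x + s *\<^sub>R h + 0 *\<^sub>R k)) {0..t}"
        by (rule fundamental_theorem_of_calculus[OF that]) (rule d1)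
      moreover have "x + s *\<^sub>R h + \<tau> *\<^sub>R k = x + \<tau> *\<^sub>R k + s *\<^sub>R h" for \<tau>
        by (simp add: algebra_simps)
      ultimately show ?thesis by (simp only: integral_unique cbox_interval[symmetric]) simp
    qed
    ultimately have A: "((\<lambda>s. f (x + s *\<^sub>R h + t *\<^sub>R k) - f (x + s *\<^sub>R h)) has_vector_derivative
        integral {0..t} (\<lambda>\<tau>. f'' (x + \<tau> *\<^sub>R k) h k)) (at 0)" by simp
    have eq: "x + s *\<^sub>R h + t *\<^sub>R k = (x + t *\<^sub>R k) + s *\<^sub>R h" for s
      by (simp add: algebra_simps)
    have B: "((\<lambda>s. f (x + s *\<^sub>R h + t *\<^sub>R k) - f (x + s *\<^sub>R h)) has_vector_derivative
        f' (x + t *\<^sub>R k) h - f' x h) (at 0)"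
      using has_vector_derivative_diff[OF d1[of "x + t *\<^sub>R k" h 0 UNIV] d1[of x h 0 UNIV]] by (simp only: eq) simp
    show ?thesis using vector_derivative_unique_at[OF A B] by simp
  qed
  have "((\<lambda>t. integral {0..t} (\<lambda>\<tau>. f'' (x + \<tau> *\<^sub>R k) h k)) has_vector_derivative f'' (x + 0 *\<^sub>R k) h k) (at 0 within {0..1})"
    by (rule integral_has_vector_derivative)
      (auto intro!: continuous_intros continuous_on_compose2[OF cont])
  then have "((\<lambda>t. f' (x + t *\<^sub>R k) h - f' x h) has_vector_derivative f'' x h k) (at 0 within {0..1})"
    by (subst (asm) scale_zero_left, subst (asm) add_0_right)
      (rule has_vector_derivative_transform[rotated 2], auto simp: key)
  moreover have "((\<lambda>t. f' (x + t *\<^sub>R k) h - f' x h) has_vector_derivative f'' x k h) (at 0 within {0..1})"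
    using has_vector_derivative_diff[OF d2[of x k h 0 "{0..1}"] has_vector_derivative_const] by simp
  ultimately show ?thesis
    by (rule vector_derivative_unique_within[rotated]) (simp add: trivial_limit_within islimpt_Icc)
qed

text \<open>
  Real differentiability in complex form: \<open>a\<close> and \<open>b\<close> are the continuous derivatives of \<open>F\<close>
  with respect to \<open>z\<close> and to the conjugate of \<open>z\<close>. The case \<open>b = 0\<close> is the Cauchy-Riemann equation.
\<close>
definition wirtinger :: "(complex \<Rightarrow> complex) \<Rightarrow> (complex \<Rightarrow> complex) \<Rightarrow> (complex \<Rightarrow> complex) \<Rightarrow> bool" where
  "wirtinger F a b \<longleftrightarrow> continuous_on UNIV a \<and> continuous_on UNIV b \<and>
     (\<forall>z. (F has_derivative (\<lambda>h. a z * h + b z * cnj h)) (at z))"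

lemma wirtingerD:
  assumes "wirtinger F a b"
  shows "(F has_derivative (\<lambda>h. a z * h + b z * cnj h)) (at z within S)"
    and "continuous_on S a" "continuous_on S b" "continuous_on S F"
proof -
  show *: "(F has_derivative (\<lambda>h. a z * h + b z * cnj h)) (at z within S)" for z S
    using assms by (auto simp: wirtinger_def intro: has_derivative_at_withinI)
  show "continuous_on S a" "continuous_on S b"
    using assms by (auto simp: wirtinger_def intro: continuous_on_subset)
  show "continuous_on S F"
    by (meson * continuous_on_eq_continuous_within has_derivative_continuous)
qed

lemma wirtinger_cong:
  assumes "wirtinger F a b" "\<And>z. F z = F' z" "\<And>z. a z = a' z" "\<And>z. b z = b' z"
  shows "wirtinger F' a' b'"
proof -
  have "F = F'" "a = a'" "b = b'" using assms by auto
  with assms show ?thesis by simp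
qed

lemma wirtinger_const: "wirtinger (\<lambda>_. c) (\<lambda>_. 0) (\<lambda>_. 0)"
  by (auto simp: wirtinger_def)

lemma wirtinger_ident: "wirtinger (\<lambda>z. z) (\<lambda>_. 1) (\<lambda>_. 0)"
  by (auto simp: wirtinger_def)

lemma wirtinger_add:
  assumes "wirtinger F a b" "wirtinger G c d"
  shows "wirtinger (\<lambda>z. F z + G z) (\<lambda>z. a z + c z) (\<lambda>z. b z + d z)"
  unfolding wirtinger_def
  by (auto intro!: continuous_intros derivative_eq_intros wirtingerD[OF assms(1)] wirtingerD[OF assms(2)]
      simp: algebra_simps)

lemma wirtinger_diff:
  assumes "wirtinger F a b" "wirtinger G c d"
  shows "wirtinger (\<lambda>z. F z - G z) (\<lambda>z. a z - c z) (\<lambda>z. b z - d z)"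
  unfolding wirtinger_def
  by (auto intro!: continuous_intros derivative_eq_intros wirtingerD[OF assms(1)] wirtingerD[OF assms(2)]
      simp: algebra_simps)

lemma wirtinger_mult:
  assumes "wirtinger F a b" "wirtinger G c d"
  shows "wirtinger (\<lambda>z. F z * G z) (\<lambda>z. F z * c z + a z * G z) (\<lambda>z. F z * d z + b z * G z)"
  unfolding wirtinger_def
  by (auto intro!: continuous_intros derivative_eq_intros wirtingerD[OF assms(1)] wirtingerD[OF assms(2)]
      simp: algebra_simps)

lemma wirtinger_cmult:
  assumes "wirtinger F a b"
  shows "wirtinger (\<lambda>z. c * F z) (\<lambda>z. c * a z) (\<lambda>z. c * b z)"
  using wirtinger_mult[OF wirtinger_const[of c] assms] by simp

lemma wirtinger_cnj:
  assumes "wirtinger F a b"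
  shows "wirtinger (\<lambda>z. cnj (F z)) (\<lambda>z. cnj (b z)) (\<lambda>z. cnj (a z))"
  unfolding wirtinger_def
  by (auto intro!: continuous_intros derivative_eq_intros wirtingerD[OF assms]
      bounded_linear.has_derivative[OF bounded_linear_cnj] simp: algebra_simps)

lemma wirtinger_exp:
  assumes "wirtinger F a b"
  shows "wirtinger (\<lambda>z. exp (F z)) (\<lambda>z. exp (F z) * a z) (\<lambda>z. exp (F z) * b z)"
proof -
  have "((\<lambda>z. exp (F z)) has_derivative (\<lambda>h. exp (F z) * (a z * h + b z * cnj h))) (at z)" for z
    by (rule has_derivative_compose[OF wirtingerD(1)[OF assms]])
      (use DERIV_exp[of "F z"] in \<open>simp add: has_field_derivative_def\<close>)
  then show ?thesis
    unfolding wirtinger_def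
    by (auto intro!: continuous_intros wirtingerD[OF assms] simp: algebra_simps)
qed

lemma wirtinger_holomorphic:
  assumes "wirtinger F a (\<lambda>_. 0)"
  shows "(F has_field_derivative a z) (at z)"
  using wirtingerD(1)[OF assms, of z UNIV] by (simp add: has_field_derivative_def)

lemma wirtinger_along_curve:
  assumes "wirtinger F a b"
    and "(\<gamma> has_vector_derivative v) (at t within S)"
  shows "((\<lambda>t. F (\<gamma> t)) has_vector_derivative a (\<gamma> t) * v + b (\<gamma> t) * cnj v) (at t within S)"
proof -
  have "((\<lambda>t. F (\<gamma> t)) has_derivative (\<lambda>s. a (\<gamma> t) * (s *\<^sub>R v) + b (\<gamma> t) * cnj (s *\<^sub>R v))) (at t within S)"
    using assms(2) unfolding has_vector_derivative_def
    by (rule has_derivative_compose[OF _ wirtingerD(1)[OF assms(1)]])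
  moreover have "(\<lambda>s. a (\<gamma> t) * (s *\<^sub>R v) + b (\<gamma> t) * cnj (s *\<^sub>R v)) = (\<lambda>s. s *\<^sub>R (a (\<gamma> t) * v + b (\<gamma> t) * cnj v))"
    by (auto simp: algebra_simps scaleR_conv_of_real)
  ultimately show ?thesis by (simp add: has_vector_derivative_def)
qed

text \<open>
  All later arguments use the solution only through \<open>g = u_z\<close>. Since the Laplacian is four times
  the mixed Wirtinger derivative, the Liouville equation prescribes the derivative of \<open>g\<close>
  with respect to the conjugate variable.
\<close>
lemma liouville_wirtinger:
  assumes "liouville_solution u"
  obtains g p where "wirtinger (\<lambda>z. of_real (u z)) g (\<lambda>z. cnj (g z))"
    and "wirtinger g p (\<lambda>z. of_real (- exp (2 * u z) / 4))"
    and "\<And>z. partial_x u z = 2 * Re (g z)" "\<And>z. partial_y u z = - 2 * Im (g z)"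
proof -
  from assms obtain f' :: "complex \<Rightarrow> complex \<Rightarrow>\<^sub>L real" and f'' :: "complex \<Rightarrow> complex \<Rightarrow>\<^sub>L complex \<Rightarrow>\<^sub>L real"
    where f': "\<And>x. (u has_derivative blinfun_apply (f' x)) (at x)"
    and f'': "\<And>x. (f' has_derivative blinfun_apply (f'' x)) (at x)"
    and cont: "continuous_on UNIV f''" and lap: "\<And>z. - laplacian u z = exp (2 * u z)"
    by (auto simp: liouville_solution_def C2_fun_def)
  have contf': "continuous_on UNIV f'"
    by (meson continuous_at_imp_continuous_on f'' has_derivative_continuous)
  have cx: "((\<lambda>t. Complex t b) has_derivative (\<lambda>t. of_real t)) (at a)" for a b
    by (auto simp: Complex_eq intro!: derivative_eq_intros)
  have cy: "((\<lambda>t. Complex b t) has_derivative (\<lambda>t. \<i> * of_real t)) (at a)" for a b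
    by (auto simp: Complex_eq intro!: derivative_eq_intros)
  have of: "complex_of_real t = t *\<^sub>R 1" "\<i> * complex_of_real t = t *\<^sub>R \<i>" for t
    by (auto simp: scaleR_conv_of_real)
  have px: "partial_x u z = f' z 1" for z
    unfolding partial_x_def
    by (rule DERIV_imp_deriv)
      (use has_derivative_compose[OF cx f', of "Im z" "Re z"] in \<open>simp add: has_field_derivative_def of blinfun.scaleR_right mult_commute_abs\<close>)
  have py: "partial_y u z = f' z \<i>" for z
    unfolding partial_y_def
    by (rule DERIV_imp_deriv)
      (use has_derivative_compose[OF cy f', of "Re z" "Im z"] in \<open>simp add: has_field_derivative_def of blinfun.scaleR_right mult_commute_abs\<close>)
  have d2: "((\<lambda>z. f' z c) has_derivative (\<lambda>h. f'' z h c)) (at z)" for z c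
    by (rule bounded_linear.has_derivative[OF blinfun.bounded_linear_left f''])
  have "partial_x (partial_x u) z = f'' z 1 1" for z
    unfolding partial_x_def[of "partial_x u"] px
    by (rule DERIV_imp_deriv)
      (use has_derivative_compose[OF cx[of "Im z" "Re z"] d2[of 1]] in \<open>simp add: has_field_derivative_def of blinfun.scaleR_right blinfun.scaleR_left mult_commute_abs\<close>)
  moreover have "partial_y (partial_y u) z = f'' z \<i> \<i>" for z
    unfolding partial_y_def[of "partial_y u"] py
    by (rule DERIV_imp_deriv)
      (use has_derivative_compose[OF cy[of "Re z" "Im z"] d2[of "\<i>"]] in \<open>simp add: has_field_derivative_def of blinfun.scaleR_right blinfun.scaleR_left mult_commute_abs\<close>)
  ultimately have lap2: "f'' z 1 1 + f'' z \<i> \<i> = - exp (2 * u z)" for z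
    using lap[of z] by (simp add: laplacian_def)
  have sym: "f'' z h k = f'' z k h" for z h k
    by (rule second_derivative_symmetric[OF f' f'' cont])
  have dec: "h = Re h *\<^sub>R 1 + Im h *\<^sub>R \<i>" for h by (simp add: complex_eq_iff)
  have f'h: "f' z h = Re h * f' z 1 + Im h * f' z \<i>" for z h
    by (subst dec) (simp only: blinfun.add_right blinfun.scaleR_right real_scaleR_def)
  have f''h: "f'' z h c = Re h * f'' z 1 c + Im h * f'' z \<i> c" for z h c
    by (subst dec) (simp only: blinfun.add_right blinfun.scaleR_right blinfun.add_left blinfun.scaleR_left real_scaleR_def)
  define g where "g z = Complex (f' z 1 / 2) (- f' z \<i> / 2)" for z
  define p where "p z = Complex ((f'' z 1 1 - f'' z \<i> \<i>) / 4) (- f'' z 1 \<i> / 2)" for z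
  have "continuous_on UNIV g"
    unfolding g_def by (intro continuous_intros contf'; simp)
  have "((\<lambda>z. complex_of_real (u z)) has_derivative (\<lambda>h. g z * h + cnj (g z) * cnj h)) (at z)" for z
  proof -
    have "((\<lambda>z. complex_of_real (u z)) has_derivative (\<lambda>h. of_real (f' z h))) (at z)"
      by (auto intro!: derivative_eq_intros f')
    moreover have "of_real (f' z h) = g z * h + cnj (g z) * cnj h" for h
      by (subst f'h) (simp add: g_def complex_eq_iff field_simps)
    ultimately show ?thesis by simp
  qed
  with \<open>continuous_on UNIV g\<close> have w1: "wirtinger (\<lambda>z. of_real (u z)) g (\<lambda>z. cnj (g z))"
    by (auto simp: wirtinger_def intro!: continuous_intros)
  have "(g has_derivative (\<lambda>h. p z * h + of_real (- exp (2 * u z) / 4) * cnj h)) (at z)" for z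
  proof -
    have "((\<lambda>z. (1/2) * of_real (f' z 1) + (- \<i>/2) * of_real (f' z \<i>)) has_derivative
        (\<lambda>h. (1/2) * of_real (f'' z h 1) + (- \<i>/2) * of_real (f'' z h \<i>))) (at z)"
      by (intro has_derivative_add has_derivative_mult_right has_derivative_of_real d2)
    moreover have "(1/2) * of_real (f'' z h 1) + (- \<i>/2) * of_real (f'' z h \<i>)
        = p z * h + of_real (- exp (2 * u z) / 4) * cnj h" for h
    proof -
      have E: "exp (2 * u z) = - f'' z 1 1 - f'' z \<i> \<i>" using lap2[of z] by simp
      show ?thesis
        unfolding E by (subst (1 2) f''h) (simp add: p_def complex_eq_iff field_simps sym[of z \<i> 1])
    qed
    moreover have "g = (\<lambda>z. (1/2) * of_real (f' z 1) + (- \<i>/2) * of_real (f' z \<i>))"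
      by (auto simp: g_def complex_eq_iff)
    ultimately show ?thesis by (simp only:)
  qed
  moreover have "continuous_on UNIV p"
    unfolding p_def by (intro continuous_intros cont; simp)
  moreover have "continuous_on UNIV u"
    using f' by (meson continuous_at_imp_continuous_on has_derivative_continuous)
  ultimately have w2: "wirtinger g p (\<lambda>z. of_real (- exp (2 * u z) / 4))"
    by (auto simp: wirtinger_def intro!: continuous_intros)
  show ?thesis
    by (rule that[OF w1 w2]) (simp_all add: g_def px py)
qed

section \<open>The entire function attached to a solution\<close>

text \<open>
  The hypotheses share the function \<open>c\<close>, which says that the form \<open>a dz + b d(cnj z)\<close> is closed. Its primitive is the
  integral along the ray from 0; the derivative of the integrand in direction \<open>h\<close> is the total
  derivative in \<open>t\<close> of \<open>t (a(tz) h + b(tz) cnj h)\<close>, so it integrates to \<open>a(z) h + b(z) cnj h\<close>.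
\<close>
lemma closed_form_exact:
  assumes a: "wirtinger a a1 c" and b: "wirtinger b c b2"
  obtains Y where "wirtinger Y a b"
proof -
  define CB where "CB = Blinfun cnj"
  have CB: "blinfun_apply CB h = cnj h" for h
    unfolding CB_def by (simp add: bounded_linear_Blinfun_apply bounded_linear_cnj)
  define W where "W A B = blinfun_mult_right A + (blinfun_mult_right B o\<^sub>L CB)" for A B :: complex
  have W: "blinfun_apply (W A B) h = A * h + B * cnj h" for A B h
    by (simp add: W_def blinfun.add_left CB)
  have contW: "continuous_on S (\<lambda>x. W (f x) (g x))" if "continuous_on S f" "continuous_on S g"
    for f g and S :: "(complex \<times> real) set"
    unfolding W_def using that
    by (intro continuous_intros bounded_bilinear.continuous_on[OF bounded_bilinear_blinfun_compose]
        bounded_linear.continuous_on[OF bounded_linear_blinfun_mult_right])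
  define f where "f z t = a (t *\<^sub>R z) * z + b (t *\<^sub>R z) * cnj z" for z and t :: real
  define A where "A z t = t *\<^sub>R a1 (t *\<^sub>R z) * z + a (t *\<^sub>R z) + t *\<^sub>R c (t *\<^sub>R z) * cnj z" for z and t :: real
  define B where "B z t = t *\<^sub>R c (t *\<^sub>R z) * z + b (t *\<^sub>R z) + t *\<^sub>R b2 (t *\<^sub>R z) * cnj z" for z and t :: real
  note contD = wirtingerD(2,3,4)[OF a, of UNIV] wirtingerD(3,4)[OF b, of UNIV]
  have contA: "continuous_on (UNIV \<times> T) (\<lambda>x. A (fst x) (snd x))"
    and contB: "continuous_on (UNIV \<times> T) (\<lambda>x. B (fst x) (snd x))" for T
    unfolding A_def B_def
    by (intro continuous_intros contD[THEN continuous_on_compose2]; simp)+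
  define Y where "Y z = integral (cbox 0 1) (f z)" for z
  have Y': "(Y has_derivative integral (cbox 0 1) (\<lambda>t. W (A z t) (B z t))) (at z within UNIV)" for z
    unfolding Y_def
  proof (rule leibniz_rule)
    fix x :: complex and t :: real
    have "((\<lambda>x. t *\<^sub>R x) has_derivative (\<lambda>h. t *\<^sub>R h)) (at x within UNIV)"
      by (auto intro!: derivative_eq_intros)
    from has_derivative_compose[OF this wirtingerD(1)[OF a]] has_derivative_compose[OF this wirtingerD(1)[OF b]]
    have D: "((\<lambda>x. a (t *\<^sub>R x)) has_derivative (\<lambda>h. a1 (t *\<^sub>R x) * (t *\<^sub>R h) + c (t *\<^sub>R x) * cnj (t *\<^sub>R h))) (at x within UNIV)"
      "((\<lambda>x. b (t *\<^sub>R x)) has_derivative (\<lambda>h. c (t *\<^sub>R x) * (t *\<^sub>R h) + b2 (t *\<^sub>R x) * cnj (t *\<^sub>R h))) (at x within UNIV)" .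
    have "((\<lambda>x. f x t) has_derivative (\<lambda>h. A x t * h + B x t * cnj h)) (at x within UNIV)"
      unfolding f_def A_def B_def
      by (rule derivative_eq_intros D bounded_linear.has_derivative[OF bounded_linear_cnj] refl)+
        (auto simp: algebra_simps scaleR_conv_of_real)
    then show "((\<lambda>x. f x t) has_derivative blinfun_apply (W (A x t) (B x t))) (at x within UNIV)"
      by (simp add: W[abs_def])
  next
    show "f x integrable_on cbox 0 1" for x
      unfolding f_def
      by (intro integrable_continuous continuous_intros contD[THEN continuous_on_compose2]) auto
    show "continuous_on (UNIV \<times> cbox 0 1) (\<lambda>(x, t). W (A x t) (B x t))"
      unfolding split_beta by (intro contW contA contB)
  qed auto
  have "blinfun_apply (integral (cbox 0 1) (\<lambda>t. W (A z t) (B z t))) h = a z * h + b z * cnj h" for z h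
  proof -
    have "continuous_on (cbox 0 1) (\<lambda>t::real. W (A z t) (B z t))"
    proof -
      have joint: "continuous_on (UNIV \<times> cbox 0 1) (\<lambda>x::complex \<times> real. W (A (fst x) (snd x)) (B (fst x) (snd x)))"
        by (intro contW contA contB)
      moreover have "continuous_on (cbox 0 1) (\<lambda>t::real. (z, t))"
        by (intro continuous_intros)
      ultimately show ?thesis
        using continuous_on_compose2[OF joint, of "cbox 0 1" "\<lambda>t::real. (z, t)"] by (simp add: image_subset_iff)
    qed
    then have int: "(\<lambda>t. W (A z t) (B z t)) integrable_on cbox 0 1"
      by (rule integrable_continuous)
    have "blinfun_apply (integral (cbox 0 1) (\<lambda>t. W (A z t) (B z t))) h
        = integral (cbox 0 1) (\<lambda>t. A z t * h + B z t * cnj h)"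
      using integral_linear[OF int blinfun.bounded_linear_left[of h]] by (simp add: o_def W)
    also have "((\<lambda>t. A z t * h + B z t * cnj h) has_integral
        (1 *\<^sub>R a (1 *\<^sub>R z) * h + 1 *\<^sub>R b (1 *\<^sub>R z) * cnj h) - (0 *\<^sub>R a (0 *\<^sub>R z) * h + 0 *\<^sub>R b (0 *\<^sub>R z) * cnj h)) {0..1}"
    proof (rule fundamental_theorem_of_calculus)
      fix t :: real
      have "((\<lambda>t. t *\<^sub>R z) has_vector_derivative z) (at t within {0..1})"
        by (auto intro!: derivative_eq_intros)
      note D = wirtinger_along_curve[OF a this] wirtinger_along_curve[OF b this]
      show "((\<lambda>t. t *\<^sub>R a (t *\<^sub>R z) * h + t *\<^sub>R b (t *\<^sub>R z) * cnj h) has_vector_derivative A z t * h + B z t * cnj h) (at t within {0..1})"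
        unfolding A_def B_def
        by (rule derivative_eq_intros D refl)+ (auto simp: algebra_simps scaleR_conv_of_real)
    qed auto
    then have "integral (cbox 0 1) (\<lambda>t. A z t * h + B z t * cnj h) = a z * h + b z * cnj h"
      by (simp add: integral_unique)
    finally show ?thesis .
  qed
  then have "blinfun_apply (integral (cbox 0 1) (\<lambda>t. W (A z t) (B z t))) = (\<lambda>h. a z * h + b z * cnj h)" for z
    by auto
  with Y' have "wirtinger Y a b"
    unfolding wirtinger_def using contD by metis
  then show ?thesis by (rule that)
qed

text \<open>
  The Schwarzian \<open>p - g^2 = u_zz - u_z^2\<close> is entire, in a form that needs only two derivatives of \<open>u\<close>.
  Writing \<open>h\<close> for the derivative of \<open>g\<close> in the conjugate variable, one has \<open>h_z = 2 g h\<close>, so the form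
  \<open>g^2 dz + h d(cnj z)\<close> is closed. Its primitive \<open>Y\<close> has the same conjugate derivative as \<open>g\<close>, and
  \<open>P = g - Y\<close> is entire with derivative \<open>p - g^2\<close>.
\<close>
lemma schwarzian_entire:
  assumes u: "wirtinger (\<lambda>z. of_real (u z)) g (\<lambda>z. cnj (g z))"
    and g: "wirtinger g p (\<lambda>z. of_real (- exp (2 * u z) / 4))"
  obtains Y P where "wirtinger Y (\<lambda>z. g z ^ 2) (\<lambda>z. of_real (- exp (2 * u z) / 4))"
    and "\<And>z. P z = g z - Y z" and "\<And>z. (P has_field_derivative p z - g z ^ 2) (at z)"
proof -
  have 1: "wirtinger (\<lambda>z. g z ^ 2) (\<lambda>z. 2 * g z * p z) (\<lambda>z. 2 * g z * of_real (- exp (2 * u z) / 4))"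
    by (rule wirtinger_cong[OF wirtinger_mult[OF g g]]) (auto simp: power2_eq_square algebra_simps)
  have 2: "wirtinger (\<lambda>z. of_real (- exp (2 * u z) / 4)) (\<lambda>z. 2 * g z * of_real (- exp (2 * u z) / 4))
      (\<lambda>z. 2 * cnj (g z) * of_real (- exp (2 * u z) / 4))"
    by (rule wirtinger_cong[OF wirtinger_cmult[OF wirtinger_exp[OF wirtinger_cmult[OF u]], of "-1/4" 2]])
      (auto simp: exp_of_real[symmetric])
  from closed_form_exact[OF 1 2] obtain Y where Y:
    "wirtinger Y (\<lambda>z. g z ^ 2) (\<lambda>z. of_real (- exp (2 * u z) / 4))" .
  show ?thesis
    by (rule that[OF Y refl])
      (rule wirtinger_holomorphic, rule wirtinger_cong[OF wirtinger_diff[OF g Y]], auto)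
qed

section \<open>Integrals over circles\<close>

text \<open>
  The angular integral, without a factor depending on \<open>r\<close>, so that it makes sense for \<open>r = 0\<close> too.
\<close>
definition circle_integral :: "(complex \<Rightarrow> complex) \<Rightarrow> complex \<Rightarrow> real \<Rightarrow> complex" where
  "circle_integral F z0 r = integral {0..2*pi} (\<lambda>t. F (z0 + of_real r * cis t))"

lemma circle_integrable:
  fixes F :: "complex \<Rightarrow> complex"
  assumes "continuous_on UNIV F"
  shows "(\<lambda>t. F (z0 + of_real r * cis t)) integrable_on {0..2*pi}"
  by (rule integrable_continuous_interval, rule continuous_on_compose2[OF assms])
     (auto intro!: continuous_intros)

lemma circle_integral_0:
  fixes F :: "complex \<Rightarrow> complex"
  shows "circle_integral F z0 0 = of_real (2 * pi) * F z0"
  by (simp add: circle_integral_def scaleR_conv_of_real)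

text \<open>
  The \<open>r\<close>-derivative contributes both Wirtinger derivatives, but the \<open>t\<close>-derivative integrates to 0
  over a full turn, and this expresses the part with \<open>a\<close> by the part with \<open>b\<close>.
\<close>
lemma circle_integral_derivative:
  assumes "wirtinger F a b" "r \<noteq> 0"
  shows "((\<lambda>r. circle_integral F z0 r) has_vector_derivative
    2 * integral {0..2*pi} (\<lambda>t. b (z0 + of_real r * cis t) * cis (- t))) (at r)"
proof -
  let ?z = "\<lambda>t. z0 + of_real r * cis t"
  note cont = wirtingerD(2,3,4)[OF assms(1), of UNIV]
  have int1: "(\<lambda>t. a (?z t) * cis t) integrable_on {0..2*pi}"
    and int2: "(\<lambda>t. b (?z t) * cis (- t)) integrable_on {0..2*pi}"
    by (intro integrable_continuous_interval cont[THEN continuous_on_compose2] continuous_intros; simp)+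
  have "((\<lambda>r. integral (cbox 0 (2*pi)) (\<lambda>t. F (z0 + of_real r * cis t))) has_vector_derivative
      integral (cbox 0 (2*pi)) (\<lambda>t. a (?z t) * cis t + b (?z t) * cis (- t))) (at r within UNIV)"
  proof (rule leibniz_rule_vector_derivative)
    fix x t :: real
    have "((\<lambda>x. z0 + of_real x * cis t) has_vector_derivative cis t) (at x within UNIV)"
      by (auto intro!: derivative_eq_intros simp: has_vector_derivative_def scaleR_conv_of_real)
    from wirtinger_along_curve[OF assms(1) this]
    show "((\<lambda>x. F (z0 + of_real x * cis t)) has_vector_derivative
       a (z0 + of_real x * cis t) * cis t + b (z0 + of_real x * cis t) * cis (- t)) (at x within UNIV)"
      by (simp add: cis_cnj)
  next
    show "(\<lambda>t. F (z0 + complex_of_real x * cis t)) integrable_on cbox 0 (2 * pi)" for x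
      using circle_integrable[OF cont(3)] by simp
    show "continuous_on (UNIV \<times> cbox 0 (2 * pi))
     (\<lambda>(x, t). a (z0 + complex_of_real x * cis t) * cis t + b (z0 + complex_of_real x * cis t) * cis (- t))"
      unfolding split_beta by (intro cont[THEN continuous_on_compose2] continuous_intros; simp)
  qed auto
  moreover have "integral {0..2*pi} (\<lambda>t. a (?z t) * cis t) = integral {0..2*pi} (\<lambda>t. b (?z t) * cis (- t))"
  proof -
    have "((\<lambda>t. a (?z t) * (of_real r * (\<i> * cis t)) + b (?z t) * cnj (of_real r * (\<i> * cis t))) has_integral
        F (?z (2*pi)) - F (?z 0)) {0..2*pi}"
    proof (rule fundamental_theorem_of_calculus)
      fix t :: real
      have "(?z has_vector_derivative of_real r * (\<i> * cis t)) (at t within {0..2*pi})"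
        unfolding has_vector_derivative_def
        by (rule has_derivative_eq_rhs, (rule derivative_eq_intros refl)+) (auto simp: scaleR_conv_of_real mult_ac)
      from wirtinger_along_curve[OF assms(1) this]
      show "((\<lambda>t. F (?z t)) has_vector_derivative a (?z t) * (of_real r * (\<i> * cis t)) + b (?z t) * cnj (of_real r * (\<i> * cis t))) (at t within {0..2*pi})" .
    qed auto
    then have "((\<lambda>t. (\<i> * of_real r) * (a (?z t) * cis t - b (?z t) * cis (- t))) has_integral 0) {0..2*pi}"
      by (simp only: cis_2pi cis_zero diff_self) (simp add: cis_cnj algebra_simps)
    then have "integral {0..2*pi} (\<lambda>t. (\<i> * of_real r) * (a (?z t) * cis t - b (?z t) * cis (- t))) = 0"
      by (rule integral_unique)
    then have "integral {0..2*pi} (\<lambda>t. a (?z t) * cis t - b (?z t) * cis (- t)) = 0"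
      using assms(2) by simp
    then show ?thesis
      using int1 int2 by (simp add: Henstock_Kurzweil_Integration.integral_diff)
  qed
  ultimately show ?thesis
    using int1 int2 by (simp add: circle_integral_def[abs_def] Henstock_Kurzweil_Integration.integral_add)
qed

lemma circle_integral_continuous:
  assumes "continuous_on UNIV F"
  shows "continuous_on S (circle_integral F z0)"
proof -
  have "continuous_on S (\<lambda>r. integral (cbox 0 (2*pi)) (\<lambda>t. F (z0 + of_real r * cis t)))"
    by (rule integral_continuous_on_param, unfold split_beta, rule continuous_on_compose2[OF assms])
      (auto intro!: continuous_intros)
  then show ?thesis by (simp add: circle_integral_def[abs_def])
qed

lemma norm_increment_le:
  fixes f :: "real \<Rightarrow> 'a::real_normed_vector"
  assumes "r \<ge> 0" "continuous_on {0..r} f"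
    and "\<And>x. 0 < x \<Longrightarrow> x < r \<Longrightarrow> (f has_vector_derivative f' x) (at x)"
    and "\<And>x. 0 < x \<Longrightarrow> x < r \<Longrightarrow> norm (f' x) \<le> B"
  shows "norm (f r - f 0) \<le> B * r"
proof (cases "r = 0")
  case False
  have "norm (f r - f 0) \<le> B * r - B * 0"
    by (rule differentiable_bound_general[where f' = f' and \<phi>' = "\<lambda>_. B"])
      (use assms False in \<open>auto intro!: continuous_intros derivative_eq_intros\<close>)
  then show ?thesis by simp
qed auto

lemma circle_integral_growth:
  assumes F: "wirtinger F a b" and r: "r \<ge> 0"
    and B: "\<And>z. dist z0 z \<le> r \<Longrightarrow> norm (b z) \<le> B"
  shows "norm (circle_integral F z0 r - circle_integral F z0 0) \<le> 4 * pi * B * r"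
proof (rule norm_increment_le[OF r circle_integral_continuous circle_integral_derivative[OF F]])
  fix x assume x: "0 < x" "x < r"
  have "norm (integral {0..2*pi} (\<lambda>t. b (z0 + of_real x * cis t) * cis (- t))) \<le> B * (2 * pi - 0)"
  proof (rule integral_bound)
    show "continuous_on {0..2*pi} (\<lambda>t. b (z0 + of_real x * cis t) * cis (- t))"
      by (intro continuous_intros continuous_on_compose2[OF wirtingerD(3)[OF F, of UNIV]]) auto
    show "norm (b (z0 + of_real x * cis t) * cis (- t)) \<le> B" for t
      using B[of "z0 + of_real x * cis t"] x by (simp add: norm_mult dist_norm)
  qed auto
  then show "norm (2 * integral {0..2*pi} (\<lambda>t. b (z0 + of_real x * cis t) * cis (- t))) \<le> 4 * pi * B"
    by (simp add: norm_mult)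
qed (use wirtingerD[OF F] in auto)

section \<open>Gradient estimates\<close>

text \<open>
  Here \<open>g\<close> stands for \<open>u_z\<close> and \<open>p\<close> for \<open>u_zz\<close>; by the second assumption, \<open>u\<close> solves the Liouville equation.
\<close>
locale liouville_gradient =
  fixes u :: "complex \<Rightarrow> real" and g p :: "complex \<Rightarrow> complex"
  assumes u: "wirtinger (\<lambda>z. of_real (u z)) g (\<lambda>z. cnj (g z))"
    and g: "wirtinger g p (\<lambda>z. of_real (- exp (2 * u z) / 4))"
begin

lemma u_derivative: "(u has_derivative (\<lambda>h. 2 * Re (g z * h))) (at z within S)"
  using bounded_linear.has_derivative[OF bounded_linear_Re wirtingerD(1)[OF u, of z S]] by (simp add: mult.commute)

lemma continuous_u: "continuous_on S u"
  by (meson continuous_on_eq_continuous_within has_derivative_continuous u_derivative)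

lemma continuous_g: "continuous_on S g"
  using wirtingerD[OF u] by blast

lemma wirtinger_weighted: "wirtinger F a b \<Longrightarrow> wirtinger (\<lambda>z. (z - z0) * F z) (\<lambda>z. (z - z0) * a z + F z) (\<lambda>z. (z - z0) * b z)"
  by (rule wirtinger_cong[OF wirtinger_mult[OF wirtinger_diff[OF wirtinger_ident wirtinger_const]]]) auto

text \<open>
  A weight \<open>z - z0\<close> turns the mean into the first Fourier coefficient on the circle. The weight is holomorphic,
  so the derivative formula for circle integrals applies to it as well.
\<close>
lemma circle_integral_weighted: 
  "circle_integral (\<lambda>z. (z - z0) * F z) z0 r = of_real r * integral {0..2*pi} (\<lambda>t. F (z0 + of_real r * cis t) * cis t)"
  unfolding circle_integral_def integral_mult_right[symmetric] by (simp add: mult_ac)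

lemma circle_integral_u_derivative:
  assumes "r > 0"
  shows "(circle_integral (\<lambda>z. of_real (u z)) z0 has_vector_derivative
     2 * cnj (circle_integral (\<lambda>z. (z - z0) * g z) z0 r) / of_real r) (at r)"
proof -
  have "integral {0..2*pi} (\<lambda>t. cnj (g (z0 + of_real r * cis t)) * cis (- t))
      = cnj (integral {0..2*pi} (\<lambda>t. g (z0 + of_real r * cis t) * cis t))"
    by (simp add: integral_cnj cis_cnj)
  then show ?thesis
    using circle_integral_derivative[OF u, of r z0] assms by (simp add: circle_integral_weighted)
qed

end

text \<open>
  The bound \<open>K\<close> on the curvature density is carried as a parameter of its own, because all
  constants depend on it, while \<open>M\<close> only enters through the distance of \<open>u\<close> to its upper bound.
\<close>
locale bounded_liouville = liouville_gradient +
  fixes K M :: real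
  assumes u_le: "u z \<le> M" and exp_u_le: "exp (2 * u z) \<le> K"
begin

lemma K_pos: "K > 0"
  using exp_u_le[of 0] exp_gt_zero by (rule less_le_trans[rotated])

lemma laplace_bound: "norm (complex_of_real (- exp (2 * u z) / 4)) \<le> K / 4"
  unfolding norm_of_real using exp_u_le[of z] by simp

lemma circle_mean_g:
  assumes "r \<ge> 0"
  shows "norm (circle_integral g z0 r - of_real (2 * pi) * g z0) \<le> pi * K * r"
  using circle_integral_growth[OF g assms laplace_bound] by (simp add: circle_integral_0)

text \<open>
  The quantitative form of superharmonicity: the Laplacian is bounded by \<open>K\<close>, so the mean over a circle
  falls below the value at the center by at most a multiple of \<open>K r^2\<close>.
\<close>
lemma circle_mean_u:
  assumes "r \<ge> 0"
  shows "norm (circle_integral (\<lambda>z. of_real (u z)) z0 r - of_real (2 * pi * u z0)) \<le> 2 * pi * K * r ^ 2"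
proof -
  let ?W = "circle_integral (\<lambda>z. (z - z0) * g z) z0" and ?c = "circle_integral (\<lambda>z. of_real (u z)) z0"
  have "norm (?c r - ?c 0) \<le> (2 * pi * K * r) * r"
  proof (rule norm_increment_le[OF assms circle_integral_continuous circle_integral_u_derivative])
    fix x assume x: "0 < x" "x < r"
    have "norm (?W x - ?W 0) \<le> 4 * pi * (x * (K / 4)) * x"
    proof (rule circle_integral_growth[OF wirtinger_weighted[OF g]])
      fix z assume "dist z0 z \<le> x"
      then have "norm (z - z0) \<le> x" by (simp add: dist_norm norm_minus_commute)
      then show "norm ((z - z0) * complex_of_real (- exp (2 * u z) / 4)) \<le> x * (K / 4)"
        unfolding norm_mult using laplace_bound[of z] by (intro mult_mono) (use x in auto)
    qed (use x in auto)
    then have "norm (?W x) \<le> pi * K * x * x"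
      by (simp add: circle_integral_0 mult_ac)
    then have "norm (2 * cnj (?W x) / of_real x) \<le> 2 * (pi * K * x)"
      using x by (simp add: norm_divide norm_mult field_simps)
    also have "\<dots> \<le> 2 * pi * K * r"
      using x K_pos by simp
    finally show "norm (2 * cnj (?W x) / of_real x) \<le> 2 * pi * K * r" .
  qed (use continuous_u in \<open>auto intro!: continuous_intros\<close>)
  then show ?thesis by (simp add: circle_integral_0 power2_eq_square mult_ac)
qed

text \<open>
  For harmonic functions the first Fourier coefficient on a circle is, up to normalisation, the gradient at the center;
  the bound on the Laplacian makes this an approximation with an error of third order.
\<close>
lemma circle_first_moment:
  assumes "r \<ge> 0"
  shows "norm (circle_integral (\<lambda>z. (z - z0) * of_real (u z)) z0 r - of_real (2 * pi * r ^ 2) * cnj (g z0)) \<le> 2 * pi * K * r ^ 3"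
proof -
  let ?J = "\<lambda>x. integral {0..2*pi} (\<lambda>t. ((z0 + of_real x * cis t) - z0) * cnj (g (z0 + of_real x * cis t)) * cis (- t))"
  let ?D = "\<lambda>x. 2 * of_real x * cnj (circle_integral g z0 x) - of_real (4 * pi * x) * cnj (g z0)"
  let ?f = "\<lambda>r. circle_integral (\<lambda>z. (z - z0) * of_real (u z)) z0 r - of_real (2 * pi * r ^ 2) * cnj (g z0)"
  have "norm (?f r - ?f 0) \<le> (2 * pi * K * r ^ 2) * r"
  proof (rule norm_increment_le[OF assms])
    show "continuous_on {0..r} ?f"
      by (intro continuous_intros circle_integral_continuous continuous_u)
    fix x assume x: "0 < x" "x < r"
    have "2 * ?J x
        = 2 * integral {0..2*pi} (\<lambda>t. of_real x * cnj (g (z0 + of_real x * cis t)))"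
      by (simp add: cis_mult mult.assoc mult.left_commute[of "cis _"] flip: mult.assoc[of "cis _"])
    also have "\<dots> = 2 * of_real x * cnj (circle_integral g z0 x)"
      by (simp add: circle_integral_def integral_cnj)
    finally have eq: "2 * ?J x
        = 2 * of_real x * cnj (circle_integral g z0 x)" .
    have d: "((\<lambda>r. of_real (2 * pi * r ^ 2) * cnj (g z0)) has_vector_derivative of_real (4 * pi * x) * cnj (g z0)) (at x)"
      unfolding has_vector_derivative_def
      by (rule derivative_eq_intros refl | simp add: scaleR_conv_of_real mult_ac)+
    show "(?f has_vector_derivative (?D x)) (at x)"
      using has_vector_derivative_diff[OF circle_integral_derivative[OF wirtinger_weighted[OF u], of x z0 z0] d] x
      unfolding eq by simp
    have "?D x
       = 2 * of_real x * cnj (circle_integral g z0 x - of_real (2 * pi) * g z0)"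
      by (simp add: algebra_simps)
    also have "norm \<dots> \<le> 2 * x * (pi * K * x)"
      unfolding norm_mult complex_mod_cnj using circle_mean_g[of x z0] x
      by (intro mult_mono) auto
    also have "\<dots> \<le> 2 * pi * K * r ^ 2"
      using x K_pos by (simp add: power2_eq_square mult_mono)
    finally show "norm (?D x) \<le> 2 * pi * K * r ^ 2" .
  qed
  then show ?thesis by (simp add: circle_integral_0 power2_eq_square power3_eq_cube mult_ac)
qed

text \<open>
  Since \<open>u \<le> M\<close>, the mean of \<open>\<bar>M - u\<bar>\<close> over a circle equals \<open>M\<close> minus the mean of \<open>u\<close>, hence is at most
  about \<open>M - u(z0) + K r^2\<close>. It bounds the first Fourier coefficient, which gives
  \<open>\<bar>g(z0)\<bar> \<le> v/r + 2 K r\<close> with \<open>v = M + 1 - u(z0)\<close>, for every radius \<open>r > 0\<close>; the summand 1 keeps \<open>v\<close> away from 0.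
\<close>
lemma gradient_bound: "norm (g z0) \<le> (1 + 2 * K) * sqrt (M + 1 - u z0)"
proof -
  define v where "v = M + 1 - u z0"
  \<comment> \<open>This radius balances the two terms \<open>v/r\<close> and \<open>K r\<close>.\<close>
  define r where "r = sqrt v"
  have v: "v \<ge> 1" using u_le[of z0] by (simp add: v_def)
  then have r: "r \<ge> 1" "r ^ 2 = v" by (auto simp: r_def)
  let ?z = "\<lambda>t. z0 + of_real r * cis t"
  let ?I = "integral {0..2*pi} (\<lambda>t. u (?z t))" and ?J = "integral {0..2*pi} (\<lambda>t. M - u (?z t))"
  let ?F = "circle_integral (\<lambda>z. (z - z0) * of_real (u z)) z0 r"
  have intR: "(\<lambda>t. u (?z t)) integrable_on {0..2*pi}"
    by (intro integrable_continuous_interval continuous_on_compose2[OF continuous_u[of UNIV]] continuous_intros) auto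
  have cu: "circle_integral (\<lambda>z. of_real (u z)) z0 r = of_real (?I)"
    unfolding circle_integral_def
    by (rule integral_unique) (use has_integral_of_real[OF integrable_integral[OF intR]] in simp)
  have "?I - 2 * pi * u z0 \<ge> - (2 * pi * K * v)"
  proof -
    have "\<bar>?I - 2 * pi * u z0\<bar> \<le> 2 * pi * K * v"
      using circle_mean_u[of r z0] r unfolding cu
      by (metis (no_types, lifting) norm_of_real of_real_diff of_real_mult of_real_numeral order_trans zero_le_one)
    then show ?thesis by linarith
  qed
  moreover have "?J = 2 * pi * M - ?I"
    using Henstock_Kurzweil_Integration.integral_diff[OF integrable_const_ivl intR, of M] by simp
  ultimately have m1: "?J \<le> 2 * pi * (M - u z0) + 2 * pi * K * v"
    by (simp add: algebra_simps)
  have m1': "?J \<le> 2 * pi * v + 2 * pi * K * v"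
  proof -
    have "2 * pi * (M - u z0) \<le> 2 * pi * v" by (intro mult_left_mono) (auto simp: v_def)
    with m1 show ?thesis by linarith
  qed
  have cis0: "((\<lambda>t. of_real M * cis t) has_integral 0) {0..2*pi}"
  proof -
    have "((\<lambda>t. of_real M * cis t) has_integral (of_real M * (- \<i>) * cis (2*pi) - of_real M * (- \<i>) * cis 0)) {0..2*pi}"
      by (rule fundamental_theorem_of_calculus)
        (auto simp: has_vector_derivative_def scaleR_conv_of_real mult_ac intro!: derivative_eq_intros)
    then show ?thesis by simp
  qed
  have intu: "(\<lambda>t. of_real (u (?z t)) * cis t) integrable_on {0..2*pi}"
    by (intro integrable_continuous_interval continuous_intros continuous_on_compose2[OF continuous_u[of UNIV]]) auto
  have "integral {0..2*pi} (\<lambda>t. of_real (u (?z t) - M) * cis t)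
      = integral {0..2*pi} (\<lambda>t. of_real (u (?z t)) * cis t)"
    using Henstock_Kurzweil_Integration.integral_diff[OF intu has_integral_integrable[OF cis0]]
    unfolding integral_unique[OF cis0] by (simp add: left_diff_distrib)
  moreover have "norm (integral {0..2*pi} (\<lambda>t. of_real (u (?z t) - M) * cis t))
     \<le> ?J"
  proof (rule integral_norm_bound_integral)
    show "(\<lambda>t. of_real (u (?z t) - M) * cis t) integrable_on {0..2*pi}"
      by (intro integrable_continuous_interval continuous_intros continuous_on_compose2[OF continuous_u[of UNIV]]) auto
    show "(\<lambda>t. M - u (?z t)) integrable_on {0..2*pi}"
      by (intro integrable_continuous_interval continuous_intros continuous_on_compose2[OF continuous_u[of UNIV]]) auto
    show "norm (of_real (u (?z t) - M) * cis t) \<le> M - u (?z t)" for t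
      unfolding norm_mult norm_of_real using u_le[of "?z t"] by simp
  qed
  ultimately have m2: "norm (?F) \<le> r * (2 * pi * v + 2 * pi * K * v)"
    unfolding circle_integral_weighted norm_mult
    using m1' r by (intro mult_mono) auto
  have "2 * pi * (v * norm (g z0)) = norm (of_real (2 * pi * r ^ 2) * cnj (g z0))"
    using r v by (simp add: norm_mult)
  also have "\<dots> \<le> 2 * pi * K * r ^ 3 + r * (2 * pi * v + 2 * pi * K * v)"
    using circle_first_moment[of r z0] m2 r norm_triangle_sub[of "of_real (2 * pi * r ^ 2) * cnj (g z0)" "?F"]
    by (simp add: norm_minus_commute)
  also have "r ^ 3 = r * v" using r by (simp add: power3_eq_cube power2_eq_square)
  also have "2 * pi * K * (r * v) + r * (2 * pi * v + 2 * pi * K * v) = 2 * pi * (v * ((1 + 2 * K) * r))"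
    by (simp add: algebra_simps)
  finally have "norm (g z0) \<le> (1 + 2 * K) * r"
    using v by simp
  then show ?thesis by (simp add: r_def v_def)
qed

end

section \<open>Polynomial growth of the Schwarzian\<close>

text \<open>
  The sign of the real part of \<open>w\<close> then selects one of the two square roots; this is how continuity
  of \<open>g\<close> is exploited once \<open>g^2\<close> is known approximately.
\<close>
lemma Re_nonzero_if_square_near_1:
  fixes w :: complex
  assumes "norm (w\<^sup>2 - 1) < 1"
  shows "Re w \<noteq> 0"
proof
  assume "Re w = 0"
  then have "w\<^sup>2 = of_real (- (Im w)\<^sup>2)" by (simp add: complex_eq_iff power2_eq_square)
  then have "w\<^sup>2 - 1 = of_real (- (Im w)\<^sup>2 - 1)" by simp
  then have "norm (w\<^sup>2 - 1) = \<bar>- (Im w)\<^sup>2 - 1\<bar>" by (metis norm_of_real)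
  then show False using assms zero_le_power2[of "Im w"] by linarith
qed

context bounded_liouville
begin

text \<open>
  By the gradient bound, \<open>g\<close> is controlled by the square root of the gap \<open>M + 1 - u\<close>, so the
  derivative of that square root is bounded.
\<close>
lemma sqrt_gap_lipschitz:
  "\<bar>sqrt (M + 1 - u z) - sqrt (M + 1 - u w)\<bar> \<le> (1 + 2 * K) * norm (z - w)"
proof -
  have "norm (sqrt (M + 1 - u z) - sqrt (M + 1 - u w)) \<le> (1 + 2 * K) * norm (z - w)"
  proof (rule differentiable_bound[of UNIV])
    fix z
    have v: "M + 1 - u z \<ge> 1" using u_le[of z] by simp
    show "((\<lambda>z. sqrt (M + 1 - u z)) has_derivative (\<lambda>h. - Re (g z * h) / sqrt (M + 1 - u z))) (at z within UNIV)"
      by (rule has_derivative_eq_rhs[OF has_derivative_real_sqrt[OF _ has_derivative_diff[OF has_derivative_const u_derivative]]])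
        (use v in \<open>auto simp: field_simps\<close>)
    show "onorm (\<lambda>h. - Re (g z * h) / sqrt (M + 1 - u z)) \<le> 1 + 2 * K"
    proof (rule onorm_le)
      fix h
      have "norm (- Re (g z * h) / sqrt (M + 1 - u z)) \<le> norm (g z) * norm h / sqrt (M + 1 - u z)"
        using v abs_Re_le_cmod[of "g z * h"] by (auto simp: norm_mult intro!: divide_right_mono)
      also have "\<dots> \<le> (1 + 2 * K) * norm h"
        using mult_right_mono[OF gradient_bound[of z], of "norm h"] v by (simp add: divide_simps mult_ac)
      finally show "norm (- Re (g z * h) / sqrt (M + 1 - u z)) \<le> (1 + 2 * K) * norm h" .
    qed
  qed auto
  then show ?thesis by simp
qed

lemma gradient_growth: obtains C where "C \<ge> 1" "\<And>z. norm (g z) \<le> C * (1 + norm z)"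
proof
  define L where "L = 1 + 2 * K"
  have L: "L \<ge> 1" using K_pos by (simp add: L_def)
  define C where "C = L * (L + sqrt (M + 1 - u 0))"
  have s0: "sqrt (M + 1 - u 0) \<ge> 1" using u_le[of 0] by simp
  have "L + sqrt (M + 1 - u 0) \<ge> 1" using L s0 by linarith
  then have "L * (L + sqrt (M + 1 - u 0)) \<ge> 1 * 1" using L by (intro mult_mono) auto
  then show "C \<ge> 1" by (simp add: C_def)
  fix z
  have "norm (g z) \<le> L * sqrt (M + 1 - u z)" using gradient_bound by (simp add: L_def)
  also have "\<dots> \<le> L * (sqrt (M + 1 - u 0) + L * norm z)"
    using sqrt_gap_lipschitz[of z 0] L unfolding L_def[symmetric] by (intro mult_left_mono) auto
  also have "\<dots> \<le> L * ((L + sqrt (M + 1 - u 0)) * (1 + norm z))"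
    using L s0 by (intro mult_left_mono) (auto simp: algebra_simps)
  finally show "norm (g z) \<le> C * (1 + norm z)" by (simp add: C_def mult_ac)
qed

text \<open>
  The conjugate of \<open>g(z)\<close> is, up to normalisation and an error \<open>K\<close>, the first Fourier coefficient of \<open>u\<close> on the unit circle around
  \<open>z\<close>. Moving the center changes that coefficient by at most the Lipschitz constant \<open>2 A\<close> of \<open>u\<close> times the distance.
  This replaces a Hoelder estimate for \<open>g\<close>.
\<close>
lemma gradient_oscillation:
  assumes A: "\<And>z. dist z0 z \<le> 2 \<Longrightarrow> norm (g z) \<le> A" and z1: "dist z0 z1 \<le> 1"
  shows "norm (g z1 - g z0) \<le> 2 * K + 2 * A * dist z0 z1"
proof -
  let ?m = "\<lambda>z0. circle_integral (\<lambda>z. (z - z0) * of_real (u z)) z0 1"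
  have "A \<ge> 0" using order_trans[OF norm_ge_zero A[of z0]] by simp
  have lip: "\<bar>u z - u w\<bar> \<le> 2 * A * norm (z - w)" if "z \<in> cball z0 2" "w \<in> cball z0 2" for z w
  proof -
    have "norm (u z - u w) \<le> 2 * A * norm (z - w)"
    proof (rule differentiable_bound[of "cball z0 2" _ "\<lambda>z h. 2 * Re (g z * h)"])
      fix z assume z: "z \<in> cball z0 2"
      show "onorm (\<lambda>h. 2 * Re (g z * h)) \<le> 2 * A"
      proof (rule onorm_le)
        fix h
        have "norm (2 * Re (g z * h)) \<le> 2 * (norm (g z) * norm h)"
          using abs_Re_le_cmod[of "g z * h"] by (simp add: norm_mult)
        also have "\<dots> \<le> 2 * (A * norm h)"
          using A[of z] z by (intro mult_left_mono mult_right_mono) auto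
        finally show "norm (2 * Re (g z * h)) \<le> 2 * A * norm h" by simp
      qed
    qed (use that u_derivative in \<open>blast+\<close>)
    then show ?thesis by simp
  qed
  have m: "norm (?m z - of_real (2 * pi) * cnj (g z)) \<le> 2 * pi * K" for z
    using circle_first_moment[of 1 z] by simp
  have int: "(\<lambda>t. of_real (u (z + cis t)) * cis t) integrable_on {0..2*pi}" for z
    by (intro integrable_continuous_interval continuous_intros continuous_on_compose2[OF continuous_u[of UNIV]]) auto
  have "?m z1 - ?m z0 = integral {0..2*pi} (\<lambda>t. of_real (u (z1 + cis t) - u (z0 + cis t)) * cis t)"
    unfolding circle_integral_weighted
    using Henstock_Kurzweil_Integration.integral_diff[OF int[of z1] int[of z0]] by (simp add: left_diff_distrib)
  also have "norm \<dots> \<le> (2 * A * dist z0 z1) * (2 * pi - 0)"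
  proof (rule integral_bound)
    show "continuous_on {0..2*pi} (\<lambda>t. complex_of_real (u (z1 + cis t) - u (z0 + cis t)) * cis t)"
      by (intro continuous_intros continuous_on_compose2[OF continuous_u[of UNIV]]) auto
    fix t
    have "dist z0 (z1 + cis t) \<le> dist z0 z1 + dist z1 (z1 + cis t)"
      by (rule dist_triangle)
    then have 1: "z1 + cis t \<in> cball z0 2" using z1 by (simp add: dist_norm)
    have 2: "z0 + cis t \<in> cball z0 2" by (simp add: dist_norm)
    show "norm (complex_of_real (u (z1 + cis t) - u (z0 + cis t)) * cis t) \<le> 2 * A * dist z0 z1"
      unfolding norm_mult norm_of_real using lip[OF 1 2] by (simp add: dist_norm norm_minus_commute)
  qed auto
  finally have d: "norm (?m z1 - ?m z0) \<le> 2 * pi * (2 * A * dist z0 z1)" by (simp add: mult_ac)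
  have "of_real (2 * pi) * cnj (g z1 - g z0) = (?m z1 - ?m z0) - (?m z1 - of_real (2 * pi) * cnj (g z1)) + (?m z0 - of_real (2 * pi) * cnj (g z0))"
    by (simp add: algebra_simps)
  also have "norm \<dots> \<le> 2 * pi * (2 * A * dist z0 z1) + 2 * pi * K + 2 * pi * K"
    by (rule norm_triangle_le norm_triangle_le_diff add_mono d m order_refl)+
  finally have "norm (of_real (2 * pi) * cnj (g z1 - g z0)) \<le> 2 * pi * (2 * A * dist z0 z1) + 2 * pi * K + 2 * pi * K" .
  then have "2 * pi * norm (g z1 - g z0) \<le> 2 * pi * (2 * K + 2 * A * dist z0 z1)"
    unfolding norm_mult norm_of_real complex_mod_cnj by (simp add: algebra_simps)
  then show ?thesis by (subst (asm) mult_le_cancel_left_pos) auto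
qed

text \<open>
  Let \<open>P = g - Y\<close> be the entire function whose derivative is the Schwarzian. Near \<open>z0\<close> the primitive \<open>Y\<close> differs from its
  linear part \<open>g(z0)^2 (z - z0)\<close> by little, because \<open>g\<close> hardly oscillates. So
  \<open>P(z) - P(z0) + g(z0)^2 (z - z0)\<close> is bounded on a small disc, its derivative at \<open>z0\<close> is
  \<open>p(z0)\<close>, and Cauchy's inequality applies.
\<close>
lemma second_derivative_bound:
  assumes A: "A \<ge> 1" "\<And>z. dist z0 z \<le> 2 \<Longrightarrow> norm (g z) \<le> A"
  shows "norm (p z0) \<le> (7 * K + 6) * A"
proof -
  obtain Y P where Y: "wirtinger Y (\<lambda>z. g z ^ 2) (\<lambda>z. of_real (- exp (2 * u z) / 4))"
    and P: "\<And>z. P z = g z - Y z" and P': "\<And>z. (P has_field_derivative p z - g z ^ 2) (at z)"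
    using schwarzian_entire[OF u g] by blast
  \<comment> \<open>On the disc of radius \<open>1/A\<close> both the oscillation of \<open>g\<close> and the remainder of \<open>Y\<close> are bounded
    independently of \<open>A\<close>, and Cauchy's inequality loses exactly one factor \<open>A\<close>.\<close>
  define r where "r = 1 / A"
  have r: "0 < r" "r \<le> 1" using A by (auto simp: r_def)
  have osc: "norm (g z - g z0) \<le> 2 * K + 2" if "dist z0 z \<le> r" for z
  proof -
    have "norm (g z - g z0) \<le> 2 * K + 2 * A * dist z0 z"
      by (rule gradient_oscillation[OF A(2)]) (use that r in auto)
    also have "\<dots> \<le> 2 * K + 2 * A * r" using that A r by simp
    finally show ?thesis using A by (simp add: r_def)
  qed
  define G where "G z = P z - P z0 + g z0 ^ 2 * (z - z0)" for z
  have G': "(G has_field_derivative p z - g z ^ 2 + g z0 ^ 2) (at z)" for z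
    unfolding G_def by (rule derivative_eq_intros P' refl | simp)+
  have bound: "norm (G z) \<le> 7 * K + 6" if z: "norm (z0 - z) = r" for z
  proof -
    let ?Z = "\<lambda>z. Y z - g z0 ^ 2 * z"
    let ?Z' = "\<lambda>z h. g z ^ 2 * h + of_real (- exp (2 * u z) / 4) * cnj h - g z0 ^ 2 * h"
    have "norm (?Z z - ?Z z0) \<le> (2 * A * (2 * K + 2) + K) * norm (z - z0)"
    proof (rule differentiable_bound[of "cball z0 r" _ "?Z'"])
      fix x assume x: "x \<in> cball z0 r"
      show "(?Z has_derivative (?Z' x)) (at x within cball z0 r)"
        by (rule derivative_eq_intros wirtingerD(1)[OF Y] refl | simp)+
      show "onorm (?Z' x) \<le> 2 * A * (2 * K + 2) + K"
      proof (rule onorm_le)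
        fix h
        have "?Z' x h
          = (g x + g z0) * (g x - g z0) * h + of_real (- exp (2 * u x) / 4) * cnj h"
          by (simp add: algebra_simps power2_eq_square)
        also have "norm \<dots> \<le> (2 * A) * (2 * K + 2) * norm h + K * norm h"
        proof (rule norm_triangle_mono)
          have "norm (g x + g z0) \<le> 2 * A"
            using A(2)[of x] A(2)[of z0] x r norm_triangle_ineq[of "g x" "g z0"] by auto
          then show "norm ((g x + g z0) * (g x - g z0) * h) \<le> (2 * A) * (2 * K + 2) * norm h"
            unfolding norm_mult using osc[of x] x A K_pos by (intro mult_mono) auto
          show "norm (of_real (- exp (2 * u x) / 4) * cnj h) \<le> K * norm h"
            unfolding norm_mult complex_mod_cnj using laplace_bound[of x] K_pos by (intro mult_mono) auto
        qed
        finally show "norm (?Z' x h) \<le> (2 * A * (2 * K + 2) + K) * norm h"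
          by (simp add: algebra_simps)
      qed
    qed (use z r in \<open>auto simp: dist_norm\<close>)
    also have "\<dots> = (2 * A * (2 * K + 2) + K) * r" using z by (simp add: norm_minus_commute)
    also have "\<dots> = 2 * (2 * K + 2) + K * r" using A by (simp add: r_def field_simps)
    also have "\<dots> \<le> 5 * K + 4" using r K_pos mult_left_mono[of r 1 K] by (simp add: algebra_simps)
    finally have Z: "norm (?Z z - ?Z z0) \<le> 5 * K + 4" .
    have "G z = (g z - g z0) - (?Z z - ?Z z0)" by (simp add: G_def P algebra_simps)
    also have "norm \<dots> \<le> (2 * K + 2) + (5 * K + 4)"
      by (rule norm_triangle_le_diff, rule add_mono[OF osc Z]) (use z in \<open>simp add: dist_norm\<close>)
    finally show ?thesis by simp
  qed
  have hol: "G holomorphic_on S" for S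
    using G' by (auto simp: holomorphic_on_def field_differentiable_def intro: has_field_derivative_at_within)
  have "norm ((deriv ^^ 1) G z0) \<le> fact 1 * (7 * K + 6) / r ^ 1"
    using r(1) bound hol holomorphic_on_imp_continuous_on by (intro Cauchy_inequality) auto
  moreover have "deriv G z0 = p z0" using DERIV_imp_deriv[OF G'[of z0]] by simp
  ultimately show ?thesis by (simp add: r_def mult.commute)
qed

text \<open>
  The same estimate with a bound for \<open>g\<close> on a disc around the origin, which fits growth conditions.
\<close>
lemma second_derivative_bound_disc:
  assumes A: "A \<ge> 1" "\<And>w. norm w \<le> norm z + 2 \<Longrightarrow> norm (g w) \<le> A"
  shows "norm (p z) \<le> (7 * K + 6) * A"
proof (rule second_derivative_bound[OF A(1) A(2)])
  fix w assume "dist z w \<le> 2"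
  then show "norm w \<le> norm z + 2"
    using norm_triangle_sub[of w z] by (simp add: dist_norm norm_minus_commute)
qed

lemma linear_growth:
  obtains C where "C \<ge> 1" "\<And>z. norm (g z) \<le> C * (1 + norm z)" "\<And>z. norm (p z) \<le> C * (1 + norm z)"
proof -
  obtain C where C: "C \<ge> 1" "\<And>z. norm (g z) \<le> C * (1 + norm z)" using gradient_growth by metis
  define C' where "C' = (7 * K + 6) * (C * 3)"
  have "(7 * K + 6) * (C * 3) \<ge> 1 * (C * 1)" using C(1) K_pos by (intro mult_mono) auto
  then have C': "C' \<ge> C" by (simp add: C'_def)
  have "norm (g z) \<le> C' * (1 + norm z)" for z
    using C(2)[of z] mult_right_mono[OF C', of "1 + norm z"] by simp
  moreover have "norm (p z) \<le> C' * (1 + norm z)" for z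
  proof -
    have "norm (p z) \<le> (7 * K + 6) * (C * (3 + norm z))"
    proof (rule second_derivative_bound_disc)
      have "C * (3 + norm z) \<ge> 1 * 1" using C(1) by (intro mult_mono) auto
      then show "C * (3 + norm z) \<ge> 1" by simp
      fix w :: complex assume "norm w \<le> norm z + 2"
      then show "norm (g w) \<le> C * (3 + norm z)"
        using C(2)[of w] mult_left_mono[of "1 + norm w" "3 + norm z" C] C(1) by linarith
    qed
    also have "\<dots> \<le> (7 * K + 6) * (C * 3 * (1 + norm z))"
      using C(1) K_pos by (intro mult_left_mono) (auto simp: algebra_simps)
    finally show ?thesis by (simp add: C'_def mult.assoc)
  qed
  ultimately show ?thesis using C(1) C' by (intro that[of C']) auto
qed

text \<open>
  Linear growth of \<open>g\<close> and \<open>p\<close> makes the entire function \<open>p - g^2\<close> grow at most quadratically.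
\<close>
lemma schwarzian_quadratic:
  obtains a b c where "\<forall>z. p z - g z ^ 2 = a + b * z + c * z ^ 2"
proof -
  obtain Y P where "\<And>z. P z = g z - Y z" and P': "\<And>z. (P has_field_derivative p z - g z ^ 2) (at z)"
    using schwarzian_entire[OF u g] by metis
  have hol: "(\<lambda>z. p z - g z ^ 2) holomorphic_on UNIV"
  proof -
    have "P holomorphic_on UNIV" using P' by (auto simp: holomorphic_on_def field_differentiable_def)
    then have "deriv P holomorphic_on UNIV" by (rule holomorphic_deriv) auto
    moreover have "deriv P = (\<lambda>z. p z - g z ^ 2)" using DERIV_imp_deriv[OF P'] by auto
    ultimately show ?thesis by simp
  qed
  obtain C where C: "C \<ge> 1" "\<And>z. norm (g z) \<le> C * (1 + norm z)" "\<And>z. norm (p z) \<le> C * (1 + norm z)"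
    using linear_growth by metis
  define B where "B = 2 * C + (2 * C) ^ 2"
  have "norm (p z - g z ^ 2) \<le> B * norm z ^ 2" if z: "1 \<le> norm z" for z
  proof -
    have lin: "C * (1 + norm z) \<le> 2 * C * norm z"
    proof -
      have "C * (1 + norm z) \<le> C * (2 * norm z)" using z C(1) by (intro mult_left_mono) auto
      then show ?thesis by (simp add: mult_ac)
    qed
    also have "\<dots> \<le> 2 * C * norm z ^ 2"
      using self_le_power[OF z, of 2] C(1) by (intro mult_left_mono) auto
    finally have 1: "norm (p z) \<le> 2 * C * norm z ^ 2" using C(3)[of z] by linarith
    have "norm (g z) \<le> 2 * C * norm z" using C(2)[of z] lin by linarith
    then have 2: "norm (g z ^ 2) \<le> (2 * C * norm z) ^ 2"
      unfolding norm_power by (intro power_mono) auto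
    show ?thesis
      using norm_triangle_le_diff[OF add_mono[OF 1 2]] by (simp add: B_def algebra_simps power_mult_distrib)
  qed
  note bnd = this
  define c where "c k = (deriv ^^ k) (\<lambda>z. p z - g z ^ 2) 0 / fact k" for k
  have sum: "(\<Sum>k\<le>2. c k * z ^ k) = c 0 + c 1 * z + c 2 * z ^ 2" for z
    by (simp add: numeral_2_eq_2)
  have "p z - g z ^ 2 = c 0 + c 1 * z + c 2 * z ^ 2" for z
    unfolding sum[symmetric] unfolding c_def by (rule Liouville_polynomial[OF hol bnd])
  then show ?thesis by (intro that[of "c 0" "c 1" "c 2"]) (rule allI)
qed

end

context bounded_liouville
begin

text \<open>
  Suppose \<open>c \<noteq> 0\<close>. As \<open>p\<close> grows only linearly, \<open>g^2 = - c z^2 + O(\<bar>z\<bar>)\<close>. Outside a large disc, a connected set, \<open>g\<close> is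
  therefore close to one and the same square root \<open>\<beta> z\<close>, up to a bounded error. Then \<open>u\<close> differs from the real part of
  \<open>\<beta> z^2\<close> by at most linear growth, and that is unbounded above along a suitable ray.
\<close>
lemma schwarzian_not_quadratic:
  assumes Q: "\<forall>z. p z - g z ^ 2 = a + b * z + c * z ^ 2"
  shows "c = 0"
proof (rule ccontr)
  assume c: "c \<noteq> 0"
  obtain C where C: "C \<ge> 1" "\<And>z. norm (g z) \<le> C * (1 + norm z)" "\<And>z. norm (p z) \<le> C * (1 + norm z)"
    using linear_growth by metis
  define B where "B = 2 * C + norm a + norm b"
  have B: "B > 0" using C(1) by (auto simp: B_def intro!: add_pos_nonneg)
  define \<beta> where "\<beta> = csqrt (- c)"
  have \<beta>: "\<beta> ^ 2 = - c" "\<beta> \<noteq> 0" using c by (auto simp: \<beta>_def)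
  have error: "norm (g z ^ 2 - (\<beta> * z) ^ 2) \<le> B * norm z" if z: "norm z \<ge> 1" for z
  proof -
    have 1: "norm (p z) \<le> 2 * C * norm z"
    proof -
      have "C * (1 + norm z) \<le> C * (2 * norm z)" using z C(1) by (intro mult_left_mono) auto
      then show ?thesis using C(3)[of z] by (simp add: mult_ac)
    qed
    have 2: "norm (a + b * z) \<le> norm a * norm z + norm b * norm z"
      using z by (intro norm_triangle_le add_mono) (auto simp: norm_mult mult_le_cancel_left1)
    have "g z ^ 2 - (\<beta> * z) ^ 2 = p z - (a + b * z)"
      using Q[rule_format, of z] by (simp add: power_mult_distrib \<beta> algebra_simps)
    also have "norm \<dots> \<le> 2 * C * norm z + (norm a * norm z + norm b * norm z)"
      by (rule norm_triangle_le_diff add_mono 1 2)+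
    also have "\<dots> = B * norm z" by (simp add: B_def algebra_simps)
    finally show ?thesis .
  qed
  define k where "k z = g z / (\<beta> * z)" for z
  have ksq: "norm ((k z)\<^sup>2 - 1) \<le> B / (norm c * norm z)" if z: "norm z \<ge> 1" for z
  proof -
    have nz: "z \<noteq> 0" using z by auto
    have "(k z)\<^sup>2 - 1 = (g z ^ 2 - (\<beta> * z) ^ 2) / (\<beta> * z) ^ 2"
      using nz \<beta> by (simp add: k_def power_divide diff_divide_distrib)
    also have "norm \<dots> = norm (g z ^ 2 - (\<beta> * z) ^ 2) / (norm c * norm z ^ 2)"
      by (simp add: norm_divide norm_power norm_mult power_mult_distrib \<beta> flip: norm_power[of \<beta>])
    also have "\<dots> \<le> B * norm z / (norm c * norm z ^ 2)"
      by (rule divide_right_mono[OF error[OF z]]) auto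
    also have "\<dots> = B / (norm c * norm z)" using nz by (simp add: power2_eq_square)
    finally show ?thesis .
  qed
  \<comment> \<open>Beyond this radius the square of the quotient \<open>k\<close> is within distance 1 of 1.\<close>
  define R where "R = max 1 (2 * B / norm c)"
  define S where "S = - ball (0::complex) R"
  have S: "norm z \<ge> 1" "norm ((k z)\<^sup>2 - 1) < 1" if "z \<in> S" for z
  proof -
    have "norm z \<ge> R" using that by (simp add: S_def)
    then have z: "norm z \<ge> 1" "norm z \<ge> 2 * B / norm c" by (auto simp: R_def)
    then show "norm z \<ge> 1" by simp
    have "B / (norm c * norm z) < 1"
      using z c B by (auto simp: field_simps)
    with ksq[OF z(1)] show "norm ((k z)\<^sup>2 - 1) < 1" by simp
  qed
  have cont: "continuous_on S (\<lambda>z. Re (k z))"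
    unfolding k_def using S(1) \<beta> by (intro continuous_intros continuous_g) force+
  have "connected S"
    unfolding S_def by (rule connected_complement_bounded_convex) auto
  then have "connected ((\<lambda>z. Re (k z)) ` S)" by (rule connected_continuous_image[OF cont])
  then have "0 \<in> (\<lambda>z. Re (k z)) ` S" if "z \<in> S" "w \<in> S" "Re (k z) \<le> 0" "Re (k w) \<ge> 0" for z w
    by (rule connectedD_interval[of _ "Re (k z)" "Re (k w)"]) (use that in auto)
  moreover have nz: "0 \<notin> (\<lambda>z. Re (k z)) ` S"
    using Re_nonzero_if_square_near_1[OF S(2)] by force
  ultimately have no_change: "\<not> (Re (k z) \<le> 0 \<and> Re (k w) \<ge> 0)" if "z \<in> S" "w \<in> S" for z w
    using that by blast
  have "(\<forall>z\<in>S. Re (k z) > 0) \<or> (\<forall>z\<in>S. Re (k z) < 0)"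
  proof (rule ccontr)
    assume "\<not> ?thesis"
    then obtain z w where "z \<in> S" "w \<in> S" "Re (k z) \<le> 0" "Re (k w) \<ge> 0"
      by (auto simp: not_less)
    with no_change show False by blast
  qed
  then obtain \<sigma> :: complex where \<sigma>: "\<sigma> ^ 2 = 1" "\<And>z. z \<in> S \<Longrightarrow> Re (\<sigma> * k z) > 0"
  proof
    assume "\<forall>z\<in>S. Re (k z) > 0" then show ?thesis by (intro that[of 1]) auto
  next
    assume "\<forall>z\<in>S. Re (k z) < 0" then show ?thesis by (intro that[of "-1"]) auto
  qed
  define \<beta>' where "\<beta>' = \<sigma> * \<beta>"
  have "\<sigma> \<noteq> 0" using \<sigma> by auto
  then have \<beta>': "\<beta>' \<noteq> 0" using \<beta> by (auto simp: \<beta>'_def)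
  define D where "D = norm \<beta>' * (B / norm c)"
  have close: "norm (g z - \<beta>' * z) \<le> D" if z: "z \<in> S" for z
  proof -
    have nz: "z \<noteq> 0" using S(1)[OF z] by auto
    let ?w = "\<sigma> * k z"
    have "1 \<le> Re (?w + 1)" using \<sigma>(2)[OF z] by simp
    also have "\<dots> \<le> norm (?w + 1)" by (rule complex_Re_le_cmod)
    finally have "norm (?w - 1) * 1 \<le> norm (?w - 1) * norm (?w + 1)"
      by (intro mult_left_mono) auto
    also have "\<dots> = norm (?w ^ 2 - 1)"
      unfolding norm_mult[symmetric] by (simp add: algebra_simps power2_eq_square)
    also have "\<dots> \<le> B / (norm c * norm z)"
      using ksq[OF S(1)[OF z]] \<sigma> by (simp add: power_mult_distrib)
    finally have w: "norm (?w - 1) \<le> B / (norm c * norm z)" by simp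
    have "g z - \<beta>' * z = (\<beta>' * z) * (?w - 1)"
      using \<sigma>(1) nz \<beta> \<open>\<sigma> \<noteq> 0\<close> by (simp add: \<beta>'_def k_def field_simps power2_eq_square)
    also have "norm \<dots> \<le> (norm \<beta>' * norm z) * (B / (norm c * norm z))"
      unfolding norm_mult using w by (intro mult_left_mono) (auto simp: norm_mult)
    also have "\<dots> = D" using nz by (simp add: D_def)
    finally show ?thesis .
  qed
  \<comment> \<open>The direction in which \<open>\<beta>' z^2\<close> is positive.\<close>
  define e where "e = csqrt (cnj \<beta>' / of_real (norm \<beta>'))"
  have e2: "e ^ 2 = cnj \<beta>' / of_real (norm \<beta>')" by (simp add: e_def)
  then have "norm e ^ 2 = 1" using \<beta>' by (simp add: norm_divide flip: norm_power)
  then have ne: "norm e = 1" by (simp add: power2_eq_1_iff) (use norm_ge_zero[of e] in linarith)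
  have \<beta>e: "\<beta>' * e ^ 2 = of_real (norm \<beta>')"
    unfolding e2 using \<beta>' complex_norm_square[of \<beta>'] by (simp add: power2_eq_square divide_eq_eq)
  \<comment> \<open>Beyond \<open>R'\<close> the derivative of \<open>u\<close> along the ray is at least 1.\<close>
  define R' where "R' = max R ((1 + 2 * D) / (2 * norm \<beta>'))"
  have R': "R' \<ge> R" "R' \<ge> 1" "2 * norm \<beta>' * R' \<ge> 1 + 2 * D"
  proof -
    have "R' \<ge> (1 + 2 * D) / (2 * norm \<beta>')" by (simp add: R'_def)
    then show "2 * norm \<beta>' * R' \<ge> 1 + 2 * D" using \<beta>' by (simp add: field_simps)
  qed (auto simp: R'_def R_def)
  have "u (of_real (R' + s) * e) - u (of_real R' * e) \<ge> s" if s: "s > 0" for s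
  proof -
    have der: "((\<lambda>r. u (of_real r * e)) has_real_derivative 2 * Re (g (of_real r * e) * e)) (at r)" for r
    proof -
      have "((\<lambda>r. of_real r * e) has_derivative (\<lambda>t. of_real t * e)) (at r)"
        by (auto intro!: derivative_eq_intros)
      from has_derivative_compose[OF this u_derivative]
      show ?thesis by (rule has_derivative_imp_has_field_derivative) (simp add: algebra_simps)
    qed
    obtain \<xi> where \<xi>: "R' < \<xi>" "\<xi> < R' + s"
      and mv: "u (of_real (R' + s) * e) - u (of_real R' * e) = (R' + s - R') * (2 * Re (g (of_real \<xi> * e) * e))"
      using MVT2[of R' "R' + s" "\<lambda>r. u (of_real r * e)" "\<lambda>r. 2 * Re (g (of_real r * e) * e)"] der s by auto
    let ?z = "of_real \<xi> * e"
    have "?z \<in> S" using R' \<xi> ne by (simp add: S_def norm_mult)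
    from close[OF this] have cl: "norm ((g ?z - \<beta>' * ?z) * e) \<le> D" using ne by (simp add: norm_mult)
    have "g ?z * e = (g ?z - \<beta>' * ?z) * e + of_real \<xi> * (\<beta>' * e ^ 2)"
      by (simp add: algebra_simps power2_eq_square)
    also have "\<dots> = (g ?z - \<beta>' * ?z) * e + of_real (\<xi> * norm \<beta>')" by (simp add: \<beta>e)
    finally have "Re (g ?z * e) = Re ((g ?z - \<beta>' * ?z) * e) + \<xi> * norm \<beta>'" by simp
    moreover have "R' * norm \<beta>' \<le> \<xi> * norm \<beta>'"
      using \<xi> by (intro mult_right_mono) auto
    moreover have "Re ((g ?z - \<beta>' * ?z) * e) \<ge> - D"
      using cl abs_Re_le_cmod[of "(g ?z - \<beta>' * ?z) * e"] by linarith
    moreover have "2 * (R' * norm \<beta>') \<ge> 1 + 2 * D" using R'(3) by (simp add: mult_ac)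
    ultimately have "2 * Re (g ?z * e) \<ge> 1" by linarith
    then show ?thesis unfolding mv using s by (simp add: mult_le_cancel_left1)
  qed
  note grow = this
  define s where "s = max 1 (M - u (of_real R' * e) + 1)"
  have "u (of_real (R' + s) * e) - u (of_real R' * e) \<ge> s" by (rule grow) (simp add: s_def)
  moreover have "s \<ge> M - u (of_real R' * e) + 1" by (simp add: s_def)
  ultimately show False using u_le[of "of_real (R' + s) * e"] by linarith
qed

text \<open>
  Suppose \<open>b \<noteq> 0\<close>. Then \<open>g^2 = p - a - b z\<close> has linear growth, hence \<open>g\<close> and, by the second derivative bound, \<open>p\<close>
  are of order \<open>\<bar>z\<bar>^(1/2)\<close>, and so \<open>g^2\<close> is asymptotic to \<open>- b z\<close>. On a large circle \<open>g\<close> would be a continuous function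
  close to a square root of \<open>- b z\<close>, but continuing that square root once around the circle changes its sign.
\<close>
lemma schwarzian_not_linear:
  assumes Q: "\<forall>z. p z - g z ^ 2 = a + b * z"
  shows "b = 0"
proof (rule ccontr)
  assume b: "b \<noteq> 0"
  obtain C where C: "C \<ge> 1" "\<And>z. norm (g z) \<le> C * (1 + norm z)" "\<And>z. norm (p z) \<le> C * (1 + norm z)"
    using linear_growth by metis
  define B where "B = C + norm a + norm b"
  have B: "B \<ge> 1" using C(1) by (simp add: B_def add_increasing2)
  have gsq: "norm (g z) \<le> sqrt (B * (1 + norm z))" for z
  proof -
    have 2: "norm (a + b * z) \<le> norm a * (1 + norm z) + norm b * (1 + norm z)"
      by (intro norm_triangle_le add_mono) (auto simp: norm_mult algebra_simps)
    have "g z ^ 2 = p z - (a + b * z)" using Q[rule_format, of z] by (simp add: algebra_simps)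
    also have "norm \<dots> \<le> C * (1 + norm z) + (norm a * (1 + norm z) + norm b * (1 + norm z))"
      by (rule norm_triangle_le_diff add_mono C(3) 2)+
    also have "\<dots> = B * (1 + norm z)" by (simp add: B_def algebra_simps)
    finally have "norm (g z) ^ 2 \<le> B * (1 + norm z)" by (simp add: norm_power)
    then show ?thesis by (rule real_le_rsqrt)
  qed
  define \<beta> where "\<beta> = csqrt (- b)"
  have \<beta>: "\<beta> ^ 2 = - b" "\<beta> \<noteq> 0" using b by (auto simp: \<beta>_def)
  define E where "E = (7 * K + 6) * (2 * sqrt B) + norm a"
  have E: "E \<ge> 0" using K_pos B by (simp add: E_def)
  have error: "norm (g z ^ 2 + b * z) \<le> E * sqrt (norm z)" if z: "norm z \<ge> 1" for z
  proof -
    have "norm (p z) \<le> (7 * K + 6) * sqrt (B * (3 + norm z))"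
    proof (rule second_derivative_bound_disc)
      have "B * (3 + norm z) \<ge> 1 * 1" using B by (intro mult_mono) auto
      then show "sqrt (B * (3 + norm z)) \<ge> 1" by simp
      fix w :: complex assume w: "norm w \<le> norm z + 2"
      show "norm (g w) \<le> sqrt (B * (3 + norm z))"
        by (rule order_trans[OF gsq], rule real_sqrt_le_mono, rule mult_left_mono) (use w B in auto)
    qed
    also have "\<dots> \<le> (7 * K + 6) * sqrt (B * (4 * norm z))"
      using z B K_pos by (intro mult_left_mono real_sqrt_le_mono) auto
    also have "sqrt (B * (4 * norm z)) = 2 * sqrt B * sqrt (norm z)"
      by (simp add: real_sqrt_mult)
    finally have 1: "norm (p z) \<le> (7 * K + 6) * (2 * sqrt B * sqrt (norm z))" .
    have 2: "norm a \<le> norm a * sqrt (norm z)" using z by (simp add: mult_le_cancel_left1)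
    have "g z ^ 2 + b * z = p z - a" using Q[rule_format, of z] by (simp add: algebra_simps)
    also have "norm \<dots> \<le> (7 * K + 6) * (2 * sqrt B * sqrt (norm z)) + norm a * sqrt (norm z)"
      by (rule norm_triangle_le_diff add_mono 1 2)+
    also have "\<dots> = E * sqrt (norm z)" by (simp add: E_def algebra_simps)
    finally show ?thesis .
  qed
  \<comment> \<open>Chosen so that the error \<open>E sqrt R\<close> is smaller than \<open>\<bar>b\<bar> R\<close>.\<close>
  define R where "R = (E / norm b + 1) ^ 2"
  have "E / norm b \<ge> 0" using E by simp
  then have R: "R \<ge> 1" "sqrt R = E / norm b + 1" by (auto simp: R_def one_le_power)
  have small: "E * sqrt R < norm b * R"
  proof -
    have "E < norm b * sqrt R" using b R by (simp add: field_simps)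
    then have "E * sqrt R < norm b * sqrt R * sqrt R" using R(1) by (intro mult_strict_right_mono) auto
    also have "norm b * sqrt R * sqrt R = norm b * R" using R(1) by (simp add: mult.assoc)
    finally show ?thesis .
  qed
  define k where "k t = g (of_real R * cis t) / (\<beta> * of_real (sqrt R) * cis (t / 2))" for t
  have sqR: "of_real (sqrt R) ^ 2 = complex_of_real R" using R(1) by (simp flip: of_real_power)
  have "norm ((k t)\<^sup>2 - 1) < 1" for t
  proof -
    let ?z = "of_real R * cis t"
    have nz: "norm ?z = R" using R by (simp add: norm_mult)
    have "(k t)\<^sup>2 = g ?z ^ 2 / (- b * ?z)"
      unfolding k_def power_divide power_mult_distrib \<beta> sqR by (simp add: Complex.DeMoivre mult.assoc)
    then have "(k t)\<^sup>2 - 1 = (g ?z ^ 2 + b * ?z) / (- b * ?z)"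
      using b R by (simp add: field_simps)
    also have "norm \<dots> = norm (g ?z ^ 2 + b * ?z) / (norm b * R)"
      using nz by (simp only: norm_divide norm_mult norm_minus_cancel)
    also have "\<dots> \<le> E * sqrt R / (norm b * R)"
      using error[of ?z] nz R by (intro divide_right_mono) auto
    also have "\<dots> < 1" using small b R by simp
    finally show ?thesis .
  qed
  then have nz: "Re (k t) \<noteq> 0" for t by (rule Re_nonzero_if_square_near_1)
  have cont: "continuous_on {0..2*pi} (\<lambda>t. Re (k t))"
    unfolding k_def using \<beta> R(1)
    by (intro continuous_intros continuous_on_compose2[OF continuous_g[of UNIV]]) auto
  \<comment> \<open>The half angle in \<open>k\<close> causes the change of sign after a full turn.\<close>
  have end0: "k (2 * pi) = - k 0" by (simp add: k_def)
  have "\<exists>t. Re (k t) = 0"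
  proof (cases "Re (k 0) \<le> 0")
    case True
    then show ?thesis using IVT'[of "\<lambda>t. Re (k t)" 0 0 "2*pi"] cont end0 by auto
  next
    case False
    then show ?thesis using IVT2'[of "\<lambda>t. Re (k t)" "2*pi" 0 0] cont end0 by auto
  qed
  with nz show False by blast
qed

theorem schwarzian_constant: obtains q where "\<forall>z. p z = g z ^ 2 + q"
proof -
  obtain a b c where Q: "\<forall>z. p z - g z ^ 2 = a + b * z + c * z ^ 2" by (rule schwarzian_quadratic)
  with schwarzian_not_quadratic[OF Q] have "\<forall>z. p z - g z ^ 2 = a + b * z" by simp
  with schwarzian_not_linear[OF this] have "\<forall>z. p z = g z ^ 2 + a" by (simp add: algebra_simps)
  then show ?thesis by (rule that)
qed

end

section \<open>Solutions bounded above\<close>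

text \<open>
  The logarithmic density of the round metric in stereographic coordinates.
\<close>
definition bubble :: "complex \<Rightarrow> real" where
  "bubble w = ln (2 / (1 + norm w ^ 2))"

text \<open>
  The logarithmic density of the metric on the universal cover of a sphere without two points. For \<open>S = 0\<close> these points are antipodal, and the
  profile depends on the real part alone.
\<close>
definition periodic_profile :: "real \<Rightarrow> complex \<Rightarrow> real" where
  "periodic_profile S w = - ln (sqrt (1 + S ^ 2) * cosh (Re w) + S * cos (Im w))"

lemma wirtinger_zero_constant:
  assumes "wirtinger F (\<lambda>_. 0) (\<lambda>_. 0)"
  shows "F z = F 0"
proof -
  have "(F has_derivative (\<lambda>_. 0)) (at z within UNIV)" for z
    using wirtingerD(1)[OF assms, of z UNIV] by simp
  then obtain c where "\<And>z. F z = c"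
    using has_derivative_zero_constant[of UNIV F] by auto
  then show ?thesis by simp
qed

text \<open>
  Multiplication with the inverse exponential leaves a function with vanishing derivatives.
\<close>
lemma wirtinger_linear_ode:
  assumes "wirtinger F (\<lambda>z. \<kappa> * F z) (\<lambda>z. \<nu> * F z)"
  shows "F z = F 0 * exp (\<kappa> * z + \<nu> * cnj z)"
proof -
  let ?L = "\<lambda>z. - (\<kappa> * z + \<nu> * cnj z)"
  have "wirtinger ?L (\<lambda>_. - \<kappa>) (\<lambda>_. - \<nu>)"
    by (rule wirtinger_cong[OF wirtinger_diff[OF wirtinger_cmult[OF wirtinger_ident, of "-\<kappa>"] 
            wirtinger_cmult[OF wirtinger_cnj[OF wirtinger_ident], of "\<nu>"]]]) auto
  from wirtinger_mult[OF assms wirtinger_exp[OF this]]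
  have "wirtinger (\<lambda>z. F z * exp (?L z)) (\<lambda>_. 0) (\<lambda>_. 0)"
    by (rule wirtinger_cong) auto
  from wirtinger_zero_constant[OF this, of z] have "F z * exp (?L z) = F 0" by simp
  moreover have "F z = F z * exp (?L z) * exp (\<kappa> * z + \<nu> * cnj z)"
    by (simp only: mult.assoc exp_add[symmetric]) simp
  ultimately show ?thesis by simp
qed

context liouville_gradient
begin

definition \<Phi> where "\<Phi> z = complex_of_real (exp (- u z))"
definition grad\<Phi> where "grad\<Phi> z = - g z * \<Phi> z"
definition lap\<Phi> where "lap\<Phi> z = (g z * cnj (g z) + of_real (exp (2 * u z) / 4)) * \<Phi> z"

lemma \<Phi>_real: "cnj (\<Phi> z) = \<Phi> z" "Re (\<Phi> z) > 0" and lap\<Phi>_real: "cnj (lap\<Phi> z) = lap\<Phi> z" "Re (lap\<Phi> z) > 0"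
proof -
  have m_alt: "lap\<Phi> z = of_real ((norm (g z) ^ 2 + exp (2 * u z) / 4) * exp (- u z))"
    by (simp only: lap\<Phi>_def \<Phi>_def complex_norm_square[symmetric] of_real_add[symmetric] of_real_mult[symmetric])
  show "cnj (\<Phi> z) = \<Phi> z" "Re (\<Phi> z) > 0" "cnj (lap\<Phi> z) = lap\<Phi> z" "Re (lap\<Phi> z) > 0"
    unfolding m_alt complex_cnj_complex_of_real Re_complex_of_real
    by (auto simp: \<Phi>_def intro!: mult_pos_pos add_nonneg_pos)
qed

lemma wirtinger_\<Phi>: "wirtinger \<Phi> grad\<Phi> (\<lambda>z. cnj (grad\<Phi> z))"
  by (rule wirtinger_cong[OF wirtinger_exp[OF wirtinger_cmult[OF u, of "-1"]]])
    (auto simp: \<Phi>_def grad\<Phi>_def exp_of_real[symmetric] exp_cnj)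

lemma wirtinger_grad\<Phi>:
  assumes q: "\<forall>z. p z = g z ^ 2 + q"
  shows "wirtinger grad\<Phi> (\<lambda>z. - q * \<Phi> z) lap\<Phi>"
proof -
  show ?thesis
    by (rule wirtinger_cong[OF wirtinger_mult[OF wirtinger_cmult[OF g, of "-1"] wirtinger_\<Phi>]])
      (auto simp: grad\<Phi>_def lap\<Phi>_def q \<Phi>_real algebra_simps power2_eq_square)
qed

lemma wirtinger_lap\<Phi>:
  assumes q: "\<forall>z. p z = g z ^ 2 + q"
  shows "wirtinger lap\<Phi> (\<lambda>z. - q * cnj (grad\<Phi> z)) (\<lambda>z. - cnj q * grad\<Phi> z)"
proof -
  have e2: "exp (2 * complex_of_real (u z)) = complex_of_real (exp (2 * u z))" for z
    by (simp add: exp_of_real[symmetric])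
  have m_eq: "lap\<Phi> z = (g z * cnj (g z) + (1/4) * exp (2 * of_real (u z))) * \<Phi> z" for z
    by (simp add: lap\<Phi>_def e2)
  have "wirtinger (\<lambda>z. (g z * cnj (g z) + (1/4) * exp (2 * of_real (u z))) * \<Phi> z) (\<lambda>z. - q * cnj (grad\<Phi> z)) (\<lambda>z. - cnj q * grad\<Phi> z)"
    by (rule wirtinger_cong[OF wirtinger_mult[OF wirtinger_add[OF wirtinger_mult[OF g wirtinger_cnj[OF g]]
            wirtinger_cmult[OF wirtinger_exp[OF wirtinger_cmult[OF u, of 2]], of "1/4"]] wirtinger_\<Phi>]])
      (simp_all add: grad\<Phi>_def q algebra_simps power2_eq_square e2, simp_all add: \<Phi>_def)
  then show ?thesis by (simp add: m_eq[abs_def])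
qed

text \<open>
  The Liouville equation in terms of \<open>\<Phi> = exp (- u)\<close>. It fixes the normalisation of the constants
  of integration.
\<close>
lemma determinant: "\<Phi> z * lap\<Phi> z - grad\<Phi> z * cnj (grad\<Phi> z) = 1 / 4"
proof -
  have "\<Phi> z * lap\<Phi> z - grad\<Phi> z * cnj (grad\<Phi> z) = complex_of_real (exp (- u z) * exp (- u z) * exp (2 * u z)) / 4"
    by (simp add: lap\<Phi>_def grad\<Phi>_def algebra_simps \<Phi>_def)
  also have "exp (- u z) * exp (- u z) * exp (2 * u z) = 1"
    by (simp flip: exp_add)
  finally show ?thesis by simp
qed

lemma u_eq_\<Phi>: "u z = - ln (Re (\<Phi> z))"
  by (simp add: \<Phi>_def)

text \<open>
  For \<open>Q = 0\<close> the function \<open>\<Phi>\<close> satisfies \<open>\<Phi>_zz = 0\<close> and its Laplacian is constant, so that \<open>\<Phi>\<close> is a quadratic polynomial in the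
  distance to a point.
\<close>
lemma flat_schwarzian_bubble:
  assumes q: "\<forall>z. p z = g z ^ 2"
  obtains k c where "k \<noteq> 0" "\<forall>z. u z = ln (norm k) + bubble (k * z + c)"
proof -
  have q0: "\<forall>z. p z = g z ^ 2 + 0" using q by simp
  have "wirtinger lap\<Phi> (\<lambda>_. 0) (\<lambda>_. 0)"
    by (rule wirtinger_cong[OF wirtinger_lap\<Phi>[OF q0]]) auto
  then have m0: "lap\<Phi> z = lap\<Phi> 0" for z by (rule wirtinger_zero_constant)
  define \<rho> where "\<rho> = Re (lap\<Phi> 0)"
  have \<rho>: "\<rho> > 0" "lap\<Phi> z = of_real \<rho>" for z
    using lap\<Phi>_real[of 0] m0[of z] by (auto simp: \<rho>_def complex_eq_iff)
  have "wirtinger (\<lambda>z. grad\<Phi> z - of_real \<rho> * cnj z) (\<lambda>_. 0) (\<lambda>_. 0)"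
    by (rule wirtinger_cong[OF wirtinger_diff[OF wirtinger_grad\<Phi>[OF q0] wirtinger_cmult[OF wirtinger_cnj[OF wirtinger_ident]]]])
      (auto simp: \<rho>)
  note grad\<Phi>_const = wirtinger_zero_constant[OF this]
  define p0 where "p0 = - cnj (grad\<Phi> 0) / of_real \<rho>"
  have a: "grad\<Phi> z = of_real \<rho> * cnj (z - p0)" for z
    using grad\<Phi>_const[of z] \<rho>(1) by (simp add: p0_def field_simps)
  have "wirtinger (\<lambda>z. \<Phi> z - of_real \<rho> * ((z - p0) * cnj (z - p0))) (\<lambda>_. 0) (\<lambda>_. 0)"
    by (rule wirtinger_cong[OF wirtinger_diff[OF wirtinger_\<Phi> wirtinger_cmult[OF 
            wirtinger_mult[OF wirtinger_diff[OF wirtinger_ident wirtinger_const] 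
              wirtinger_cnj[OF wirtinger_diff[OF wirtinger_ident wirtinger_const]]]]]])
      (auto simp: a)
  note \<Phi>_const = wirtinger_zero_constant[OF this]
  have \<Phi>: "\<Phi> z = \<Phi> p0 + of_real \<rho> * ((z - p0) * cnj (z - p0))" for z
    using \<Phi>_const[of p0] \<Phi>_const[of z] by (simp add: algebra_simps)
  have "\<Phi> p0 = 1 / (4 * of_real \<rho>)"
    using determinant[of p0] \<rho> by (simp add: a field_simps)
  then have \<Phi>': "Re (\<Phi> z) = 1 / (4 * \<rho>) + \<rho> * norm (z - p0) ^ 2" for z
    unfolding \<Phi>[of z] complex_norm_square[symmetric] by (simp flip: of_real_mult of_real_power add: Re_divide_numeral)
  show ?thesis
  proof (rule that[of "of_real (2 * \<rho>)" "- of_real (2 * \<rho>) * p0"])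
    show "\<forall>z. u z = ln (norm (complex_of_real (2 * \<rho>))) + bubble (of_real (2 * \<rho>) * z + - of_real (2 * \<rho>) * p0)"
    proof
      fix z
      have "norm (of_real (2 * \<rho>) * z + - of_real (2 * \<rho>) * p0) = norm (of_real (2 * \<rho>) * (z - p0))"
        by (simp add: algebra_simps)
      also have "\<dots> = 2 * \<rho> * norm (z - p0)" using \<rho> by (simp add: norm_mult)
      finally have n: "norm (of_real (2 * \<rho>) * z + - of_real (2 * \<rho>) * p0) = 2 * \<rho> * norm (z - p0)" .
      have "u z = ln (1 / (1 / (4 * \<rho>) + \<rho> * norm (z - p0) ^ 2))"
        unfolding u_eq_\<Phi> \<Phi>' using \<rho> by (subst ln_div) (auto intro!: add_pos_nonneg)
      also have "1 / (1 / (4 * \<rho>) + \<rho> * norm (z - p0) ^ 2) = (2 * \<rho>) * (2 / (1 + (2 * \<rho> * norm (z - p0)) ^ 2))"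
      proof -
        have "1 / (4 * \<rho>) + \<rho> * norm (z - p0) ^ 2 = (1 + (2 * \<rho> * norm (z - p0)) ^ 2) / (4 * \<rho>)"
          using \<rho> by (simp add: field_simps power2_eq_square)
        then show ?thesis using \<rho> by simp
      qed
      also have "ln \<dots> = ln (2 * \<rho>) + ln (2 / (1 + (2 * \<rho> * norm (z - p0)) ^ 2))"
        using \<rho> by (intro ln_mult_pos) (auto intro!: divide_pos_pos add_pos_nonneg)
      finally show "u z = ln (norm (complex_of_real (2 * \<rho>))) + bubble (of_real (2 * \<rho>) * z + - of_real (2 * \<rho>) * p0)"
        unfolding bubble_def n using \<rho> by (simp add: norm_mult)
    qed
  qed (use \<rho> in auto)
qed

text \<open>
  With \<open>\<kappa>^2 = - q\<close> the function \<open>\<Phi>\<close> satisfies \<open>\<Phi>_zz = \<kappa>^2 \<Phi>\<close> and the conjugate equation. Applying the factors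
  \<open>d/dz \<plusminus> \<kappa>\<close> and their conjugates produces four functions that are exponentials, and \<open>\<Phi>\<close> is a linear combination of them: two real
  exponentials in \<open>Re (k z)\<close> and one conjugate pair of oscillating ones in \<open>Im (k z)\<close>, where \<open>k = 2 \<kappa>\<close>. The determinant identity relates the
  coefficients.
\<close>
lemma nonflat_schwarzian_periodic:
  assumes q: "\<forall>z. p z = g z ^ 2 + q" and "q \<noteq> 0"
  obtains k c S where "k \<noteq> 0" "S \<ge> 0" "\<forall>z. u z = ln (norm k) + periodic_profile S (k * z + c)"
proof -
  define \<kappa> where "\<kappa> = csqrt (- q)"
  have \<kappa>: "\<kappa> ^ 2 = - q" "\<kappa> \<noteq> 0" using \<open>q \<noteq> 0\<close> by (auto simp: \<kappa>_def)
  have \<kappa>': "- q = \<kappa> * \<kappa>" "- cnj q = cnj \<kappa> * cnj \<kappa>"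
    using \<kappa>(1) by (auto simp: power2_eq_square simp flip: complex_cnj_mult)
  note W = wirtinger_\<Phi> wirtinger_grad\<Phi>[OF q] wirtinger_cnj[OF wirtinger_grad\<Phi>[OF q]] wirtinger_lap\<Phi>[OF q]
  \<comment> \<open>The result of applying \<open>d/dz + \<mu>\<close> and \<open>d/d(cnj z) + \<nu>\<close> to \<open>\<Phi>\<close>, for \<open>\<mu> = \<plusminus>\<kappa>\<close> and \<open>\<nu> = \<plusminus>cnj \<kappa>\<close>.\<close>
  define E where "E \<mu> \<nu> z = lap\<Phi> z + \<mu> * cnj (grad\<Phi> z) + \<nu> * grad\<Phi> z + \<mu> * \<nu> * \<Phi> z" for \<mu> \<nu> z
  have E: "wirtinger (E \<mu> \<nu>) (\<lambda>z. \<mu> * E \<mu> \<nu> z) (\<lambda>z. \<nu> * E \<mu> \<nu> z)"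
    if "\<mu> * \<mu> = - q" "\<nu> * \<nu> = - cnj q" for \<mu> \<nu>
  proof (rule wirtinger_cong[OF wirtinger_add[OF wirtinger_add[OF wirtinger_add[OF W(4) wirtinger_cmult[OF W(3), of \<mu>]]
            wirtinger_cmult[OF W(2), of \<nu>]] wirtinger_cmult[OF W(1), of "\<mu> * \<nu>"]]])
    fix z
    show "- q * cnj (grad\<Phi> z) + \<mu> * cnj (lap\<Phi> z) + \<nu> * (- q * \<Phi> z) + \<mu> * \<nu> * grad\<Phi> z = \<mu> * E \<mu> \<nu> z"
      unfolding that(1)[symmetric] by (simp add: E_def lap\<Phi>_real algebra_simps)
    show "- cnj q * grad\<Phi> z + \<mu> * cnj (- q * \<Phi> z) + \<nu> * lap\<Phi> z + \<mu> * \<nu> * cnj (grad\<Phi> z) = \<nu> * E \<mu> \<nu> z"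
      unfolding complex_cnj_mult complex_cnj_minus that(2)[symmetric] by (simp add: E_def \<Phi>_real algebra_simps)
  qed (simp add: E_def)
  have E_exp: "E \<mu> \<nu> z = E \<mu> \<nu> 0 * exp (\<mu> * z + \<nu> * cnj z)" if "\<mu> * \<mu> = - q" "\<nu> * \<nu> = - cnj q" for \<mu> \<nu> z
    using wirtinger_linear_ode[OF E[OF that]] .
  define k where "k = 2 * \<kappa>"
  have k: "k \<noteq> 0" using \<kappa> by (simp add: k_def)
  define \<alpha> \<beta> \<gamma> where "\<alpha> = Re (E \<kappa> (cnj \<kappa>) 0)" "\<beta> = Re (E (- \<kappa>) (- cnj \<kappa>) 0)" "\<gamma> = E \<kappa> (- cnj \<kappa>) 0"
  have Im0: "Im (lap\<Phi> z) = 0" "Im (\<Phi> z) = 0" for z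
    using lap\<Phi>_real(1)[of z] \<Phi>_real(1)[of z] by (auto simp: complex_eq_iff)
  have real: "E \<kappa> (cnj \<kappa>) z = of_real (Re (E \<kappa> (cnj \<kappa>) z))"
       "E (- \<kappa>) (- cnj \<kappa>) z = of_real (Re (E (- \<kappa>) (- cnj \<kappa>) z))" for z
    by (auto simp: E_def complex_eq_iff Im0 algebra_simps)
  have e1: "exp (\<kappa> * z + cnj \<kappa> * cnj z) = of_real (exp (Re (k * z)))"
    and e2: "exp (- \<kappa> * z + - cnj \<kappa> * cnj z) = of_real (exp (- Re (k * z)))"
    and e3: "exp (\<kappa> * z + - cnj \<kappa> * cnj z) = cis (Im (k * z))" for z
  proof -
    have "\<kappa> * z + cnj \<kappa> * cnj z = of_real (Re (k * z))" "- \<kappa> * z + - cnj \<kappa> * cnj z = of_real (- Re (k * z))"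
      "\<kappa> * z + - cnj \<kappa> * cnj z = \<i> * of_real (Im (k * z))"
      by (auto simp: complex_eq_iff k_def algebra_simps)
    then show "exp (\<kappa> * z + cnj \<kappa> * cnj z) = of_real (exp (Re (k * z)))"
     "exp (- \<kappa> * z + - cnj \<kappa> * cnj z) = of_real (exp (- Re (k * z)))"
     "exp (\<kappa> * z + - cnj \<kappa> * cnj z) = cis (Im (k * z))"
      by (simp_all only: exp_of_real cis_conv_exp)
  qed
  have E1: "E \<kappa> (cnj \<kappa>) z = of_real (\<alpha> * exp (Re (k * z)))" for z
    using E_exp[of \<kappa> "cnj \<kappa>" z] \<kappa>' real(1)[of 0] by (simp add: e1 \<alpha>_\<beta>_\<gamma>_def)
  have E2: "E (- \<kappa>) (- cnj \<kappa>) z = of_real (\<beta> * exp (- Re (k * z)))" for z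
    using E_exp[of "-\<kappa>" "-cnj \<kappa>" z] \<kappa>' real(2)[of 0] e2[of z] by (simp add: \<alpha>_\<beta>_\<gamma>_def)
  have E3: "E \<kappa> (- cnj \<kappa>) z = \<gamma> * cis (Im (k * z))" for z
    using E_exp[of "\<kappa>" "-cnj \<kappa>" z] \<kappa>' e3[of z] by (simp add: \<alpha>_\<beta>_\<gamma>_def)
  have kk: "\<kappa> * cnj \<kappa> = of_real (norm k ^ 2 / 4)"
    using complex_norm_square[of \<kappa>] by (simp add: k_def norm_mult power_mult_distrib)
  have "norm k ^ 2 * Re (\<Phi> z) = \<alpha> * exp (Re (k * z)) + \<beta> * exp (- Re (k * z)) - 2 * Re (\<gamma> * cis (Im (k * z)))" for z
  proof -
    have "E \<kappa> (cnj \<kappa>) z + E (- \<kappa>) (- cnj \<kappa>) z - (E \<kappa> (- cnj \<kappa>) z + cnj (E \<kappa> (- cnj \<kappa>) z)) = 4 * (\<kappa> * cnj \<kappa>) * \<Phi> z"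
      by (simp add: E_def lap\<Phi>_real \<Phi>_real algebra_simps)
    then have "Re (4 * (\<kappa> * cnj \<kappa>) * \<Phi> z) = Re (E \<kappa> (cnj \<kappa>) z) + Re (E (- \<kappa>) (- cnj \<kappa>) z) - 2 * Re (E \<kappa> (- cnj \<kappa>) z)"
      by (subst (asm) eq_commute) (simp only: minus_complex.sel plus_complex.sel complex_cnj, simp)
    then show ?thesis unfolding E1 E2 E3 kk by simp
  qed
  note \<Phi>_eq = this
  have det: "\<alpha> * \<beta> - norm \<gamma> ^ 2 = norm k ^ 2 / 4"
  proof -
    have "E \<kappa> (cnj \<kappa>) 0 * E (- \<kappa>) (- cnj \<kappa>) 0 - E \<kappa> (- cnj \<kappa>) 0 * cnj (E \<kappa> (- cnj \<kappa>) 0) = 4 * (\<kappa> * cnj \<kappa>) * (\<Phi> 0 * lap\<Phi> 0 - grad\<Phi> 0 * cnj (grad\<Phi> 0))"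
      by (simp add: E_def lap\<Phi>_real \<Phi>_real algebra_simps)
    then have "of_real (\<alpha> * \<beta> - norm \<gamma> ^ 2) = complex_of_real (norm k ^ 2 / 4)"
      using complex_norm_square[of \<gamma>] unfolding determinant kk E1 E2 E3 by simp
    then show ?thesis by (simp only: of_real_eq_iff)
  qed
  have pos: "\<alpha> > 0" "\<beta> > 0"
  proof -
    have "\<alpha> * \<beta> > 0" using det k by (smt (verit) zero_less_power2 zero_le_power2 norm_eq_zero divide_pos_pos)
    moreover have "of_real (\<alpha> + \<beta>) = E \<kappa> (cnj \<kappa>) 0 + E (- \<kappa>) (- cnj \<kappa>) 0"
      by (simp add: E1 E2)
    then have "of_real (\<alpha> + \<beta>) = 2 * (lap\<Phi> 0 + (\<kappa> * cnj \<kappa>) * \<Phi> 0)"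
      unfolding E_def by (simp only: algebra_simps) simp
    then have "\<alpha> + \<beta> = Re (2 * (lap\<Phi> 0 + (\<kappa> * cnj \<kappa>) * \<Phi> 0))" by (metis Re_complex_of_real)
    then have "\<alpha> + \<beta> > 0" unfolding kk using lap\<Phi>_real(2)[of 0] \<Phi>_real(2)[of 0]
      by (simp add: add_pos_nonneg)
    ultimately show "\<alpha> > 0" "\<beta> > 0" by (auto simp: zero_less_mult_iff)
  qed
  define s where "s = ln (\<alpha> / \<beta>) / 2"
  define c where "c = Complex s (Arg (- \<gamma>))"
  define S where "S = 2 * norm \<gamma> / norm k"
  define CC where "CC = 2 * sqrt (\<alpha> * \<beta>) / norm k"
  have CC: "CC = sqrt (1 + S ^ 2)"
  proof (rule real_sqrt_unique[symmetric])
    have "CC ^ 2 = 4 * (\<alpha> * \<beta>) / norm k ^ 2" using pos by (simp add: CC_def power_divide power_mult_distrib)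
    also have "\<alpha> * \<beta> = norm \<gamma> ^ 2 + norm k ^ 2 / 4" using det by simp
    also have "4 * (norm \<gamma> ^ 2 + norm k ^ 2 / 4) / norm k ^ 2 = 1 + S ^ 2"
      using k by (simp add: S_def power_divide power_mult_distrib field_simps)
    finally show "CC ^ 2 = 1 + S ^ 2" .
    show "CC \<ge> 0" using pos by (simp add: CC_def)
  qed
  have es: "exp s = sqrt (\<alpha> * \<beta>) / \<beta>" "exp (- s) = sqrt (\<alpha> * \<beta>) / \<alpha>"
  proof -
    have "exp s = sqrt (\<alpha> / \<beta>)"
      using pos by (simp add: s_def ln_sqrt[symmetric])
    then show 1: "exp s = sqrt (\<alpha> * \<beta>) / \<beta>"
      using pos real_sqrt_unique[of "sqrt (\<alpha> * \<beta>) / \<beta>" "\<alpha> / \<beta>"]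
      by (simp add: power_divide power2_eq_square)
    show "exp (- s) = sqrt (\<alpha> * \<beta>) / \<alpha>"
      unfolding exp_minus 1 using pos by (simp add: field_simps)
  qed
  have "Re (\<Phi> z) = (CC * cosh (Re (k * z + c)) + S * cos (Im (k * z + c))) / norm k" for z
  proof -
    have "2 * sqrt (\<alpha> * \<beta>) * cosh (Re (k * z) + s) = sqrt (\<alpha> * \<beta>) * exp s * exp (Re (k * z)) + sqrt (\<alpha> * \<beta>) * exp (- s) * exp (- Re (k * z))"
    proof -
      have "2 * q * cosh (x + s) = q * exp s * exp x + q * exp (- s) * exp (- x)" for q x :: real
        unfolding cosh_field_def minus_add_distrib exp_add by (simp add: algebra_simps)
      then show ?thesis .
    qed
    also have "\<dots> = \<alpha> * exp (Re (k * z)) + \<beta> * exp (- Re (k * z))"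
      unfolding es using pos by simp
    finally have h1: "2 * sqrt (\<alpha> * \<beta>) * cosh (Re (k * z) + s) = \<alpha> * exp (Re (k * z)) + \<beta> * exp (- Re (k * z))" .
    have "- \<gamma> = of_real (norm \<gamma>) * cis (Arg (- \<gamma>))"
      by (cases "\<gamma> = 0") (simp_all add: complex_eq_iff cos_Arg sin_Arg)
    then have "Re ((- \<gamma>) * cis (Im (k * z))) = Re (of_real (norm \<gamma>) * cis (Arg (- \<gamma>)) * cis (Im (k * z)))"
      by simp
    then have h2: "- Re (\<gamma> * cis (Im (k * z))) = norm \<gamma> * cos (Im (k * z) + Arg (- \<gamma>))"
      by (simp add: mult.assoc cis_mult add.commute)
    have "norm k ^ 2 * Re (\<Phi> z) = norm k * (CC * cosh (Re (k * z + c)) + S * cos (Im (k * z + c)))"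
      unfolding \<Phi>_eq h1[symmetric] using h2 k by (simp add: CC_def S_def c_def field_simps)
    then have "norm k * Re (\<Phi> z) = CC * cosh (Re (k * z + c)) + S * cos (Im (k * z + c))"
      unfolding power2_eq_square mult.assoc mult_cancel_left using k by simp
    then show ?thesis using k by (simp only: eq_divide_eq norm_eq_zero mult.commute[of "norm k"]) simp
  qed
  note \<Phi>_quot = this
  have "u z = ln (norm k) + periodic_profile S (k * z + c)" for z
  proof -
    have pos: "CC * cosh (Re (k * z + c)) + S * cos (Im (k * z + c)) > 0"
      using \<Phi>_real(2)[of z] k unfolding \<Phi>_quot by (simp only: zero_less_divide_iff) simp
    show ?thesis
      unfolding u_eq_\<Phi> \<Phi>_quot periodic_profile_def CC[symmetric] using pos k
      by (subst ln_div) (simp_all only: norm_eq_zero zero_less_norm_iff, simp)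
  qed
  then show ?thesis
    by (intro that[of k S c]) (auto simp: S_def k)
qed

end

text \<open>
  The two cases are those of a vanishing and of a nonvanishing constant Schwarzian.
\<close>
theorem bounded_liouville_classification:
  assumes "liouville_solution u" "bdd_above (range u)"
  obtains (bubble) k c where "k \<noteq> 0" "\<forall>z. u z = ln (norm k) + bubble (k * z + c)"
  | (periodic) k c S where "k \<noteq> 0" "S \<ge> 0" "\<forall>z. u z = ln (norm k) + periodic_profile S (k * z + c)"
proof -
  obtain g p where *: "wirtinger (\<lambda>z. of_real (u z)) g (\<lambda>z. cnj (g z))"
     "wirtinger g p (\<lambda>z. of_real (- exp (2 * u z) / 4))"
    using liouville_wirtinger[OF assms(1)] by metis
  obtain M where "\<And>z. u z \<le> M" using assms(2) by (auto simp: bdd_above_def)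
  with * interpret bounded_liouville u g p "exp (2 * M)" M by unfold_locales auto
  obtain q where q: "\<forall>z. p z = g z ^ 2 + q" by (rule schwarzian_constant)
  show ?thesis
  proof (cases "q = 0")
    case True
    with q have "\<forall>z. p z = g z ^ 2" by simp
    from flat_schwarzian_bubble[OF this] show ?thesis using bubble by metis
  next
    case False
    from nonflat_schwarzian_periodic[OF q False] show ?thesis using periodic by metis
  qed
qed

section \<open>Behaviour of the explicit solutions\<close>

lemma abs_less_sqrt_add_square: "\<bar>S\<bar> < sqrt (1 + S ^ 2)" for S :: real
  by (rule real_less_rsqrt) simp

lemma has_real_derivative_Re:
  "(f has_vector_derivative D) (at x) \<Longrightarrow> ((\<lambda>x. Re (f x)) has_real_derivative Re D) (at x)"
  unfolding has_real_derivative_iff_has_vector_derivative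
  by (rule bounded_linear.has_vector_derivative[OF bounded_linear_Re])

lemma periodic_denominator_pos: "sqrt (1 + S ^ 2) * cosh x + S * cos y > 0"
proof -
  have "\<bar>S * cos y\<bar> \<le> \<bar>S\<bar> * 1" unfolding abs_mult by (intro mult_left_mono) auto
  also have "\<dots> < sqrt (1 + S ^ 2) * 1" using abs_less_sqrt_add_square by simp
  also have "\<dots> \<le> sqrt (1 + S ^ 2) * cosh x" by (intro mult_left_mono cosh_real_ge_1) auto
  finally show ?thesis by linarith
qed

lemma periodic_profile_eq_iff:
  "periodic_profile S w = periodic_profile S w' \<longleftrightarrow>
    sqrt (1 + S ^ 2) * cosh (Re w) + S * cos (Im w) = sqrt (1 + S ^ 2) * cosh (Re w') + S * cos (Im w')"
  unfolding periodic_profile_def using periodic_denominator_pos by (simp add: ln_inj_iff)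

lemma periodic_profile_period: "periodic_profile S (w + 2 * of_real pi * \<i>) = periodic_profile S w"
  by (simp add: periodic_profile_def)

lemma periodic_solution_period:
  assumes "k \<noteq> 0" "\<forall>z. u z = ln (norm k) + periodic_profile S (k * z + c)"
  shows "u (z + 2 * of_real pi * \<i> / k) = u z"
proof -
  have "k * (z + 2 * of_real pi * \<i> / k) + c = (k * z + c) + 2 * of_real pi * \<i>"
    using assms(1) by (simp add: field_simps)
  then show ?thesis unfolding assms(2)[rule_format] by (simp only: periodic_profile_period)
qed

lemma bubble_solution_radial:
  assumes "k \<noteq> 0" "\<forall>z. u z = ln (norm k) + bubble (k * z + c)"
  shows "radial_about (- c / k) u"
  unfolding radial_about_def
proof (intro exI[of _ "\<lambda>r. ln (norm k) + bubble (of_real (norm k * r))"] allI)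
  fix z
  have "k * z + c = k * (z - (- c / k))" using assms(1) by (simp add: field_simps)
  then have "norm (k * z + c) = norm k * norm (z - (- c / k))" by (simp only: norm_mult)
  then show "u z = ln (norm k) + bubble (of_real (norm k * norm (z - (- c / k))))"
    unfolding assms(2)[rule_format] bubble_def by (simp add: norm_mult)
qed

lemma bubble_solution_vanishes:
  assumes "k \<noteq> 0" "\<forall>z. u z = ln (norm k) + bubble (k * z + c)"
  shows "filterlim u at_bot at_infinity"
proof -
  have 1: "filterlim (\<lambda>z. k * z) at_infinity at_infinity"
    using assms(1) tendsto_mult_filterlim_at_infinity[OF tendsto_const _ filterlim_ident] by blast
  have 2: "filterlim (\<lambda>z. k * z + c) at_infinity at_infinity"
    using tendsto_add_filterlim_at_infinity'[OF 1 tendsto_const] .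
  have "filterlim (\<lambda>z. norm (k * z + c)) at_top at_infinity"
    using filterlim_compose[OF filterlim_norm_at_top 2] .
  moreover have "filterlim (\<lambda>x::real. ln (norm k) + ln (2 / (1 + x ^ 2))) at_bot at_top"
    by real_asymp
  ultimately have "filterlim (\<lambda>z. ln (norm k) + ln (2 / (1 + norm (k * z + c) ^ 2))) at_bot at_infinity"
    by (rule filterlim_compose[rotated])
  moreover have "u = (\<lambda>z. ln (norm k) + ln (2 / (1 + norm (k * z + c) ^ 2)))"
    using assms(2) by (auto simp: bubble_def)
  ultimately show ?thesis by (simp only:)
qed

lemma periodic_solution_not_vanishing:
  assumes "k \<noteq> 0" "\<forall>z. u z = ln (norm k) + periodic_profile S (k * z + c)"
  shows "\<not> filterlim u at_bot at_infinity"
proof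
  assume lim: "filterlim u at_bot at_infinity"
  define T where "T = 2 * of_real pi * \<i> / k"
  have per: "u (of_nat n * T) = u 0" for n
  proof (induction n)
    case (Suc n)
    have "of_nat (Suc n) * T = of_nat n * T + T" by (simp add: algebra_simps)
    then show ?case using periodic_solution_period[OF assms, of "of_nat n * T"] Suc by (simp add: T_def)
  qed simp
  have "eventually (\<lambda>z. u z \<le> u 0 - 1) at_infinity"
    using lim by (simp add: filterlim_at_bot)
  then obtain b where b: "\<And>z. norm z \<ge> b \<Longrightarrow> u z \<le> u 0 - 1" by (auto simp: eventually_at_infinity)
  have "norm T > 0" using assms(1) by (simp add: T_def)
  then obtain n where "real n * norm T > b" by (metis reals_Archimedean3)
  then have "norm (of_nat n * T) \<ge> b" by (simp add: norm_mult)
  from b[OF this] per[of n] show False by simp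
qed

lemma cosh_eq_imp_abs_eq:
  fixes x y :: real
  assumes "cosh x = cosh y"
  shows "\<bar>x\<bar> = \<bar>y\<bar>"
  using cosh_real_nonneg_le_iff[of "\<bar>x\<bar>" "\<bar>y\<bar>"] cosh_real_nonneg_le_iff[of "\<bar>y\<bar>" "\<bar>x\<bar>"] assms
  by simp

text \<open>
  Rotating the period around the center of symmetry by a quarter turn gives points at distance \<open>2 pi\<close> on both sides
  in the real direction of the profile, where \<open>u\<close> would have to agree with its value at the center. As the
  profile is even and monotone in the absolute value of the real part, this is impossible.
\<close>
lemma periodic_solution_not_radial:
  assumes "k \<noteq> 0" "\<forall>z. u z = ln (norm k) + periodic_profile S (k * z + c)"
  shows "\<not> radial_about p u"
proof
  assume "radial_about p u"
  then obtain G where G: "\<And>z. u z = G (norm (z - p))" by (auto simp: radial_about_def)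
  define T where "T = 2 * of_real pi * \<i> / k"
  have eq: "u (p + 2 * of_real pi * s / k) = u p" if "norm s = 1" for s
  proof -
    have "norm (2 * of_real pi * s / k) = norm T" using that by (simp add: T_def norm_mult norm_divide)
    then have "u (p + 2 * of_real pi * s / k) = u (p + T)" by (simp add: G)
    also have "\<dots> = u p" unfolding T_def by (rule periodic_solution_period[OF assms])
    finally show ?thesis .
  qed
  define w where "w = k * p + c"
  have C: "sqrt (1 + S ^ 2) > 0" by (intro real_sqrt_gt_zero) (simp add: add_pos_nonneg)
  have arg: "k * (p + 2 * of_real pi * s / k) + c = w + 2 * of_real pi * s" for s
    using assms(1) by (simp add: w_def field_simps)
  have "cosh (Re w + 2 * pi) = cosh (Re w)"
    using eq[of 1] C unfolding assms(2)[rule_format] arg add_left_cancel periodic_profile_eq_iff w_def[symmetric] by simp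
  then have 1: "\<bar>Re w + 2 * pi\<bar> = \<bar>Re w\<bar>" by (rule cosh_eq_imp_abs_eq)
  have "cosh (Re w - 2 * pi) = cosh (Re w)"
    using eq[of "-1"] C unfolding assms(2)[rule_format] arg add_left_cancel periodic_profile_eq_iff w_def[symmetric] by simp
  then have 2: "\<bar>Re w - 2 * pi\<bar> = \<bar>Re w\<bar>" by (rule cosh_eq_imp_abs_eq)
  show False using 1 2 pi_gt_zero by linarith
qed

text \<open>
  A direction along which \<open>u\<close> is constant cannot have a real component in the coordinate \<open>k z + c\<close>, where the hyperbolic
  cosine would be unbounded. It is therefore the direction of the period, along which the profile
  oscillates unless \<open>S = 0\<close>.
\<close>
lemma periodic_solution_one_dimensional_iff:
  assumes k: "k \<noteq> 0" and u: "\<forall>z. u z = ln (norm k) + periodic_profile S (k * z + c)" and S: "S \<ge> 0"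
  shows "one_dimensional u \<longleftrightarrow> S = 0"
proof
  assume "S = 0"
  have "inner (cnj k / of_real (norm k)) z = Re (k * z) / norm k" for z
    by (simp add: inner_complex_def diff_divide_distrib)
  then have "u z = ln (norm k) + periodic_profile 0 (of_real (norm k * inner (cnj k / of_real (norm k)) z) + c)" for z
    using k unfolding u[rule_format] \<open>S = 0\<close> periodic_profile_def by simp
  moreover have "norm (cnj k / of_real (norm k)) = 1" using k by (simp add: norm_divide)
  ultimately show "one_dimensional u"
    unfolding one_dimensional_def
    by (intro exI[of _ "cnj k / of_real (norm k)"] conjI allI
        exI[of _ "\<lambda>s. ln (norm k) + periodic_profile 0 (of_real (norm k * s) + c)"])
next
  assume "one_dimensional u"
  then obtain \<omega> G where \<omega>: "norm \<omega> = 1" and G: "\<And>z. u z = G (inner \<omega> z)" by (auto simp: one_dimensional_def)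
  have orth: "inner \<omega> (z + of_real t * (\<i> * \<omega>)) = inner \<omega> z" for z t
    by (simp add: inner_complex_def algebra_simps)
  define X where "X = k * (\<i> * \<omega>)"
  have "X \<noteq> 0" using k \<omega> by (auto simp: X_def)
  have "u (- c / k + of_real t * (\<i> * \<omega>)) = u (- c / k)" for t
    unfolding G orth ..
  moreover have "k * (- c / k + of_real t * (\<i> * \<omega>)) + c = of_real t * X" for t
    using k by (simp add: X_def field_simps)
  moreover have "k * (- c / k) + c = 0" using k by simp
  ultimately have "periodic_profile S (of_real t * X) = periodic_profile S 0" for t
    unfolding u[rule_format] by (metis add_left_cancel)
  then have eq: "sqrt (1 + S ^ 2) * cosh (t * Re X) + S * cos (t * Im X) = sqrt (1 + S ^ 2) + S" for t
    unfolding periodic_profile_eq_iff by simp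
  have C: "sqrt (1 + S ^ 2) > S" using abs_less_sqrt_add_square[of S] S by linarith
  have "Re X = 0"
  proof (rule ccontr)
    assume X: "Re X \<noteq> 0"
    let ?C = "sqrt (1 + S ^ 2)"
    \<comment> \<open>At real part 4 the hyperbolic cosine exceeds 3, which suffices because \<open>S\<close> is less than \<open>sqrt (1 + S^2)\<close>.\<close>
    have "exp (4::real) \<ge> 13" using exp_lower_Taylor_quadratic[of "4::real"] by simp
    then have "cosh (4::real) > 3" using cosh_field_def[of "4::real"] exp_gt_zero[of "-4::real"] by argo
    moreover have "?C > 0" using C S by linarith
    ultimately have "?C * cosh 4 > ?C * 3" by (rule mult_strict_left_mono)
    moreover have "?C * cosh 4 + S * cos (4 / Re X * Im X) = ?C + S" using eq[of "4 / Re X"] X by simp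
    moreover have "S * cos (4 / Re X * Im X) \<ge> S * (- 1)" using S by (intro mult_left_mono) auto
    ultimately show False using C S by linarith
  qed
  then have "Im X \<noteq> 0" using \<open>X \<noteq> 0\<close> by (simp add: complex_eq_iff)
  then show "S = 0" using eq[of "pi / Im X"] \<open>Re X = 0\<close> by simp
qed

section \<open>Vanishing, monotone and concave solutions\<close>

context liouville_gradient
begin

text \<open>
  A radial function coincides with its circle means around the center, and these decrease because \<open>u\<close> is superharmonic.
\<close>
lemma radial_le_center:
  assumes "radial_about z0 u"
  shows "u z \<le> u z0"
proof -
  obtain G where G: "\<And>z. u z = G (norm (z - z0))" using assms by (auto simp: radial_about_def)
  define r where "r = norm (z - z0)"
  let ?W = "\<lambda>r. circle_integral (\<lambda>z. (z - z0) * g z) z0 r"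
  let ?c = "\<lambda>r. circle_integral (\<lambda>z. complex_of_real (u z)) z0 r"
  let ?I = "\<lambda>x. integral {0..2*pi} (\<lambda>t. - exp (2 * u (z0 + of_real x * cis t)) / 4)"
  let ?J = "\<lambda>x. integral {0..2*pi} (\<lambda>t. ((z0 + of_real x * cis t) - z0) * of_real (- exp (2 * u (z0 + of_real x * cis t)) / 4) * cis (- t))"
  have W: "Re (?W s) \<le> 0" if s: "s > 0" for s
  proof -
    have "Re (?W s) \<le> Re (?W 0)"
    proof (rule DERIV_nonpos_imp_decreasing_open[of 0 s "\<lambda>x. Re (?W x)"])
      fix x assume x: "0 < x" "x < s"
      have int: "(\<lambda>t. - exp (2 * u (z0 + of_real x * cis t)) / 4) integrable_on {0..2*pi}"
        by (intro integrable_continuous_interval continuous_intros continuous_on_compose2[OF continuous_u[of UNIV]]) auto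
      have "?J x
         = integral {0..2*pi} (\<lambda>t. of_real x * of_real (- exp (2 * u (z0 + of_real x * cis t)) / 4))"
        by (rule integral_cong) (simp add: cis_mult mult_ac flip: cis_inverse)
      also have "\<dots> = of_real x * of_real (?I x)"
      proof -
        have "((\<lambda>t. complex_of_real (- exp (2 * u (z0 + of_real x * cis t)) / 4)) has_integral
            of_real (?I x)) {0..2*pi}"
          by (rule has_integral_of_real[OF integrable_integral[OF int]])
        from integral_unique[OF this] show ?thesis by (simp only: integral_mult_right)
      qed
      finally have eq: "?J x
         = of_real x * of_real (?I x)" .
      have "(?W has_vector_derivative 2 * (of_real x * of_real (?I x))) (at x)"
        using circle_integral_derivative[OF wirtinger_weighted[OF g], of x z0 z0] x unfolding eq by simp
      then have "((\<lambda>x. Re (?W x)) has_real_derivative Re (2 * (of_real x * of_real (?I x)))) (at x)"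
        by (intro has_real_derivative_Re)
      moreover have "?I x \<le> 0"
        using integral_le[OF int integrable_0] by simp
      then have "Re (2 * (of_real x * of_real (?I x))) \<le> 0"
        using x by (simp add: mult_nonneg_nonpos)
      ultimately show "\<exists>y. ((\<lambda>x. Re (?W x)) has_real_derivative y) (at x) \<and> y \<le> 0" by blast
    qed (use s continuous_g in \<open>auto intro!: continuous_intros circle_integral_continuous\<close>)
    then show ?thesis by (simp add: circle_integral_0)
  qed
  have "Re (?c r) \<le> Re (?c 0)"
  proof (cases "r = 0")
    case False
    then have r: "r > 0" by (simp add: r_def)
    show ?thesis
    proof (rule DERIV_nonpos_imp_decreasing_open[of 0 r "\<lambda>x. Re (?c x)"])
      fix x assume x: "0 < x" "x < r"
      have "((\<lambda>x. Re (?c x)) has_real_derivative Re (2 * cnj (?W x) / of_real x)) (at x)"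
        by (intro has_real_derivative_Re circle_integral_u_derivative x)
      moreover have "Re (2 * cnj (?W x) / of_real x) \<le> 0"
        using W[OF x(1)] x by (simp add: divide_nonpos_pos)
      ultimately show "\<exists>y. ((\<lambda>x. Re (?c x)) has_real_derivative y) (at x) \<and> y \<le> 0" by blast
    qed (use r continuous_u in \<open>auto intro!: continuous_intros circle_integral_continuous\<close>)
  qed simp
  moreover have "?c s = of_real (2 * pi * G s)" if "s \<ge> 0" for s
    unfolding circle_integral_def G using that by (simp add: norm_mult scaleR_conv_of_real)
  ultimately have "2 * pi * G r \<le> 2 * pi * G 0" by (simp add: r_def)
  then show ?thesis by (simp add: G r_def)
qed

end

lemma liouville_solution_gradient:
  assumes "liouville_solution u"
  obtains g p where "liouville_gradient u g p" "\<And>z. partial_x u z = 2 * Re (g z)" "\<And>z. partial_y u z = - 2 * Im (g z)"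
  using liouville_wirtinger[OF assms] unfolding liouville_gradient_def by metis

lemma liouville_solution_continuous: "liouville_solution u \<Longrightarrow> continuous_on UNIV u"
  using liouville_solution_gradient liouville_gradient.continuous_u by metis

text \<open>
  Either condition implies that \<open>u\<close> is bounded above: a function tending to \<open>-\<infinity>\<close> is bounded above by compactness, a radial solution
  by its value at the center. The classification then leaves the bubble.
\<close>
theorem vanishing_iff_radial:
  assumes "liouville_solution u"
  shows "filterlim u at_bot at_infinity \<longleftrightarrow> (\<exists>p. radial_about p u)"
proof
  assume lim: "filterlim u at_bot at_infinity"
  then have "eventually (\<lambda>z. u z \<le> 0) at_infinity" by (simp add: filterlim_at_bot)
  then obtain b where b: "\<And>z. norm z \<ge> b \<Longrightarrow> u z \<le> 0" by (auto simp: eventually_at_infinity)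
  have "compact (u ` cball 0 b)"
    by (intro compact_continuous_image continuous_on_subset[OF liouville_solution_continuous[OF assms]]) auto
  then have "bdd_above (u ` cball 0 b)" by (intro bounded_imp_bdd_above compact_imp_bounded)
  then obtain M where "\<forall>z\<in>cball 0 b. u z \<le> M" by (auto simp: bdd_above_def)
  then have M: "\<And>z. norm z \<le> b \<Longrightarrow> u z \<le> M" by simp
  have "u z \<le> max M 0" for z using b[of z] M[of z] by (cases "norm z \<le> b") auto
  then have "bdd_above (range u)" by (auto simp: bdd_above_def)
  from assms this show "\<exists>p. radial_about p u"
  proof (cases rule: bounded_liouville_classification)
    case bubble
    then show ?thesis using bubble_solution_radial by blast
  next
    case periodic
    then show ?thesis using periodic_solution_not_vanishing lim by blast
  qed
next
  assume "\<exists>p. radial_about p u"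
  then obtain z0 where rad: "radial_about z0 u" ..
  obtain g p where "liouville_gradient u g p" using liouville_solution_gradient[OF assms] by metis
  then have "u z \<le> u z0" for z using rad by (rule liouville_gradient.radial_le_center)
  then have "bdd_above (range u)" by (auto simp: bdd_above_def)
  from assms this show "filterlim u at_bot at_infinity"
  proof (cases rule: bounded_liouville_classification)
    case bubble
    then show ?thesis using bubble_solution_vanishes by blast
  next
    case periodic
    then show ?thesis using periodic_solution_not_radial rad by blast
  qed
qed

text \<open>
  Monotonicity and symmetry make the origin a maximum, so the classification applies. A bubble that is
  symmetric under both reflections is centered at 0. A periodic solution is impossible: up to reflection its period
  leads from the first quadrant further out into the first quadrant, where \<open>u\<close> decreases strictly.
\<close>
theorem monotone_symmetric_radial:
  assumes sol: "liouville_solution u"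
    and sym: "\<forall>x y. u (Complex x y) = u (Complex x (- y)) \<and> u (Complex x y) = u (Complex (- x) y)"
    and mono: "\<forall>z. Re z > 0 \<and> Im z > 0 \<longrightarrow> partial_x u z < 0 \<and> partial_y u z < 0"
  shows "radial_about 0 u"
proof -
  obtain g p where gp: "liouville_gradient u g p" "\<And>z. partial_x u z = 2 * Re (g z)" "\<And>z. partial_y u z = - 2 * Im (g z)"
    using liouville_solution_gradient[OF sol] by metis
  interpret liouville_gradient u g p by (rule gp(1))
  have decr: "u (z + d) < u z" if z: "Re z > 0" "Im z > 0" and d: "Re d \<ge> 0" "Im d \<ge> 0" "d \<noteq> 0" for z d
  proof -
    have "u (z + of_real 1 * d) < u (z + of_real 0 * d)"
    proof (rule DERIV_neg_imp_decreasing[of 0 1 "\<lambda>t. u (z + of_real t * d)"])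
      fix t :: real assume t: "0 \<le> t" "t \<le> 1"
      have "((\<lambda>t. z + of_real t * d) has_derivative (\<lambda>s. of_real s * d)) (at t)"
        by (auto intro!: derivative_eq_intros)
      from has_derivative_compose[OF this u_derivative]
      have "((\<lambda>t. u (z + of_real t * d)) has_real_derivative 2 * Re (g (z + of_real t * d) * d)) (at t)"
        by (rule has_derivative_imp_has_field_derivative) (simp add: algebra_simps)
      moreover have "2 * Re (g (z + of_real t * d) * d) < 0"
      proof -
        let ?w = "z + of_real t * d"
        have "Re ?w > 0 \<and> Im ?w > 0" using z d t by (simp add: add_pos_nonneg)
        then have "partial_x u ?w < 0" "partial_y u ?w < 0" using mono by blast+
        then have m: "Re (g ?w) < 0" "Im (g ?w) > 0" by (simp_all add: gp)
        have "Re d > 0 \<or> Im d > 0" using d by (auto simp: complex_eq_iff)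
        then have "Re (g ?w) * Re d < 0 \<and> Im (g ?w) * Im d \<ge> 0 \<or> Re (g ?w) * Re d \<le> 0 \<and> Im (g ?w) * Im d > 0"
          using m d by (auto intro: mult_neg_pos mult_nonpos_nonneg mult_pos_pos mult_nonneg_nonneg less_imp_le)
        then show ?thesis by auto
      qed
      ultimately show "\<exists>y. ((\<lambda>t. u (z + of_real t * d)) has_real_derivative y) (at t) \<and> y < 0" by blast
    qed simp
    then show ?thesis by simp
  qed
  have fold: "u z = u (Complex \<bar>Re z\<bar> \<bar>Im z\<bar>)" for z
  proof -
    have "u z = u (Complex (Re z) (Im z))" by simp
    also have "\<dots> = u (Complex \<bar>Re z\<bar> (Im z))" using sym by (simp add: abs_if)
    also have "\<dots> = u (Complex \<bar>Re z\<bar> \<bar>Im z\<bar>)" using sym by (simp add: abs_if)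
    finally show ?thesis .
  qed
  have "u z \<le> u 0" for z
  proof (cases "z = 0")
    case False
    define d where "d = Complex \<bar>Re z\<bar> \<bar>Im z\<bar>"
    have d: "Re d \<ge> 0" "Im d \<ge> 0" "d \<noteq> 0" using False by (auto simp: d_def complex_eq_iff)
    have cu: "isCont u w" for w using continuous_u[of UNIV] by (simp add: continuous_on_eq_continuous_at)
    \<comment> \<open>The strict decrease holds in the open quadrant; shifting along the diagonal by \<open>t\<close> and letting \<open>t\<close> tend to 0
      covers the axes and the origin.\<close>
    have l: "((\<lambda>t. u (of_real t * Complex 1 1 + e)) \<longlongrightarrow> u (of_real 0 * Complex 1 1 + e)) (at_right 0)" for e
      by (rule isCont_tendsto_compose[OF cu]) (intro tendsto_intros)
    have "u (of_real 0 * Complex 1 1 + d) \<le> u (of_real 0 * Complex 1 1 + 0)"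
      by (rule tendsto_le[OF _ l l])
        (use decr[of "of_real t * Complex 1 1" d for t] d in \<open>auto simp: eventually_at_right_field intro!: exI[of _ 1] less_imp_le\<close>)
    then show ?thesis using fold[of z] by (simp add: d_def)
  qed simp
  then have "bdd_above (range u)" by (auto simp: bdd_above_def)
  from sol this show ?thesis
  proof (cases rule: bounded_liouville_classification)
    case (bubble k c)
    define p0 where "p0 = - c / k"
    have "u (- p0) = u p0" unfolding fold[of "- p0"] fold[of p0] by simp
    then have "ln (2 / (1 + norm (2 * c) ^ 2)) = ln (2 / 1)"
      unfolding bubble(2)[rule_format] using bubble(1) by (simp add: bubble_def p0_def)
    then have "2 / (1 + norm (2 * c) ^ 2) = 2 / 1"
      by (subst (asm) ln_inj_iff) (auto intro!: divide_pos_pos add_pos_nonneg)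
    moreover have "x = 0" if "2 / (1 + x) = 2 / 1" "x \<ge> 0" for x :: real
      using that by (simp add: field_simps)
    ultimately have "c = 0" by (metis zero_le_power2 power_eq_0_iff norm_eq_zero mult_eq_0_iff zero_neq_numeral)
    then show ?thesis using bubble_solution_radial[OF bubble] by simp
  next
    case (periodic k c S)
    define T where "T = 2 * of_real pi * \<i> / k"
    have T: "T \<noteq> 0" using periodic by (simp add: T_def)
    define s where "s x = (if x \<ge> 0 then 1 else - 1 :: real)" for x :: real
    define w where "w = Complex (s (Re T)) (s (Im T))"
    have "u (Complex 1 1 + Complex \<bar>Re T\<bar> \<bar>Im T\<bar>) < u (Complex 1 1)"
      by (rule decr) (use T in \<open>auto simp: complex_eq_iff\<close>)
    also have "Complex 1 1 = Complex \<bar>Re w\<bar> \<bar>Im w\<bar>" by (simp add: w_def s_def)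
    also have "u \<dots> = u w" by (rule fold[symmetric])
    also have "\<dots> = u (w + T)" using periodic_solution_period[OF periodic(1,3)] by (simp add: T_def)
    also have "\<dots> = u (Complex \<bar>Re (w + T)\<bar> \<bar>Im (w + T)\<bar>)" by (rule fold)
    also have "Complex \<bar>Re (w + T)\<bar> \<bar>Im (w + T)\<bar> = Complex \<bar>Re w\<bar> \<bar>Im w\<bar> + Complex \<bar>Re T\<bar> \<bar>Im T\<bar>"
      by (simp add: w_def s_def complex_eq_iff abs_if)
    finally show ?thesis by simp
  qed
qed

text \<open>
  Concavity is tested at midpoints. A bubble decays only logarithmically and violates it far away from
  its center; a periodic profile violates it around a maximum of the oscillation unless \<open>S = 0\<close>.
\<close>
theorem concave_bounded_strip:
  assumes sol: "liouville_solution u" and conc: "concave_on UNIV u" and bdd: "bdd_above (range u)"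
  shows "\<exists>l z0. l \<noteq> 0 \<and> (\<forall>z. u z = ln (norm l) + log_sech (l * z + z0))"
proof -
  have mid: "u ((x + y) / 2) \<ge> (u x + u y) / 2" for x y
  proof -
    have "u ((1/2) *\<^sub>R x + (1/2) *\<^sub>R y) \<ge> 1/2 * u x + 1/2 * u y"
      using conc unfolding concave_on_iff by (metis UNIV_I half_gt_zero_iff less_imp_le zero_less_one field_sum_of_halves)
    moreover have "(1/2) *\<^sub>R x + (1/2) *\<^sub>R y = (x + y) / 2" by (simp add: complex_eq_iff)
    ultimately show ?thesis by simp
  qed
  from sol bdd show ?thesis
  proof (cases rule: bounded_liouville_classification)
    case (bubble k c)
    let ?P = "\<lambda>t::real. (of_real t - c) / k"
    have P: "u (?P t) = ln (norm k) + ln (2 / (1 + t ^ 2))" for t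
      unfolding bubble(2)[rule_format] bubble_def using bubble(1) by simp
    \<comment> \<open>Concavity at the distances 0, 2, 4 would give \<open>(1 + 4)^2 \<le> 1 + 16\<close>.\<close>
    have "(?P 0 + ?P 4) / 2 = ?P 2" using bubble(1) by (simp add: field_simps)
    note e = this
    have "u (?P 2) \<ge> (u (?P 0) + u (?P 4)) / 2" using mid[of "?P 0" "?P 4"] unfolding e .
    then have "2 * ln (2 / 5) \<ge> ln 2 + ln (2 / 17 :: real)" unfolding P by (simp add: field_simps)
    then have "ln ((2 / 5) * (2 / 5)) \<ge> ln (2 * (2 / 17 :: real))"
      by (simp only: ln_mult_pos[symmetric] mult_2 zero_less_divide_iff zero_less_numeral simp_thms)
    then have "(2 / 5) * (2 / 5) \<ge> (2 * (2 / 17 :: real))" by (subst (asm) ln_le_cancel_iff) auto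
    then show ?thesis by simp
  next
    case (periodic k c S)
    let ?P = "\<lambda>t::real. (\<i> * of_real t - c) / k"
    have P: "u (?P t) = ln (norm k) - ln (sqrt (1 + S ^ 2) + S * cos t)" for t
      unfolding periodic(3)[rule_format] periodic_profile_def using periodic(1) by simp
    have "(?P (- pi) + ?P pi) / 2 = ?P 0" using periodic(1) by (simp add: field_simps)
    note e = this
    have "u (?P 0) \<ge> (u (?P (- pi)) + u (?P pi)) / 2" using mid[of "?P (- pi)" "?P pi"] unfolding e .
    then have "ln (sqrt (1 + S ^ 2) + S) \<le> ln (sqrt (1 + S ^ 2) - S)"
      unfolding P by (simp add: field_simps)
    then have "S \<le> 0" using abs_less_sqrt_add_square[of S]
      by (subst (asm) ln_le_cancel_iff) auto
    then have "S = 0" using periodic by simp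
    have "u z = ln (norm (\<i> * k)) + log_sech ((\<i> * k) * z + \<i> * c)" for z
      unfolding periodic(3)[rule_format] periodic_profile_def log_sech_def \<open>S = 0\<close>
      by (simp add: norm_mult ln_div)
    moreover have "\<i> * k \<noteq> 0" using periodic(1) by simp
    ultimately show ?thesis by blast
  qed
qed

section \<open>Existence of the periodic solutions\<close>

lemma C2_fun_of_partials:
  fixes u ux uy uxx uxy uyy :: "complex \<Rightarrow> real"
  assumes u: "\<And>z. (u has_derivative (\<lambda>h. ux z * Re h + uy z * Im h)) (at z)"
    and ux: "\<And>z. (ux has_derivative (\<lambda>h. uxx z * Re h + uxy z * Im h)) (at z)"
    and uy: "\<And>z. (uy has_derivative (\<lambda>h. uxy z * Re h + uyy z * Im h)) (at z)"
    and cont: "continuous_on UNIV uxx" "continuous_on UNIV uxy" "continuous_on UNIV uyy"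
  shows "C2_fun u" "laplacian u z = uxx z + uyy z"
proof -
  define R I where "R = Blinfun Re" "I = Blinfun Im"
  have RI: "blinfun_apply R h = Re h" "blinfun_apply I h = Im h" for h
    unfolding R_I_def by (simp_all add: bounded_linear_Blinfun_apply bounded_linear_Re bounded_linear_Im)
  define B :: "(complex \<Rightarrow>\<^sub>L real) \<Rightarrow> (complex \<Rightarrow>\<^sub>L real) \<Rightarrow> complex \<Rightarrow>\<^sub>L complex \<Rightarrow>\<^sub>L real"
    where "B F G = Blinfun (\<lambda>h. blinfun_apply F h *\<^sub>R G)" for F G
  have B: "blinfun_apply (B F G) h = blinfun_apply F h *\<^sub>R G" for F G h
    unfolding B_def
    by (simp add: bounded_linear_Blinfun_apply bounded_linear_compose[OF bounded_linear_scaleR_left blinfun.bounded_linear_right])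
  define f' where "f' z = ux z *\<^sub>R R + uy z *\<^sub>R I" for z
  define f'' where "f'' z = uxx z *\<^sub>R B R R + uxy z *\<^sub>R (B I R + B R I) + uyy z *\<^sub>R B I I" for z
  have "blinfun_apply (f' z) = (\<lambda>h. ux z * Re h + uy z * Im h)" for z
    by (rule ext) (simp add: f'_def blinfun.add_left blinfun.scaleR_left RI)
  then have "(u has_derivative blinfun_apply (f' z)) (at z)" for z
    using u[of z] by simp
  moreover have "(f' has_derivative blinfun_apply (f'' z)) (at z)" for z
  proof -
    have "(f' has_derivative (\<lambda>h. (uxx z * Re h + uxy z * Im h) *\<^sub>R R + (uxy z * Re h + uyy z * Im h) *\<^sub>R I)) (at z)"
      unfolding f'_def by (intro has_derivative_add has_derivative_scaleR_left ux uy)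
    moreover have "(\<lambda>h. (uxx z * Re h + uxy z * Im h) *\<^sub>R R + (uxy z * Re h + uyy z * Im h) *\<^sub>R I) = blinfun_apply (f'' z)"
      by (rule ext) (simp add: f''_def blinfun.add_left blinfun.scaleR_left B RI algebra_simps)
    ultimately show ?thesis by simp
  qed
  moreover have "continuous_on UNIV f''"
    unfolding f''_def by (intro continuous_intros cont)
  ultimately show "C2_fun u" unfolding C2_fun_def by blast
  have cx: "((\<lambda>t. Complex t b) has_derivative (\<lambda>t. of_real t)) (at a)"
    and cy: "((\<lambda>t. Complex b t) has_derivative (\<lambda>t. \<i> * of_real t)) (at a)" for a b
    by (auto simp: Complex_eq intro!: derivative_eq_intros)
  have dx: "deriv (\<lambda>t. f (Complex t (Im z))) (Re z) = fx z"
    and dy: "deriv (\<lambda>t. f (Complex (Re z) t)) (Im z) = fy z"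
    if f: "\<And>z. (f has_derivative (\<lambda>h. fx z * Re h + fy z * Im h)) (at z)" for f fx fy :: "complex \<Rightarrow> real" and z
    using has_derivative_compose[OF cx f, of "Im z" "Re z"] has_derivative_compose[OF cy f, of "Re z" "Im z"]
    by (auto intro!: DERIV_imp_deriv simp: has_field_derivative_def)
  have "partial_x u = ux" "partial_y u = uy"
    by (auto simp: partial_x_def partial_y_def dx[OF u] dy[OF u])
  then show "laplacian u z = uxx z + uyy z"
    by (simp add: laplacian_def partial_x_def partial_y_def dx[OF ux] dy[OF uy])
qed

lemma has_derivative_cosh_Re: "((\<lambda>z. cosh (Re z)) has_derivative (\<lambda>h. sinh (Re z) * Re h)) (at z)"
  and has_derivative_sinh_Re: "((\<lambda>z. sinh (Re z)) has_derivative (\<lambda>h. cosh (Re z) * Re h)) (at z)"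
  and has_derivative_cos_Im: "((\<lambda>z. cos (Im z)) has_derivative (\<lambda>h. - sin (Im z) * Im h)) (at z)"
  and has_derivative_sin_Im: "((\<lambda>z. sin (Im z)) has_derivative (\<lambda>h. cos (Im z) * Im h)) (at z)"
proof -
  have R: "(Re has_derivative Re) (at z)" and I: "(Im has_derivative Im) (at z)"
    by (auto intro: bounded_linear_imp_has_derivative bounded_linear_Re bounded_linear_Im)
  have c: "((\<lambda>z. f (r z)) has_derivative (\<lambda>h. f' * r h)) (at z)"
    if "(r has_derivative r) (at z)" "(f has_real_derivative f') (at (r z))" for f f' and r :: "complex \<Rightarrow> real"
    using has_derivative_compose[OF that(1), of f "\<lambda>h. f' * h"] that(2) by (simp add: has_field_derivative_def)
  show "((\<lambda>z. cosh (Re z)) has_derivative (\<lambda>h. sinh (Re z) * Re h)) (at z)"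
    "((\<lambda>z. sinh (Re z)) has_derivative (\<lambda>h. cosh (Re z) * Re h)) (at z)"
    "((\<lambda>z. cos (Im z)) has_derivative (\<lambda>h. - sin (Im z) * Im h)) (at z)"
    "((\<lambda>z. sin (Im z)) has_derivative (\<lambda>h. cos (Im z) * Im h)) (at z)"
    by (rule c[OF R] c[OF I], auto intro!: derivative_eq_intros)+
qed

lemma periodic_profile_liouville: "liouville_solution (periodic_profile S)"
proof -
  define C where "C = sqrt (1 + S ^ 2)"
  have C2: "C ^ 2 = 1 + S ^ 2" unfolding C_def by (simp add: add_nonneg_nonneg)
  define D where "D z = C * cosh (Re z) + S * cos (Im z)" for z
  have D: "D z > 0" for z using periodic_denominator_pos by (simp add: D_def C_def)
  have Dne: "D z \<noteq> 0" for z using D[of z] by simp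
  have D': "(D has_derivative (\<lambda>h. C * (sinh (Re z) * Re h) + S * (- sin (Im z) * Im h))) (at z)" for z
    unfolding D_def
    by (intro has_derivative_add has_derivative_mult_right has_derivative_cosh_Re has_derivative_cos_Im)
  have contD: "continuous_on UNIV D" by (auto simp: D_def intro!: continuous_intros)
  define ux uy where "ux z = - (C * sinh (Re z)) / D z" "uy z = S * sin (Im z) / D z" for z
  define uxx uxy uyy where "uxx z = - (C * cosh (Re z) * D z - C ^ 2 * sinh (Re z) ^ 2) / D z ^ 2"
    "uxy z = - C * S * sinh (Re z) * sin (Im z) / D z ^ 2"
    "uyy z = (S * cos (Im z) * D z + S ^ 2 * sin (Im z) ^ 2) / D z ^ 2" for z
  have u: "(periodic_profile S has_derivative (\<lambda>h. ux z * Re h + uy z * Im h)) (at z)" for z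
  proof -
    have "((\<lambda>z. - ln (D z)) has_derivative (\<lambda>h. - ((C * (sinh (Re z) * Re h) + S * (- sin (Im z) * Im h)) / D z))) (at z)"
      by (rule derivative_eq_intros D' D refl)+ (simp add: divide_inverse mult.commute)
    moreover have "periodic_profile S = (\<lambda>z. - ln (D z))"
      by (auto simp: periodic_profile_def D_def C_def)
    moreover have "(\<lambda>h. - ((C * (sinh (Re z) * Re h) + S * (- sin (Im z) * Im h)) / D z)) = (\<lambda>h. ux z * Re h + uy z * Im h)"
      using Dne[of z] by (auto simp: ux_uy_def field_simps)
    ultimately show ?thesis by simp
  qed
  have quot: "((\<lambda>z. f z / D z) has_derivative (\<lambda>h. (f' h * D z - f z * (C * (sinh (Re z) * Re h) + S * (- sin (Im z) * Im h))) / (D z * D z))) (at z)"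
    if "(f has_derivative f') (at z)" for f f' z
    by (rule has_derivative_divide'[OF that D' Dne])
  have ux: "(ux has_derivative (\<lambda>h. uxx z * Re h + uxy z * Im h)) (at z)" for z
    unfolding ux_uy_def
    by (rule has_derivative_eq_rhs[OF quot[OF has_derivative_minus[OF has_derivative_mult_right[OF has_derivative_sinh_Re]]]])
      (use Dne[of z] in \<open>auto simp: uxx_uxy_uyy_def field_simps power2_eq_square\<close>)
  have uy: "(uy has_derivative (\<lambda>h. uxy z * Re h + uyy z * Im h)) (at z)" for z
    unfolding ux_uy_def
    by (rule has_derivative_eq_rhs[OF quot[OF has_derivative_mult_right[OF has_derivative_sin_Im]]])
      (use Dne[of z] in \<open>auto simp: uxx_uxy_uyy_def field_simps power2_eq_square\<close>)
  have cont: "continuous_on UNIV uxx" "continuous_on UNIV uxy" "continuous_on UNIV uyy"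
    unfolding uxx_uxy_uyy_def using Dne by (auto intro!: continuous_intros contD)
  have "- laplacian (periodic_profile S) z = exp (2 * periodic_profile S z)" for z
  proof -
    have "C * cosh (Re z) * D z - C ^ 2 * sinh (Re z) ^ 2 - (S * cos (Im z) * D z + S ^ 2 * sin (Im z) ^ 2)
        = C ^ 2 * (cosh (Re z) ^ 2 - sinh (Re z) ^ 2) - S ^ 2 * (sin (Im z) ^ 2 + cos (Im z) ^ 2)"
      unfolding D_def by (simp only: power2_eq_square algebra_simps)
    also have "\<dots> = 1" unfolding hyperbolic_pythagoras sin_cos_squared_add C2 by simp
    finally have "- (uxx z + uyy z) = 1 / D z ^ 2"
      unfolding uxx_uxy_uyy_def by (simp only: add_divide_distrib[symmetric] minus_divide_left) simp
    moreover have "exp (2 * periodic_profile S z) = 1 / D z ^ 2"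
    proof -
      have "2 * periodic_profile S z = - ln (D z) + - ln (D z)" by (simp add: periodic_profile_def D_def C_def)
      then have "exp (2 * periodic_profile S z) = inverse (exp (ln (D z))) * inverse (exp (ln (D z)))"
        by (simp only: exp_add exp_minus)
      then show ?thesis using D[of z] by (simp add: power2_eq_square divide_inverse)
    qed
    ultimately show ?thesis using C2_fun_of_partials(2)[OF u ux uy cont] by simp
  qed
  then show ?thesis
    unfolding liouville_solution_def using C2_fun_of_partials(1)[OF u ux uy cont] by blast
qed

lemma periodic_profile_bounded: "bdd_above (range (periodic_profile S))"
proof (rule bdd_aboveI2)
  fix z
  have "0 < sqrt (1 + S ^ 2) - \<bar>S\<bar>" using abs_less_sqrt_add_square by simp
  moreover have "sqrt (1 + S ^ 2) * cosh (Re z) \<ge> sqrt (1 + S ^ 2) * 1"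
    by (intro mult_left_mono cosh_real_ge_1) auto
  moreover have "\<bar>S * cos (Im z)\<bar> \<le> \<bar>S\<bar> * 1" unfolding abs_mult by (intro mult_left_mono) auto
  ultimately show "periodic_profile S z \<le> - ln (sqrt (1 + S ^ 2) - \<bar>S\<bar>)"
    unfolding periodic_profile_def by simp
qed

section \<open>Lengths of curves from below\<close>

text \<open>
  The integrand of the length, set to 0 on an exceptional set and at the ends of the unit interval. It is Borel measurable,
  whereas the derivative of the curve can be arbitrary at the removed points.
\<close>
definition conformal_speed :: "(complex \<Rightarrow> real) \<Rightarrow> real set \<Rightarrow> (real \<Rightarrow> complex) \<Rightarrow> real \<Rightarrow> real" where
  "conformal_speed u S \<gamma> t = indicator ({0<..<1} - S) t *\<^sub>R (exp (u (\<gamma> t)) * cmod (vector_derivative \<gamma> (at t)))"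

lemma conformal_speed_nonneg: "conformal_speed u S \<gamma> t \<ge> 0"
  by (simp add: conformal_speed_def)

lemma valid_path_derivative:
  assumes "valid_path \<gamma>"
  obtains S where "finite S" "\<And>t. t \<in> {0<..<1} - S \<Longrightarrow> (\<gamma> has_vector_derivative vector_derivative \<gamma> (at t)) (at t)"
    "continuous_on ({0<..<1} - S) (\<lambda>t. vector_derivative \<gamma> (at t))"
proof -
  from assms obtain S where S: "finite S" "\<gamma> C1_differentiable_on ({0..1} - S)"
    by (auto simp: valid_path_def piecewise_C1_differentiable_on_def)
  then show ?thesis
    by (intro that[of S]) (auto simp: C1_differentiable_on_eq vector_derivative_works[symmetric] 
        intro: continuous_on_subset)
qed

lemma conformal_speed_measurable:
  assumes "valid_path \<gamma>" "continuous_on UNIV u" "finite S" "continuous_on ({0<..<1} - S) (\<lambda>t. vector_derivative \<gamma> (at t))"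
  shows "conformal_speed u S \<gamma> \<in> borel_measurable borel"
proof -
  have "continuous_on ({0<..<1} - S) \<gamma>"
    using valid_path_imp_path[OF assms(1)] by (auto simp: path_def intro: continuous_on_subset)
  then have "continuous_on ({0<..<1} - S) (\<lambda>t. exp (u (\<gamma> t)) * cmod (vector_derivative \<gamma> (at t)))"
    by (intro continuous_intros continuous_on_compose2[OF assms(2)] assms) auto
  moreover have "{0<..<1} - S \<in> sets borel" using assms(3) by (intro borel_open open_Diff finite_imp_closed) auto
  ultimately show ?thesis
    unfolding conformal_speed_def[abs_def] by (intro borel_measurable_continuous_on_indicator)
qed

lemma conformal_length_speed:
  assumes "finite S"
  shows "conformal_length u \<gamma> = (\<integral>\<^sup>+ t. ennreal (conformal_speed u S \<gamma> t) \<partial>lborel)"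
  unfolding conformal_length_def
proof (rule nn_integral_cong_AE)
  have "finite (insert 0 (insert 1 S))" using assms by simp
  then have "AE t in lborel. t \<notin> insert 0 (insert 1 S)"
    by (intro AE_not_in finite_imp_null_set_lborel)
  then show "AE t in lborel. ennreal (exp (u (\<gamma> t)) * cmod (vector_derivative \<gamma> (at t))) * indicator {0..1} t
      = ennreal (conformal_speed u S \<gamma> t)"
    by eventually_elim (auto simp: conformal_speed_def split: split_indicator)
qed

text \<open>
  If the integral is finite, it is also a gauge integral and dominates the integral of
  the derivative of \<open>F \<circ> \<gamma>\<close>, to which the fundamental theorem of calculus applies in spite of finitely many
  exceptional points.
\<close>
lemma lipschitz_le_length:
  assumes F: "\<And>z. (F has_derivative F' z) (at z)"
    and lip: "\<And>z h. \<bar>F' z h\<bar> \<le> exp (u z) * norm h"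
    and \<gamma>: "valid_path \<gamma>" and u: "continuous_on UNIV u"
    and S: "finite S" "\<And>t. t \<in> {0<..<1} - S \<Longrightarrow> (\<gamma> has_vector_derivative vector_derivative \<gamma> (at t)) (at t)"
      "continuous_on ({0<..<1} - S) (\<lambda>t. vector_derivative \<gamma> (at t))"
    and ab: "0 \<le> a" "a \<le> b" "b \<le> 1"
  shows "ennreal \<bar>F (\<gamma> b) - F (\<gamma> a)\<bar> \<le> (\<integral>\<^sup>+ t. ennreal (conformal_speed u S \<gamma> t * indicator {a..b} t) \<partial>lborel)"
    (is "_ \<le> ?I")
proof (cases "?I = \<infinity>")
  case False
  let ?s = "\<lambda>t. conformal_speed u S \<gamma> t * indicator {a..b} t"
  have [measurable]: "conformal_speed u S \<gamma> \<in> borel_measurable borel"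
    by (rule conformal_speed_measurable[OF \<gamma> u S(1,3)])
  have "?I = ennreal (enn2real ?I)" using False by (simp add: less_top)
  then have "(?s has_integral enn2real ?I) UNIV"
    by (intro nn_integral_has_integral) (auto simp: conformal_speed_nonneg)
  moreover have "?s = (\<lambda>t. if t \<in> {a..b} then conformal_speed u S \<gamma> t else 0)" by auto
  ultimately have s: "(conformal_speed u S \<gamma> has_integral enn2real ?I) {a..b}"
    using has_integral_restrict_UNIV[of "{a..b}" "conformal_speed u S \<gamma>"] by (simp only:)
  define f' where "f' t = indicator ({0<..<1} - S) t * F' (\<gamma> t) (vector_derivative \<gamma> (at t))" for t
  have "continuous_on {a..b} \<gamma>"
    using valid_path_imp_path[OF \<gamma>] ab by (auto simp: path_def intro: continuous_on_subset)
  moreover have contF: "continuous_on UNIV F"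
    using F by (meson continuous_at_imp_continuous_on has_derivative_continuous)
  ultimately have cont: "continuous_on {a..b} (\<lambda>t. F (\<gamma> t))"
    by (intro continuous_on_compose2[OF contF]) auto
  have "(f' has_integral F (\<gamma> b) - F (\<gamma> a)) {a..b}"
  proof (rule fundamental_theorem_of_calculus_interior_strong[OF S(1) ab(2) _ cont])
    fix t assume t: "t \<in> {a<..<b} - S"
    then have t': "t \<in> {0<..<1} - S" using ab by auto
    have "((\<lambda>t. F (\<gamma> t)) has_derivative (\<lambda>s. F' (\<gamma> t) (s *\<^sub>R vector_derivative \<gamma> (at t)))) (at t)"
      using S(2)[OF t'] unfolding has_vector_derivative_def by (rule has_derivative_compose[OF _ F])
    moreover have "F' (\<gamma> t) (s *\<^sub>R vector_derivative \<gamma> (at t)) = s *\<^sub>R f' t" for s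
      using t' linear_scale[OF has_derivative_linear[OF F[of "\<gamma> t"]]] by (simp add: f'_def)
    ultimately show "((\<lambda>t. F (\<gamma> t)) has_vector_derivative f' t) (at t)"
      by (simp add: has_vector_derivative_def)
  qed
  note f' = this
  have bd: "\<bar>f' t\<bar> \<le> conformal_speed u S \<gamma> t" for t
    using lip[of "\<gamma> t" "vector_derivative \<gamma> (at t)"] by (simp add: f'_def conformal_speed_def split: split_indicator)
  have "F (\<gamma> b) - F (\<gamma> a) \<le> enn2real ?I"
    by (rule has_integral_le[OF f' s]) (use bd in \<open>auto simp: abs_le_iff\<close>)
  moreover have "- (F (\<gamma> b) - F (\<gamma> a)) \<le> enn2real ?I"
    by (rule has_integral_le[OF has_integral_neg[OF f'] s]) (use bd in \<open>auto simp: abs_le_iff\<close>)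
  ultimately have "\<bar>F (\<gamma> b) - F (\<gamma> a)\<bar> \<le> enn2real ?I" by simp
  then have "ennreal \<bar>F (\<gamma> b) - F (\<gamma> a)\<bar> \<le> ennreal (enn2real ?I)" by (rule ennreal_leI)
  also have "\<dots> = ?I" using False by (simp add: less_top)
  finally show ?thesis .
qed simp

lemma length_ge_two_legs:
  assumes F: "\<And>z. (F has_derivative F' z) (at z)"
    and lip: "\<And>z h. \<bar>F' z h\<bar> \<le> exp (u z) * norm h"
    and \<gamma>: "valid_path \<gamma>" and u: "continuous_on UNIV u" and t: "0 \<le> t" "t \<le> 1"
  shows "ennreal (\<bar>F (\<gamma> t) - F (\<gamma> 0)\<bar> + \<bar>F (\<gamma> 1) - F (\<gamma> t)\<bar>) \<le> conformal_length u \<gamma>"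
proof -
  obtain S where S: "finite S" "\<And>t. t \<in> {0<..<1} - S \<Longrightarrow> (\<gamma> has_vector_derivative vector_derivative \<gamma> (at t)) (at t)"
      "continuous_on ({0<..<1} - S) (\<lambda>t. vector_derivative \<gamma> (at t))"
    using valid_path_derivative[OF \<gamma>] by blast
  \<comment> \<open>Removing the parameter \<open>t\<close> makes the two parts of the interval disjoint.\<close>
  define S' where "S' = insert t S"
  have S': "finite S'" "\<And>t. t \<in> {0<..<1} - S' \<Longrightarrow> (\<gamma> has_vector_derivative vector_derivative \<gamma> (at t)) (at t)"
      "continuous_on ({0<..<1} - S') (\<lambda>t. vector_derivative \<gamma> (at t))"
    using S by (auto simp: S'_def intro: continuous_on_subset)
  let ?s = "conformal_speed u S' \<gamma>"
  have [measurable]: "?s \<in> borel_measurable borel"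
    by (rule conformal_speed_measurable[OF \<gamma> u S'(1,3)])
  note leg = lipschitz_le_length[OF F lip \<gamma> u S']
  have "ennreal (\<bar>F (\<gamma> t) - F (\<gamma> 0)\<bar> + \<bar>F (\<gamma> 1) - F (\<gamma> t)\<bar>) = ennreal \<bar>F (\<gamma> t) - F (\<gamma> 0)\<bar> + ennreal \<bar>F (\<gamma> 1) - F (\<gamma> t)\<bar>"
    by simp
  also have "\<dots> \<le> (\<integral>\<^sup>+ x. ennreal (?s x * indicator {0..t} x) \<partial>lborel) + (\<integral>\<^sup>+ x. ennreal (?s x * indicator {t..1} x) \<partial>lborel)"
    using t by (intro add_mono leg) auto
  also have "\<dots> = (\<integral>\<^sup>+ x. ennreal (?s x * indicator {0..t} x) + ennreal (?s x * indicator {t..1} x) \<partial>lborel)"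
    by (rule nn_integral_add[symmetric]) auto
  also have "\<dots> \<le> (\<integral>\<^sup>+ x. ennreal (?s x) \<partial>lborel)"
    by (intro nn_integral_mono) (auto simp: conformal_speed_def S'_def split: split_indicator)
  also have "\<dots> = conformal_length u \<gamma>" by (rule conformal_length_speed[OF S'(1), symmetric])
  finally show ?thesis .
qed

text \<open>
  On the unit sphere, the angle \<open>arcsin T\<close> belonging to a height \<open>T\<close> is a function with Lipschitz constant 1, but it is
  not differentiable at the poles. The functions \<open>arcsin (T / c)\<close> with \<open>c > 1\<close> are smooth, have Lipschitz constant 1 as well,
  and converge to \<open>arcsin T\<close> for \<open>c \<rightarrow> 1\<close>.
\<close>
lemma length_ge_height_angles:
  assumes T: "\<And>z. (T has_derivative T' z) (at z)" and T1: "\<And>z. \<bar>T z\<bar> \<le> 1"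
    and lip: "\<And>z h. \<bar>T' z h\<bar> \<le> sqrt (1 - T z ^ 2) * exp (u z) * norm h"
    and \<gamma>: "valid_path \<gamma>" and u: "continuous_on UNIV u" and t: "0 \<le> t" "t \<le> 1"
  shows "ennreal (\<bar>arcsin (T (\<gamma> t)) - arcsin (T (\<gamma> 0))\<bar> + \<bar>arcsin (T (\<gamma> 1)) - arcsin (T (\<gamma> t))\<bar>) \<le> conformal_length u \<gamma>"
    (is "ennreal (?L 1) \<le> _")
proof -
  define L where "L c = \<bar>arcsin (T (\<gamma> t) / c) - arcsin (T (\<gamma> 0) / c)\<bar> + \<bar>arcsin (T (\<gamma> 1) / c) - arcsin (T (\<gamma> t) / c)\<bar>" for c
  have le: "ennreal (L c) \<le> conformal_length u \<gamma>" if c: "c > 1" for c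
    unfolding L_def
  proof (rule length_ge_two_legs[OF _ _ \<gamma> u t, where F' = "\<lambda>z h. T' z h / sqrt (c ^ 2 - T z ^ 2)"])
    fix z h
    have "T z ^ 2 \<le> 1" using T1[of z] by (simp add: abs_square_le_1)
    moreover have "c ^ 2 > 1" using c by simp
    ultimately have pos: "c ^ 2 - T z ^ 2 > 0" by linarith
    have b: "- 1 < T z / c" "T z / c < 1" using T1[of z] c by (auto simp: field_simps abs_le_iff)
    have "sqrt (1 - (T z / c) ^ 2) = sqrt ((c ^ 2 - T z ^ 2) / c ^ 2)"
      using c by (simp add: field_simps)
    also have "\<dots> = sqrt (c ^ 2 - T z ^ 2) / c" using c by (simp add: real_sqrt_divide)
    finally have sq: "sqrt (1 - (T z / c) ^ 2) = sqrt (c ^ 2 - T z ^ 2) / c" .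
    have dT: "((\<lambda>z. T z / c) has_derivative (\<lambda>h. T' z h / c)) (at z)"
      using has_derivative_mult_left[OF T[of z], of "1/c"] by simp
    have "((\<lambda>z. arcsin (T z / c)) has_derivative (\<lambda>h. inverse (sqrt (1 - (T z / c) ^ 2)) * (T' z h / c))) (at z)"
      using has_derivative_compose[OF dT, of arcsin "(*) (inverse (sqrt (1 - (T z / c) ^ 2)))"] DERIV_arcsin[OF b]
      by (simp add: has_field_derivative_def)
    then show "((\<lambda>z. arcsin (T z / c)) has_derivative (\<lambda>h. T' z h / sqrt (c ^ 2 - T z ^ 2))) (at z)"
      unfolding sq using c by (simp add: field_simps)
    have "\<bar>T' z h\<bar> \<le> sqrt (1 - T z ^ 2) * exp (u z) * norm h" by (rule lip)
    also have "\<dots> \<le> sqrt (c ^ 2 - T z ^ 2) * exp (u z) * norm h"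
      using \<open>c ^ 2 > 1\<close> by (intro mult_right_mono real_sqrt_le_mono) auto
    finally show "\<bar>T' z h / sqrt (c ^ 2 - T z ^ 2)\<bar> \<le> exp (u z) * norm h"
      using pos by (simp add: abs_divide divide_le_eq mult_ac)
  qed
  have "- 1 \<le> T w / c \<and> T w / c \<le> 1" if "c \<ge> 1" for w c
  proof -
    have "- c \<le> T w" "T w \<le> c" using T1[of w] that by linarith+
    then show ?thesis using that by (simp add: divide_le_eq le_divide_eq)
  qed
  note bound = this
  have "continuous_on {1..2} L"
    unfolding L_def
    by (intro continuous_intros continuous_on_compose2[OF continuous_on_arcsin'])
      (use bound in auto)
  then have "(L \<longlongrightarrow> L 1) (at 1 within {1..2})" by (simp add: continuous_on_def)
  then have lim: "((\<lambda>c. ennreal (L c)) \<longlongrightarrow> ennreal (L 1)) (at 1 within {1..2})" by (rule tendsto_ennrealI)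
  have "ennreal (L 1) \<le> conformal_length u \<gamma>"
    by (rule tendsto_upperbound[OF lim])
      (auto simp: eventually_at_filter le trivial_limit_within islimpt_Icc intro!: always_eventually)
  then show ?thesis by (simp add: L_def)
qed

section \<open>Joining points by short curves\<close>

definition joinable :: "(complex \<Rightarrow> real) \<Rightarrow> complex \<Rightarrow> complex \<Rightarrow> real \<Rightarrow> bool" where
  "joinable u p q L \<longleftrightarrow> (\<exists>\<gamma>. valid_path \<gamma> \<and> pathstart \<gamma> = p \<and> pathfinish \<gamma> = q \<and> conformal_length u \<gamma> \<le> ennreal L)"

lemma joinable_dist: "joinable u p q L \<Longrightarrow> conformal_dist u p q \<le> ennreal L"
  unfolding joinable_def conformal_dist_def by (auto intro: INF_lower2)

lemma joinable_mono: "joinable u p q L \<Longrightarrow> L \<le> L' \<Longrightarrow> joinable u p q L'"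
  unfolding joinable_def using ennreal_leI[of L L'] by (blast intro: order_trans)

lemma conformal_length_join:
  assumes u: "continuous_on UNIV u" and \<gamma>: "valid_path \<gamma>1" "valid_path \<gamma>2" "pathfinish \<gamma>1 = pathstart \<gamma>2"
  shows "conformal_length u (\<gamma>1 +++ \<gamma>2) \<le> conformal_length u \<gamma>1 + conformal_length u \<gamma>2"
proof -
  obtain S1 where S1: "finite S1" "\<And>t. t \<in> {0<..<1} - S1 \<Longrightarrow> (\<gamma>1 has_vector_derivative vector_derivative \<gamma>1 (at t)) (at t)"
      "continuous_on ({0<..<1} - S1) (\<lambda>t. vector_derivative \<gamma>1 (at t))"
    using valid_path_derivative[OF \<gamma>(1)] by blast
  obtain S2 where S2: "finite S2" "\<And>t. t \<in> {0<..<1} - S2 \<Longrightarrow> (\<gamma>2 has_vector_derivative vector_derivative \<gamma>2 (at t)) (at t)"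
      "continuous_on ({0<..<1} - S2) (\<lambda>t. vector_derivative \<gamma>2 (at t))"
    using valid_path_derivative[OF \<gamma>(2)] by blast
  let ?s1 = "conformal_speed u S1 \<gamma>1" and ?s2 = "conformal_speed u S2 \<gamma>2"
  let ?j = "\<lambda>t. ennreal (exp (u ((\<gamma>1 +++ \<gamma>2) t)) * cmod (vector_derivative (\<gamma>1 +++ \<gamma>2) (at t))) * indicator {0..1} t"
  let ?b = "\<lambda>t. 2 * ennreal (?s1 (0 + 2 * t)) + 2 * ennreal (?s2 (- 1 + 2 * t))"
  have [measurable]: "?s1 \<in> borel_measurable borel" "?s2 \<in> borel_measurable borel"
    using conformal_speed_measurable[OF \<gamma>(1) u S1(1,3)] conformal_speed_measurable[OF \<gamma>(2) u S2(1,3)] by auto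
  define N where "N = {0, 1/2, 1} \<union> (\<lambda>x. x / 2) ` S1 \<union> (\<lambda>x. (x + 1) / 2) ` S2"
  have "finite N" using S1(1) S2(1) by (simp add: N_def)
  then have "AE t in lborel. t \<notin> N" by (intro AE_not_in finite_imp_null_set_lborel)
  then have AE: "AE t in lborel. ?j t
      \<le> ?b t"
  proof eventually_elim
    fix t assume t: "t \<notin> N"
    consider "t < 0 \<or> t > 1" | "0 < t" "t < 1/2" | "1/2 < t" "t < 1"
      using t unfolding N_def by fastforce
    then show "?j t
      \<le> ?b t"
    proof cases
      case 1
      then show ?thesis by auto
    next
      case 2
      have "2 * t \<notin> S1" using t imageI[of "2 * t" S1 "\<lambda>x. x / 2"] by (auto simp: N_def)
      then have m: "2 * t \<in> {0<..<1} - S1" using 2 by auto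
      have "((\<gamma>1 \<circ> (\<lambda>s. 2 * s)) has_vector_derivative 2 *\<^sub>R vector_derivative \<gamma>1 (at (2 * t))) (at t)"
        by (rule vector_diff_chain_at) (auto intro!: derivative_eq_intros S1(2) m)
      then have "((\<gamma>1 +++ \<gamma>2) has_vector_derivative 2 *\<^sub>R vector_derivative \<gamma>1 (at (2 * t))) (at t)"
        by (rule has_vector_derivative_transform_within_open[where S = "{0<..<1/2}"]) (use 2 in \<open>auto simp: joinpaths_def\<close>)
      then have "vector_derivative (\<gamma>1 +++ \<gamma>2) (at t) = 2 *\<^sub>R vector_derivative \<gamma>1 (at (2 * t))"
        by (rule vector_derivative_at)
      then have "?j t = ennreal (2 * ?s1 (2 * t))"
        using 2 m by (simp add: conformal_speed_def joinpaths_def mult_ac)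
      also have "\<dots> = 2 * ennreal (?s1 (2 * t))" by (simp add: ennreal_mult conformal_speed_nonneg)
      finally show ?thesis by simp
    next
      case 3
      have "2 * t - 1 \<notin> S2" using t imageI[of "2 * t - 1" S2 "\<lambda>x. (x + 1) / 2"] by (auto simp: N_def)
      then have m: "2 * t - 1 \<in> {0<..<1} - S2" using 3 by auto
      have "((\<gamma>2 \<circ> (\<lambda>s. 2 * s - 1)) has_vector_derivative 2 *\<^sub>R vector_derivative \<gamma>2 (at (2 * t - 1))) (at t)"
        by (rule vector_diff_chain_at) (auto intro!: derivative_eq_intros S2(2) m)
      then have "((\<gamma>1 +++ \<gamma>2) has_vector_derivative 2 *\<^sub>R vector_derivative \<gamma>2 (at (2 * t - 1))) (at t)"
        by (rule has_vector_derivative_transform_within_open[where S = "{1/2<..<1}"]) (use 3 in \<open>auto simp: joinpaths_def\<close>)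
      then have "vector_derivative (\<gamma>1 +++ \<gamma>2) (at t) = 2 *\<^sub>R vector_derivative \<gamma>2 (at (2 * t - 1))"
        by (rule vector_derivative_at)
      then have "?j t = ennreal (2 * ?s2 (2 * t - 1))"
        using 3 m by (simp add: conformal_speed_def joinpaths_def mult_ac)
      also have "\<dots> = 2 * ennreal (?s2 (2 * t - 1))" by (simp add: ennreal_mult conformal_speed_nonneg)
      also have "2 * t - 1 = - 1 + 2 * t" by simp
      finally show ?thesis by simp
    qed
  qed
  have "conformal_length u (\<gamma>1 +++ \<gamma>2) \<le> (\<integral>\<^sup>+ t. ?b t \<partial>lborel)"
    unfolding conformal_length_def by (rule nn_integral_mono_AE[OF AE])
  also have "\<dots> = 2 * (\<integral>\<^sup>+ t. ennreal (?s1 (0 + 2 * t)) \<partial>lborel) + 2 * (\<integral>\<^sup>+ t. ennreal (?s2 (- 1 + 2 * t)) \<partial>lborel)"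
    by (subst nn_integral_add) (auto simp: nn_integral_cmult)
  also have "2 * (\<integral>\<^sup>+ t. ennreal (?s1 (0 + 2 * t)) \<partial>lborel) = conformal_length u \<gamma>1"
    unfolding conformal_length_speed[OF S1(1)] using nn_integral_real_affine[of "\<lambda>x. ennreal (?s1 x)" 2 0] by simp
  also have "2 * (\<integral>\<^sup>+ t. ennreal (?s2 (- 1 + 2 * t)) \<partial>lborel) = conformal_length u \<gamma>2"
    unfolding conformal_length_speed[OF S2(1)] using nn_integral_real_affine[of "\<lambda>x. ennreal (?s2 x)" 2 "- 1"] by simp
  finally show ?thesis .
qed

lemma joinable_trans:
  assumes "joinable u p q L1" "joinable u q r L2" "continuous_on UNIV u" "L1 \<ge> 0" "L2 \<ge> 0"
  shows "joinable u p r (L1 + L2)"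
proof -
  obtain \<gamma>1 \<gamma>2 where 1: "valid_path \<gamma>1" "pathstart \<gamma>1 = p" "pathfinish \<gamma>1 = q" "conformal_length u \<gamma>1 \<le> ennreal L1"
    and 2: "valid_path \<gamma>2" "pathstart \<gamma>2 = q" "pathfinish \<gamma>2 = r" "conformal_length u \<gamma>2 \<le> ennreal L2"
    using assms by (auto simp: joinable_def)
  have "conformal_length u (\<gamma>1 +++ \<gamma>2) \<le> conformal_length u \<gamma>1 + conformal_length u \<gamma>2"
    by (rule conformal_length_join) (use 1 2 assms in auto)
  also have "\<dots> \<le> ennreal L1 + ennreal L2" by (intro add_mono 1 2)
  also have "\<dots> = ennreal (L1 + L2)" using assms by simp
  finally show ?thesis
    unfolding joinable_def using 1 2 by (intro exI[of _ "\<gamma>1 +++ \<gamma>2"]) (auto intro: valid_path_join)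
qed

text \<open>
  All computations are made in the coordinate \<open>w = k z + c\<close> of the explicit profiles: the factor \<open>\<bar>k\<bar>\<close> in the metric cancels the change of
  length under this map. \<open>H\<close> is a primitive of a bound for the speed of the segment.
\<close>
lemma joinable_segment:
  assumes k: "k \<noteq> 0" and u: "\<forall>z. u z = ln (norm k) + U (k * z + c)"
    and H: "\<And>t. 0 \<le> t \<Longrightarrow> t \<le> 1 \<Longrightarrow> (H has_real_derivative h t) (at t)"
    and h: "\<And>t. 0 \<le> t \<Longrightarrow> t \<le> 1 \<Longrightarrow> exp (U (linepath w1 w2 t)) * norm (w2 - w1) \<le> h t"
    and meas: "h \<in> borel_measurable borel"
  shows "joinable u ((w1 - c) / k) ((w2 - c) / k) (H 1 - H 0)"
  unfolding joinable_def
proof (intro exI conjI)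
  let ?\<gamma> = "linepath ((w1 - c) / k) ((w2 - c) / k)"
  show "valid_path ?\<gamma>" "pathstart ?\<gamma> = (w1 - c) / k" "pathfinish ?\<gamma> = (w2 - c) / k" by auto
  have pw: "exp (u (?\<gamma> t)) * cmod (vector_derivative ?\<gamma> (at t)) \<le> h t" if t: "0 \<le> t" "t \<le> 1" for t
  proof -
    have "k * ?\<gamma> t + c = linepath w1 w2 t"
      using k by (simp add: linepath_def scaleR_conv_of_real field_simps)
    then have "exp (u (?\<gamma> t)) = norm k * exp (U (linepath w1 w2 t))"
      using k u by (simp add: exp_add)
    moreover have "norm k * norm ((w2 - c) / k - (w1 - c) / k) = norm (w2 - w1)"
      using k by (simp add: norm_divide flip: diff_divide_distrib)
    ultimately have "exp (u (?\<gamma> t)) * norm ((w2 - c) / k - (w1 - c) / k) = exp (U (linepath w1 w2 t)) * norm (w2 - w1)"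
      by (metis mult.assoc mult.commute)
    then show ?thesis using h[OF t] by (simp only: vector_derivative_linepath_at)
  qed
  have "conformal_length u ?\<gamma> \<le> (\<integral>\<^sup>+ t. ennreal (h t) * indicator {0..1} t \<partial>lborel)"
    unfolding conformal_length_def
    by (intro nn_integral_mono) (use pw in \<open>auto intro!: ennreal_leI split: split_indicator\<close>)
  also have "\<dots> = ennreal (H 1 - H 0)"
  proof (rule nn_integral_FTC_Icc[OF meas])
    show "0 \<le> h t" if "t \<in> {0..1}" for t
      using h[of t] that by (auto intro: order_trans[rotated] mult_nonneg_nonneg)
  qed (use H in auto)
  finally show "conformal_length u ?\<gamma> \<le> ennreal (H 1 - H 0)" .
qed

text \<open>
  A form suited to detours through far points: \<open>X\<close> measures how far the detour goes, and \<open>f\<close> is the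
  cost of crossing over there, which disappears in the limit.
\<close>
lemma conformal_diameter_le:
  assumes k: "k \<noteq> 0" and J: "\<And>w1 w2. eventually (\<lambda>X::real. conformal_dist u ((w1 - c) / k) ((w2 - c) / k) \<le> ennreal (D + f w1 w2 X)) at_top"
    and f: "\<And>w1 w2. (f w1 w2 \<longlongrightarrow> 0) at_top"
  shows "conformal_diameter u \<le> ennreal D"
  unfolding conformal_diameter_def
proof (intro SUP_least)
  fix p q :: complex
  have pq: "p = ((k * p + c) - c) / k" "q = ((k * q + c) - c) / k" using k by auto
  have "((\<lambda>X. ennreal (D + f (k * p + c) (k * q + c) X)) \<longlongrightarrow> ennreal (D + 0)) at_top"
    by (intro tendsto_ennrealI tendsto_add tendsto_const f)
  moreover have "eventually (\<lambda>X. conformal_dist u p q \<le> ennreal (D + f (k * p + c) (k * q + c) X)) at_top"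
    using J[of "k * p + c" "k * q + c"] unfolding pq[symmetric] .
  ultimately show "conformal_dist u p q \<le> ennreal D"
    using tendsto_lowerbound[of "\<lambda>X. ennreal (D + f (k * p + c) (k * q + c) X)" "ennreal (D + 0)" at_top] by simp
qed

lemma conformal_diameter_ge:
  assumes "\<And>\<gamma>. valid_path \<gamma> \<Longrightarrow> pathstart \<gamma> = p \<Longrightarrow> pathfinish \<gamma> = q \<Longrightarrow> L \<le> conformal_length u \<gamma>"
  shows "L \<le> conformal_diameter u"
proof -
  have "L \<le> conformal_dist u p q"
    unfolding conformal_dist_def by (rule INF_greatest) (use assms in auto)
  also have "\<dots> \<le> conformal_diameter u"
    unfolding conformal_diameter_def by (rule order_trans[OF SUP_upper[of q] SUP_upper[of p]]) auto
  finally show ?thesis .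
qed

section \<open>The diameter of the periodic solutions\<close>

lemma periodic_profile_exp: "exp (periodic_profile S w) = 1 / (sqrt (1 + S ^ 2) * cosh (Re w) + S * cos (Im w))"
  unfolding periodic_profile_def using periodic_denominator_pos by (simp add: exp_minus inverse_eq_divide)

lemma periodic_profile_exp_le:
  assumes "S \<ge> 0"
  shows "exp (periodic_profile S w) \<le> 1 / (sqrt (1 + S ^ 2) * cosh (Re w) - S)"
proof -
  have "S * cos (Im w) \<ge> S * (- 1)" using assms by (intro mult_left_mono) auto
  moreover have "sqrt (1 + S ^ 2) * cosh (Re w) - S > 0" using periodic_denominator_pos[of S "Re w" pi] by simp
  ultimately show ?thesis unfolding periodic_profile_exp by (intro divide_left_mono mult_pos_pos) auto
qed

text \<open>
  A primitive of the density along the line \<open>Im w = pi\<close>, where the periodic metric is largest. This line is the longer of the two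
  arcs of the great circle through the two missing points.
\<close>
definition long_arc :: "real \<Rightarrow> real \<Rightarrow> real" where
  "long_arc S x = 2 * arctan (sqrt (1 + S ^ 2) * exp x - S)"

lemma long_arc_derivative:
  "(long_arc S has_real_derivative 1 / (sqrt (1 + S ^ 2) * cosh x - S)) (at x)"
proof -
  let ?C = "sqrt (1 + S ^ 2)"
  have C2: "?C ^ 2 = 1 + S ^ 2" by (simp add: add_nonneg_nonneg)
  have D: "?C * cosh x - S > 0" using periodic_denominator_pos[of S x pi] by simp
  have "(long_arc S has_real_derivative 2 * (inverse (1 + (?C * exp x - S) ^ 2) * (?C * exp x))) (at x)"
    unfolding long_arc_def by (rule derivative_eq_intros refl | simp)+
  also have "1 + (?C * exp x - S) ^ 2 = ?C ^ 2 - 2 * ?C * S * exp x + ?C ^ 2 * exp x ^ 2"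
    unfolding C2 power2_diff power_mult_distrib by simp
  also have "\<dots> = (2 * ?C * exp x) * (?C * cosh x - S)"
    unfolding cosh_field_def exp_minus by (simp add: field_simps power2_eq_square)
  also have "2 * (inverse ((2 * ?C * exp x) * (?C * cosh x - S)) * (?C * exp x)) = 1 / (?C * cosh x - S)"
  proof -
    have "2 * (inverse ((2 * a * b) * d) * (a * b)) = 1 / d" if "a \<noteq> 0" "b \<noteq> 0" "d \<noteq> 0" for a b d :: real
      using that by (simp add: field_simps)
    moreover have "?C \<noteq> 0" using C2 by (smt (verit) power_zero_numeral zero_le_power2)
    ultimately show ?thesis using D by (metis exp_not_eq_zero less_irrefl)
  qed
  finally show ?thesis .
qed

lemma long_arc_mono: "x \<le> y \<Longrightarrow> long_arc S x \<le> long_arc S y"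
  unfolding long_arc_def by (intro mult_left_mono arctan_monotone' diff_right_mono mult_left_mono) auto

lemma long_arc_bounds: "long_arc S x \<le> pi" "long_arc S x \<ge> - 2 * arctan S"
proof -
  show "long_arc S x \<le> pi" using arctan_ubound[of "sqrt (1 + S ^ 2) * exp x - S"] by (simp add: long_arc_def)
  have "arctan (- S) \<le> arctan (sqrt (1 + S ^ 2) * exp x - S)" by (rule arctan_monotone') simp
  then show "long_arc S x \<ge> - 2 * arctan S" by (simp add: long_arc_def arctan_minus)
qed

lemma periodic_horizontal:
  assumes k: "k \<noteq> 0" and u: "\<forall>z. u z = ln (norm k) + periodic_profile S (k * z + c)" and S: "S \<ge> 0"
  shows "joinable u ((Complex x1 y - c) / k) ((Complex x2 y - c) / k) \<bar>long_arc S x2 - long_arc S x1\<bar>"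
proof -
  define \<sigma> :: real where "\<sigma> = (if x1 \<le> x2 then 1 else - 1)"
  let ?x = "\<lambda>t. x1 + t * (x2 - x1)"
  let ?H = "\<lambda>t. \<sigma> * long_arc S (?x t)"
  let ?h = "\<lambda>t. \<bar>x2 - x1\<bar> / (sqrt (1 + S ^ 2) * cosh (?x t) - S)"
  have pos: "sqrt (1 + S ^ 2) * cosh x - S > 0" for x using periodic_denominator_pos[of S x pi] by simp
  have "joinable u ((Complex x1 y - c) / k) ((Complex x2 y - c) / k) (?H 1 - ?H 0)"
  proof (rule joinable_segment[OF k u])
    fix t :: real
    show "(?H has_real_derivative ?h t) (at t)"
      by (rule derivative_eq_intros DERIV_chain2[OF long_arc_derivative] refl | simp)+ (simp add: \<sigma>_def)
    have "linepath (Complex x1 y) (Complex x2 y) t = Complex (?x t) y"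
      by (simp add: linepath_def complex_eq_iff algebra_simps)
    moreover have "norm (Complex x2 y - Complex x1 y) = \<bar>x2 - x1\<bar>" by (simp add: cmod_def)
    ultimately show "exp (periodic_profile S (linepath (Complex x1 y) (Complex x2 y) t)) * norm (Complex x2 y - Complex x1 y) \<le> ?h t"
      using mult_right_mono[OF periodic_profile_exp_le[OF S, of "Complex (?x t) y"], of "\<bar>x2 - x1\<bar>"] by simp
    have "sqrt (1 + S ^ 2) * cosh x \<noteq> S" for x
    proof
      assume "sqrt (1 + S ^ 2) * cosh x = S"
      with pos[of x] show False by linarith
    qed
    then have "continuous_on UNIV ?h"
      by (intro continuous_intros) auto
    then show "?h \<in> borel_measurable borel" by (rule borel_measurable_continuous_onI)
  qed
  moreover have "?H 1 - ?H 0 = \<bar>long_arc S x2 - long_arc S x1\<bar>"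
    using long_arc_mono[of x1 x2 S] long_arc_mono[of x2 x1 S] by (auto simp: \<sigma>_def)
  ultimately show ?thesis by simp
qed

lemma periodic_vertical:
  assumes k: "k \<noteq> 0" and u: "\<forall>z. u z = ln (norm k) + periodic_profile S (k * z + c)" and S: "S \<ge> 0"
  shows "joinable u ((Complex x y1 - c) / k) ((Complex x y2 - c) / k) (\<bar>y2 - y1\<bar> / (sqrt (1 + S ^ 2) * cosh x - S))"
proof -
  let ?B = "\<bar>y2 - y1\<bar> / (sqrt (1 + S ^ 2) * cosh x - S)"
  have "joinable u ((Complex x y1 - c) / k) ((Complex x y2 - c) / k) (?B * 1 - ?B * 0)"
  proof (rule joinable_segment[OF k u])
    fix t :: real
    show "((\<lambda>t. ?B * t) has_real_derivative ?B) (at t)" by (rule DERIV_cmult_Id)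
    have "Re (linepath (Complex x y1) (Complex x y2) t) = x"
      by (simp add: linepath_def algebra_simps)
    moreover have "norm (Complex x y2 - Complex x y1) = \<bar>y2 - y1\<bar>" by (simp add: cmod_def)
    ultimately show "exp (periodic_profile S (linepath (Complex x y1) (Complex x y2) t)) * norm (Complex x y2 - Complex x y1) \<le> ?B"
      using mult_right_mono[OF periodic_profile_exp_le[OF S, of "linepath (Complex x y1) (Complex x y2) t"], of "\<bar>y2 - y1\<bar>"] by simp
  qed auto
  then show ?thesis by simp
qed

text \<open>
  From both points one can walk along horizontal lines to the far left, or to the far right, and cross
  there at negligible cost. On each horizontal line the ways to the left and to the right have a total length of at most
  \<open>pi + 2 arctan S\<close>, the length of the longest such line, so one of the two routes is not longer than that.
\<close>
lemma periodic_diameter_le: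
  assumes k: "k \<noteq> 0" and u: "\<forall>z. u z = ln (norm k) + periodic_profile S (k * z + c)" and S: "S \<ge> 0"
    and cont: "continuous_on UNIV u"
  shows "conformal_diameter u \<le> ennreal (pi + 2 * arctan S)"
proof (rule conformal_diameter_le[OF k])
  fix w1 w2 :: complex
  show "((\<lambda>X. \<bar>Im w2 - Im w1\<bar> / (sqrt (1 + S ^ 2) * cosh X - S)) \<longlongrightarrow> 0) at_top"
  proof -
    have "sqrt (1 + S ^ 2) > 0" by (intro real_sqrt_gt_zero) (simp add: add_pos_nonneg)
    then show ?thesis unfolding cosh_field_def by real_asymp
  qed
  show "eventually (\<lambda>X. conformal_dist u ((w1 - c) / k) ((w2 - c) / k) \<le> ennreal (pi + 2 * arctan S + \<bar>Im w2 - Im w1\<bar> / (sqrt (1 + S ^ 2) * cosh X - S))) at_top"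
    using eventually_ge_at_top[of "max \<bar>Re w1\<bar> \<bar>Re w2\<bar>"]
  proof eventually_elim
    fix X assume X: "max \<bar>Re w1\<bar> \<bar>Re w2\<bar> \<le> X"
    let ?B = "\<bar>Im w2 - Im w1\<bar> / (sqrt (1 + S ^ 2) * cosh X - S)"
    have B: "?B \<ge> 0" using periodic_denominator_pos[of S X pi] by simp
    have via: "conformal_dist u ((w1 - c) / k) ((w2 - c) / k) \<le> ennreal ((\<bar>long_arc S \<xi> - long_arc S (Re w1)\<bar> + ?B) + \<bar>long_arc S (Re w2) - long_arc S \<xi>\<bar>)"
      if "cosh \<xi> = cosh X" for \<xi>
    proof (rule joinable_dist)
      have "joinable u ((Complex (Re w1) (Im w1) - c) / k) ((Complex (Re w2) (Im w2) - c) / k) ((\<bar>long_arc S \<xi> - long_arc S (Re w1)\<bar> + ?B) + \<bar>long_arc S (Re w2) - long_arc S \<xi>\<bar>)"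
        using periodic_horizontal[OF k u S, of "Re w1" "Im w1" \<xi>] periodic_vertical[OF k u S, of \<xi> "Im w1" "Im w2"]
          periodic_horizontal[OF k u S, of \<xi> "Im w2" "Re w2"] B that
        by (intro joinable_trans[OF joinable_trans _ cont]) (auto simp: cont)
      then show "joinable u ((w1 - c) / k) ((w2 - c) / k) ((\<bar>long_arc S \<xi> - long_arc S (Re w1)\<bar> + ?B) + \<bar>long_arc S (Re w2) - long_arc S \<xi>\<bar>)"
        by simp
    qed
    let ?A = "long_arc S (Re w1) + long_arc S (Re w2)"
    show "conformal_dist u ((w1 - c) / k) ((w2 - c) / k) \<le> ennreal (pi + 2 * arctan S + ?B)"
    proof (cases "?A \<le> pi - 2 * arctan S")
      case True
      have "long_arc S (- X) \<le> long_arc S (Re w1)" "long_arc S (- X) \<le> long_arc S (Re w2)"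
        using X by (auto intro!: long_arc_mono)
      with True long_arc_bounds(2)[of S "- X"]
      have "(\<bar>long_arc S (- X) - long_arc S (Re w1)\<bar> + ?B) + \<bar>long_arc S (Re w2) - long_arc S (- X)\<bar> \<le> pi + 2 * arctan S + ?B"
        by linarith
      then show ?thesis using via[of "- X"] by (simp add: order_trans[OF _ ennreal_leI])
    next
      case False
      have "long_arc S X \<ge> long_arc S (Re w1)" "long_arc S X \<ge> long_arc S (Re w2)"
        using X by (auto intro!: long_arc_mono)
      with False long_arc_bounds(1)[of S "X"]
      have "(\<bar>long_arc S X - long_arc S (Re w1)\<bar> + ?B) + \<bar>long_arc S (Re w2) - long_arc S X\<bar> \<le> pi + 2 * arctan S + ?B"
        by linarith
      then show ?thesis using via[of X] by (simp add: order_trans[OF _ ennreal_leI])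
    qed
  qed
qed

lemma arctan_eq_arcsin: "arctan S = arcsin (S / sqrt (1 + S ^ 2))"
proof -
  have "arcsin (sin (arctan S)) = arctan S"
    using arctan_lbound[of S] arctan_ubound[of S] by (intro arcsin_sin) auto
  then show ?thesis by (simp add: sin_arctan)
qed

text \<open>
  The developing map sends the points \<open>- i pi\<close> and \<open>i pi\<close> to the same point of the sphere, the antipode of the midpoint
  of the short arc between the two missing points. A curve joining them has to cross the real axis, which is mapped to this short arc.
  With \<open>T\<close> the height in the direction of that midpoint, \<open>T = -1\<close> at both ends, and \<open>T\<close> is at least \<open>S / sqrt (1 + S^2)\<close>
  on the real axis. So each of the two parts of the curve has at least the length \<open>pi/2 + arctan S\<close>.
\<close>
lemma periodic_diameter_ge:
  assumes k: "k \<noteq> 0" and u: "\<forall>z. u z = ln (norm k) + periodic_profile S (k * z + c)" and S: "S \<ge> 0"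
    and cont: "continuous_on UNIV u"
  shows "ennreal (pi + 2 * arctan S) \<le> conformal_diameter u"
proof (rule conformal_diameter_ge[where p = "(Complex 0 (- pi) - c) / k" and q = "(Complex 0 pi - c) / k"])
  fix \<gamma> :: "real \<Rightarrow> complex"
  assume \<gamma>: "valid_path \<gamma>" and start: "pathstart \<gamma> = (Complex 0 (- pi) - c) / k" and finish: "pathfinish \<gamma> = (Complex 0 pi - c) / k"
  define C where "C = sqrt (1 + S ^ 2)"
  have C2: "C ^ 2 = 1 + S ^ 2" unfolding C_def by (simp add: add_nonneg_nonneg)
  have CS: "C > S" "C > 0" using abs_less_sqrt_add_square[of S] S unfolding C_def by linarith+
  define D where "D w = C * cosh (Re w) + S * cos (Im w)" for w
  have D: "D w > 0" for w using periodic_denominator_pos by (simp add: D_def C_def)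
  define T where "T w = (S * cosh (Re w) + C * cos (Im w)) / D w" for w
  define G where "G w = Complex (- sinh (Re w) * cos (Im w) / D w ^ 2) (- sin (Im w) * cosh (Re w) / D w ^ 2)" for w
  have T': "(T has_derivative (\<lambda>h. inner (G w) h)) (at w)" for w
  proof -
    have TD: "(T has_derivative (\<lambda>h. ((S * (sinh (Re w) * Re h) + C * (- sin (Im w) * Im h)) * D w
        - (S * cosh (Re w) + C * cos (Im w)) * (C * (sinh (Re w) * Re h) + S * (- sin (Im w) * Im h))) / (D w * D w))) (at w)"
    proof -
      have N': "((\<lambda>w. S * cosh (Re w) + C * cos (Im w)) has_derivative (\<lambda>h. S * (sinh (Re w) * Re h) + C * (- sin (Im w) * Im h))) (at w)"
        and D': "(D has_derivative (\<lambda>h. C * (sinh (Re w) * Re h) + S * (- sin (Im w) * Im h))) (at w)"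
        unfolding D_def
        by (intro has_derivative_add has_derivative_mult_right has_derivative_cosh_Re has_derivative_cos_Im)+
      show ?thesis
        unfolding T_def using D[of w] by (intro has_derivative_divide'[OF N' D']) simp
    qed
    have num: "(S * (sinh (Re w) * Re h) + C * (- sin (Im w) * Im h)) * D w
        - (S * cosh (Re w) + C * cos (Im w)) * (C * (sinh (Re w) * Re h) + S * (- sin (Im w) * Im h))
        = (C ^ 2 - S ^ 2) * (- sinh (Re w) * cos (Im w) * Re h - sin (Im w) * cosh (Re w) * Im h)" for h
      unfolding D_def by (simp add: algebra_simps power2_eq_square)
    show ?thesis
      by (rule has_derivative_eq_rhs[OF TD], rule ext, unfold num C2)
        (simp add: G_def inner_complex_def diff_divide_distrib power2_eq_square)
  qed
  have oneT: "1 - T w ^ 2 = (sinh (Re w) ^ 2 + sin (Im w) ^ 2) / D w ^ 2" for w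
  proof -
    have "D w ^ 2 - (S * cosh (Re w) + C * cos (Im w)) ^ 2 = (C ^ 2 - S ^ 2) * (cosh (Re w) ^ 2 - cos (Im w) ^ 2)"
      unfolding D_def by (simp add: algebra_simps power2_eq_square)
    also have "\<dots> = sinh (Re w) ^ 2 + sin (Im w) ^ 2"
      unfolding C2 cosh_square_eq cos_squared_eq by simp
    finally have "D w ^ 2 - (S * cosh (Re w) + C * cos (Im w)) ^ 2 = sinh (Re w) ^ 2 + sin (Im w) ^ 2" .
    moreover have "1 - T w ^ 2 = (D w ^ 2 - (S * cosh (Re w) + C * cos (Im w)) ^ 2) / D w ^ 2"
      using D[of w] by (simp add: T_def power_divide diff_divide_distrib)
    ultimately show ?thesis by simp
  qed
  have T1: "\<bar>T w\<bar> \<le> 1" for w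
  proof -
    have "1 - T w ^ 2 \<ge> 0" unfolding oneT by simp
    then show ?thesis by (simp add: abs_square_le_1)
  qed
  have nG: "norm (G w) = sqrt (1 - T w ^ 2) * exp (periodic_profile S w)" for w
  proof -
    have "norm (G w) ^ 2 = (sinh (Re w) ^ 2 * cos (Im w) ^ 2 + sin (Im w) ^ 2 * cosh (Re w) ^ 2) / (D w ^ 2 * D w ^ 2)"
      unfolding cmod_power2
      by (simp add: G_def power_divide power_mult_distrib add_divide_distrib power2_eq_square[of "D w ^ 2"])
    also have "sinh (Re w) ^ 2 * cos (Im w) ^ 2 + sin (Im w) ^ 2 * cosh (Re w) ^ 2 = sinh (Re w) ^ 2 + sin (Im w) ^ 2"
      unfolding cosh_square_eq cos_squared_eq by (simp add: algebra_simps)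
    finally have "norm (G w) ^ 2 = (1 - T w ^ 2) * (1 / D w) ^ 2"
      unfolding oneT by (simp add: power_divide)
    then have "norm (G w) = sqrt ((1 - T w ^ 2) * (1 / D w) ^ 2)" by (metis norm_ge_zero real_sqrt_unique)
    also have "\<dots> = sqrt (1 - T w ^ 2) * (1 / D w)" using D[of w] by (simp add: real_sqrt_mult)
    finally show ?thesis by (simp add: periodic_profile_exp D_def C_def)
  qed
  define w where "w t = k * \<gamma> t + c" for t
  have ends: "w 0 = Complex 0 (- pi)" "w 1 = Complex 0 pi"
    using start finish k by (auto simp: w_def pathstart_def pathfinish_def)
  have "continuous_on {0..1} (\<lambda>t. Im (w t))"
    unfolding w_def using valid_path_imp_path[OF \<gamma>] by (auto simp: path_def intro!: continuous_intros)
  then obtain t where t: "0 \<le> t" "t \<le> 1" "Im (w t) = 0"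
    using IVT'[of "\<lambda>t. Im (w t)" 0 0 1] ends by auto
  have "ennreal (\<bar>arcsin (T (k * \<gamma> t + c)) - arcsin (T (k * \<gamma> 0 + c))\<bar> + \<bar>arcsin (T (k * \<gamma> 1 + c)) - arcsin (T (k * \<gamma> t + c))\<bar>) \<le> conformal_length u \<gamma>"
  proof (rule length_ge_height_angles[OF _ _ _ \<gamma> cont t(1,2), where T' = "\<lambda>z h. inner (G (k * z + c)) (k * h)"])
    fix z h
    have "((\<lambda>z. k * z + c) has_derivative (\<lambda>h. k * h)) (at z)" by (auto intro!: derivative_eq_intros)
    from has_derivative_compose[OF this T']
    show "((\<lambda>z. T (k * z + c)) has_derivative (\<lambda>h. inner (G (k * z + c)) (k * h))) (at z)" .
    show "\<bar>T (k * z + c)\<bar> \<le> 1" by (rule T1)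
    have "\<bar>inner (G (k * z + c)) (k * h)\<bar> \<le> norm (G (k * z + c)) * norm (k * h)"
      by (rule Cauchy_Schwarz_ineq2)
    also have "\<dots> = sqrt (1 - T (k * z + c) ^ 2) * exp (u z) * norm h"
      unfolding nG u[rule_format] using k by (simp add: exp_add norm_mult)
    finally show "\<bar>inner (G (k * z + c)) (k * h)\<bar> \<le> sqrt (1 - T (k * z + c) ^ 2) * exp (u z) * norm h" .
  qed
  note len = this[folded w_def]
  have Tends: "T (w 0) = - 1" "T (w 1) = - 1"
    using CS unfolding ends by (simp_all add: T_def D_def divide_eq_eq)
  have "T (w t) \<ge> S / C"
  proof -
    have "S * D (w t) \<le> (S * cosh (Re (w t)) + C * cos (Im (w t))) * C"
      using C2 by (simp add: D_def t(3) algebra_simps power2_eq_square)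
    then show ?thesis using D[of "w t"] CS by (simp add: T_def divide_le_eq le_divide_eq mult_ac)
  qed
  then have cross: "arcsin (T (w t)) \<ge> arctan S"
    unfolding arctan_eq_arcsin C_def[symmetric] using T1[of "w t"] S CS
    by (intro arcsin_le_arcsin) (auto simp: abs_le_iff intro: order_trans[of _ 0])
  have "pi + 2 * arctan S \<le> \<bar>arcsin (T (w t)) - arcsin (T (w 0))\<bar> + \<bar>arcsin (T (w 1)) - arcsin (T (w t))\<bar>"
    unfolding Tends arcsin_minus_1 using cross by linarith
  from order_trans[OF ennreal_leI[OF this] len] show "ennreal (pi + 2 * arctan S) \<le> conformal_length u \<gamma>" .
qed

section \<open>The diameter of the bubble\<close>

lemma bubble_exp: "exp (bubble w) = 2 / (1 + norm w ^ 2)"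
  unfolding bubble_def by (rule exp_ln) (auto intro!: divide_pos_pos add_pos_nonneg)

lemma bubble_radial:
  assumes k: "k \<noteq> 0" and u: "\<forall>z. u z = ln (norm k) + bubble (k * z + c)" and e: "norm e = 1"
  shows "joinable u ((of_real r1 * e - c) / k) ((of_real r2 * e - c) / k) \<bar>2 * arctan r2 - 2 * arctan r1\<bar>"
proof -
  define \<sigma> :: real where "\<sigma> = (if r1 \<le> r2 then 1 else - 1)"
  let ?r = "\<lambda>t. r1 + t * (r2 - r1)"
  let ?H = "\<lambda>t. \<sigma> * (2 * arctan (?r t))"
  let ?h = "\<lambda>t. 2 * \<bar>r2 - r1\<bar> / (1 + ?r t ^ 2)"
  have pos: "1 + x ^ 2 \<noteq> 0" for x :: real by (metis add_pos_nonneg less_irrefl zero_le_power2 zero_less_one)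
  have "joinable u ((of_real r1 * e - c) / k) ((of_real r2 * e - c) / k) (?H 1 - ?H 0)"
  proof (rule joinable_segment[OF k u])
    fix t :: real
    show "(?H has_real_derivative ?h t) (at t)"
      by (rule derivative_eq_intros refl | simp)+ (simp add: \<sigma>_def divide_inverse)
    have "linepath (of_real r1 * e) (of_real r2 * e) t = of_real (?r t) * e"
      by (simp add: linepath_def scaleR_conv_of_real algebra_simps)
    then have "norm (linepath (of_real r1 * e) (of_real r2 * e) t) = \<bar>?r t\<bar>"
      using e by (simp only: norm_mult norm_of_real)  simp
    moreover have "norm (of_real r2 * e - of_real r1 * e) = \<bar>r2 - r1\<bar>"
      using e by (simp add: norm_mult flip: left_diff_distrib of_real_diff)
    ultimately show "exp (bubble (linepath (of_real r1 * e) (of_real r2 * e) t)) * norm (of_real r2 * e - of_real r1 * e) \<le> ?h t"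
      unfolding bubble_exp by simp
    have "continuous_on UNIV ?h"
      using pos by (intro continuous_intros) auto
    then show "?h \<in> borel_measurable borel" by (rule borel_measurable_continuous_onI)
  qed
  moreover have "?H 1 - ?H 0 = \<bar>2 * arctan r2 - 2 * arctan r1\<bar>"
    using arctan_monotone'[of r1 r2] arctan_monotone'[of r2 r1] by (auto simp: \<sigma>_def)
  ultimately show ?thesis by simp
qed

text \<open>
  Chords between far points whose directions enclose at most a right angle stay far away from the origin.
\<close>
lemma bubble_chord:
  assumes k: "k \<noteq> 0" and u: "\<forall>z. u z = ln (norm k) + bubble (k * z + c)"
    and e: "norm e1 = 1" "norm e2 = 1" "inner e1 e2 \<ge> 0" and R: "R > 0"
  shows "joinable u ((of_real R * e1 - c) / k) ((of_real R * e2 - c) / k) (8 / R)"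
proof -
  have "joinable u ((of_real R * e1 - c) / k) ((of_real R * e2 - c) / k) (8 / R * 1 - 8 / R * 0)"
  proof (rule joinable_segment[OF k u])
    fix t :: real assume t: "0 \<le> t" "t \<le> 1"
    show "((\<lambda>t. 8 / R * t) has_real_derivative 8 / R) (at t)" by (rule DERIV_cmult_Id)
    let ?l = "linepath (of_real R * e1) (of_real R * e2) t"
    have l: "?l = R *\<^sub>R ((1 - t) *\<^sub>R e1 + t *\<^sub>R e2)"
      by (simp add: linepath_def scaleR_conv_of_real algebra_simps)
    have "norm ((1 - t) *\<^sub>R e1 + t *\<^sub>R e2) ^ 2 = (1 - t) ^ 2 * norm e1 ^ 2 + t ^ 2 * norm e2 ^ 2 + 2 * ((1 - t) * t) * inner e1 e2"
      unfolding power2_norm_eq_inner by (simp add: inner_add_left inner_add_right inner_commute power2_eq_square)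
    also have "\<dots> \<ge> (1 - t) ^ 2 + t ^ 2"
      using e t by simp
    also have "(1 - t) ^ 2 + t ^ 2 = 1 / 2 + 2 * (t - 1 / 2) ^ 2" by (simp add: power2_eq_square field_simps)
    finally have "norm ((1 - t) *\<^sub>R e1 + t *\<^sub>R e2) ^ 2 \<ge> 1 / 2" using zero_le_power2[of "t - 1/2"] by linarith
    then have "R ^ 2 * norm ((1 - t) *\<^sub>R e1 + t *\<^sub>R e2) ^ 2 \<ge> R ^ 2 * (1 / 2)" by (intro mult_left_mono) auto
    then have "norm ?l ^ 2 \<ge> R ^ 2 / 2" unfolding l norm_scaleR by (simp add: power_mult_distrib)
    then have 1: "exp (bubble ?l) \<le> 2 / (R ^ 2 / 2)"
      unfolding bubble_exp using R by (intro divide_left_mono mult_pos_pos add_pos_nonneg) auto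
    have "norm (of_real R * e2 - of_real R * e1) \<le> norm (of_real R * e2) + norm (of_real R * e1)"
      by (rule norm_triangle_ineq4)
    then have 2: "norm (of_real R * e2 - of_real R * e1) \<le> 2 * R" using e R by (simp add: norm_mult)
    have "exp (bubble ?l) * norm (of_real R * e2 - of_real R * e1) \<le> 2 / (R ^ 2 / 2) * (2 * R)"
      using 1 2 by (intro mult_mono) auto
    also have "\<dots> = 8 / R" using R by (simp add: power2_eq_square)
    finally show "exp (bubble ?l) * norm (of_real R * e2 - of_real R * e1) \<le> 8 / R" .
  qed auto
  then show ?thesis by simp
qed

text \<open>
  Two points can be joined through the origin or through far points. The two routes together have length \<open>2 pi\<close> up to a
  negligible cost, so one of them has essentially at most length \<open>pi\<close>.
\<close>
lemma bubble_diameter_le: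
  assumes k: "k \<noteq> 0" and u: "\<forall>z. u z = ln (norm k) + bubble (k * z + c)" and cont: "continuous_on UNIV u"
  shows "conformal_diameter u \<le> ennreal pi"
proof (rule conformal_diameter_le[OF k])
  show "((\<lambda>R. 16 / R) \<longlongrightarrow> (0::real)) at_top" by real_asymp
  fix w1 w2 :: complex
  define e where "e w = (if w = 0 then 1 else w / of_real (norm w))" for w :: complex
  have e: "norm (e w) = 1" "w = of_real (norm w) * e w" for w by (auto simp: e_def norm_divide)
  \<comment> \<open>An intermediate direction perpendicular to the first one, so that no chord passes near the origin.\<close>
  obtain e3 where e3: "norm e3 = 1" "inner (e w1) e3 \<ge> 0" "inner e3 (e w2) \<ge> 0"
  proof (cases "inner (\<i> * e w1) (e w2) \<ge> 0")
    case True
    then show ?thesis using e(1)[of w1] by (intro that[of "\<i> * e w1"]) (auto simp: norm_mult inner_complex_def)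
  next
    case False
    then show ?thesis using e(1)[of w1] by (intro that[of "- (\<i> * e w1)"]) (auto simp: norm_mult inner_complex_def)
  qed
  have "conformal_dist u ((w1 - c) / k) ((w2 - c) / k) \<le> ennreal (pi + 16 / R)" if R: "R \<ge> 1 + norm w1 + norm w2" for R
  proof -
    let ?a1 = "2 * arctan (norm w1)" and ?a2 = "2 * arctan (norm w2)"
    have R0: "R > 0" using R norm_ge_zero[of w1] norm_ge_zero[of w2] by linarith
    have a: "?a1 \<ge> 0" "?a2 \<ge> 0" by simp_all
    have "joinable u ((w1 - c) / k) ((w2 - c) / k) (pi + 16 / R)" if "?a1 + ?a2 \<le> pi"
    proof -
      have 1: "joinable u ((w1 - c) / k) ((0 - c) / k) ?a1"
        using bubble_radial[OF k u e(1)[of w1], of "norm w1" 0] e(2)[of w1] by simp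
      have 2: "joinable u ((0 - c) / k) ((w2 - c) / k) ?a2"
        using bubble_radial[OF k u e(1)[of w2], of 0 "norm w2"] e(2)[of w2] by simp
      from joinable_trans[OF 1 2 cont a] show ?thesis
      proof (rule joinable_mono)
        have "16 / R \<ge> 0" using R0 by simp
        with that show "?a1 + ?a2 \<le> pi + 16 / R" by linarith
      qed
    qed
    moreover have "joinable u ((w1 - c) / k) ((w2 - c) / k) (pi + 16 / R)" if "?a1 + ?a2 > pi"
    proof -
      have m: "arctan (norm w1) \<le> arctan R" "arctan (norm w2) \<le> arctan R"
        using R norm_ge_zero[of w1] norm_ge_zero[of w2] by (intro arctan_monotone'; linarith)+
      have 1: "joinable u ((w1 - c) / k) ((of_real R * e w1 - c) / k) (2 * arctan R - ?a1)"
        using bubble_radial[OF k u e(1)[of w1], of "norm w1" R] e(2)[of w1] m by simp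
      have 2: "joinable u ((of_real R * e w1 - c) / k) ((of_real R * e3 - c) / k) (8 / R)"
        by (rule bubble_chord[OF k u e(1) e3(1,2) R0])
      have 3: "joinable u ((of_real R * e3 - c) / k) ((of_real R * e w2 - c) / k) (8 / R)"
        by (rule bubble_chord[OF k u e3(1) e(1) e3(3) R0])
      have 4: "joinable u ((of_real R * e w2 - c) / k) ((w2 - c) / k) (2 * arctan R - ?a2)"
        using bubble_radial[OF k u e(1)[of w2], of R "norm w2"] e(2)[of w2] m by simp
      have "joinable u ((w1 - c) / k) ((w2 - c) / k) (2 * arctan R - ?a1 + 8 / R + 8 / R + (2 * arctan R - ?a2))"
        using R0 m by (intro joinable_trans[OF joinable_trans[OF joinable_trans[OF 1 2] 3] 4] cont) auto
      moreover have "2 * arctan R - ?a1 + 8 / R + 8 / R + (2 * arctan R - ?a2) \<le> pi + 16 / R"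
        using that arctan_ubound[of R] by simp
      ultimately show ?thesis by (rule joinable_mono)
    qed
    ultimately show ?thesis by (intro joinable_dist) (meson not_less)
  qed
  then show "eventually (\<lambda>R. conformal_dist u ((w1 - c) / k) ((w2 - c) / k) \<le> ennreal (pi + 16 / R)) at_top"
    by (rule eventually_at_top_linorderI)
qed

text \<open>
  With \<open>T\<close> the height on the sphere, which is 1 at the center of the bubble and tends to \<open>-1\<close> at infinity, the distance from the center to far
  points tends to \<open>pi\<close>.
\<close>
lemma bubble_diameter_ge:
  assumes k: "k \<noteq> 0" and u: "\<forall>z. u z = ln (norm k) + bubble (k * z + c)" and cont: "continuous_on UNIV u"
  shows "ennreal pi \<le> conformal_diameter u"
proof -
  let ?T' = "\<lambda>w h::complex. - 4 * inner w h / (1 + norm w ^ 2) ^ 2" and ?t = "\<lambda>R::real. 2 / (1 + R ^ 2) - 1"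
  define T where "T w = 2 / (1 + norm w ^ 2) - 1" for w :: complex
  have D: "1 + norm w ^ 2 > 0" for w :: complex by (simp add: add_pos_nonneg)
  have T': "(T has_derivative (\<lambda>h. ?T' w h)) (at w)" for w
  proof -
    have N': "((\<lambda>w::complex. 1 + inner w w) has_derivative (\<lambda>h. 2 * inner w h)) (at w)"
      by (rule has_derivative_eq_rhs, (rule derivative_eq_intros refl)+) (auto simp: inner_commute)
    have "((\<lambda>w::complex. 2 / (1 + inner w w) - 1) has_derivative (\<lambda>h. (0 * (1 + inner w w) - 2 * (2 * inner w h)) / ((1 + inner w w) * (1 + inner w w)) - 0)) (at w)"
      using D[of w] by (intro has_derivative_diff has_derivative_divide' has_derivative_const N') (simp add: power2_norm_eq_inner)
    then show ?thesis by (simp add: T_def[abs_def] power2_norm_eq_inner power2_eq_square[of "1 + _"])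
  qed
  have oneT: "1 - T w ^ 2 = (2 * norm w / (1 + norm w ^ 2)) ^ 2" for w
  proof -
    have "1 - (2 / (1 + x ^ 2) - 1) ^ 2 = (2 * x / (1 + x ^ 2)) ^ 2" for x :: real
    proof -
      have y: "1 + x ^ 2 \<noteq> 0" by (metis add_pos_nonneg less_irrefl zero_le_power2 zero_less_one)
      then have quotient: "2 / (1 + x ^ 2) - 1 = (1 - x ^ 2) / (1 + x ^ 2)"
        by (simp add: field_simps)
      have "1 - (2 / (1 + x ^ 2) - 1) ^ 2 = ((1 + x ^ 2) ^ 2 - (1 - x ^ 2) ^ 2) / (1 + x ^ 2) ^ 2"
        unfolding quotient power_divide using y by (simp add: diff_divide_distrib)
      also have "(1 + x ^ 2) ^ 2 - (1 - x ^ 2) ^ 2 = (2 * x) ^ 2"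
        by (simp add: power2_eq_square algebra_simps)
      finally show ?thesis by (simp only: power_divide)
    qed
    then show ?thesis by (simp add: T_def)
  qed
  have T1: "\<bar>T w\<bar> \<le> 1" for w
  proof -
    have "1 - T w ^ 2 \<ge> 0" unfolding oneT by simp
    then show ?thesis by (simp add: abs_square_le_1)
  qed
  have far: "ennreal (pi / 2 - arcsin (?t R)) \<le> conformal_diameter u" for R :: real
  proof (rule conformal_diameter_ge[where p = "(0 - c) / k" and q = "(of_real R - c) / k"])
    fix \<gamma> :: "real \<Rightarrow> complex"
    assume \<gamma>: "valid_path \<gamma>" and "pathstart \<gamma> = (0 - c) / k" "pathfinish \<gamma> = (of_real R - c) / k"
    then have ends: "k * \<gamma> 0 + c = 0" "k * \<gamma> 1 + c = of_real R" using k by (auto simp: pathstart_def pathfinish_def)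
    have "ennreal (\<bar>arcsin (T (k * \<gamma> 1 + c)) - arcsin (T (k * \<gamma> 0 + c))\<bar> + \<bar>arcsin (T (k * \<gamma> 1 + c)) - arcsin (T (k * \<gamma> 1 + c))\<bar>) \<le> conformal_length u \<gamma>"
    proof (rule length_ge_height_angles[OF _ _ _ \<gamma> cont, where T' = "\<lambda>z h. ?T' (k * z + c) (k * h)"])
      fix z h
      let ?w = "k * z + c"
      have "((\<lambda>z. k * z + c) has_derivative (\<lambda>h. k * h)) (at z)" by (auto intro!: derivative_eq_intros)
      from has_derivative_compose[OF this T']
      show "((\<lambda>z. T (k * z + c)) has_derivative (\<lambda>h. ?T' ?w (k * h))) (at z)" .
      show "\<bar>T ?w\<bar> \<le> 1" by (rule T1)
      have "\<bar>?T' ?w (k * h)\<bar> = 4 * \<bar>inner ?w (k * h)\<bar> / (1 + norm ?w ^ 2) ^ 2"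
        by (simp add: abs_mult)
      also have "\<dots> \<le> 4 * (norm ?w * norm (k * h)) / (1 + norm ?w ^ 2) ^ 2"
        by (intro divide_right_mono mult_left_mono Cauchy_Schwarz_ineq2) auto
      also have "\<dots> = (2 * norm ?w / (1 + norm ?w ^ 2)) * (norm k * (2 / (1 + norm ?w ^ 2))) * norm h"
        by (simp add: norm_mult power2_eq_square[of "1 + _"])
      also have "2 * norm ?w / (1 + norm ?w ^ 2) = sqrt (1 - T ?w ^ 2)"
        unfolding oneT by (rule real_sqrt_unique[symmetric]) (use D[of ?w] in auto)
      also have "norm k * (2 / (1 + norm ?w ^ 2)) = exp (u z)"
        unfolding u[rule_format] exp_add bubble_exp using k by simp
      finally show "\<bar>?T' ?w (k * h)\<bar> \<le> sqrt (1 - T ?w ^ 2) * exp (u z) * norm h" .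
    qed auto
    moreover have "arcsin (T 0) = pi / 2" by (simp add: T_def)
    moreover have "T (of_real R) = 2 / (1 + R ^ 2) - 1" by (simp add: T_def)
    ultimately have "ennreal \<bar>arcsin (?t R) - pi / 2\<bar> \<le> conformal_length u \<gamma>"
      unfolding ends by simp
    moreover have "ennreal (pi / 2 - arcsin (?t R)) \<le> ennreal \<bar>arcsin (?t R) - pi / 2\<bar>"
      by (intro ennreal_leI) simp
    ultimately show "ennreal (pi / 2 - arcsin (?t R)) \<le> conformal_length u \<gamma>"
      by (rule order_trans[rotated])
  qed
  have "((\<lambda>R::real. 2 / (1 + R ^ 2) - 1) \<longlongrightarrow> - 1) at_top" by real_asymp
  moreover have "eventually (\<lambda>R::real. 2 / (1 + R ^ 2) - 1 \<in> {-1..1}) at_top"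
  proof (intro always_eventually allI)
    fix R :: real
    show "2 / (1 + R ^ 2) - 1 \<in> {-1..1}" using T1[of "of_real R"] by (simp add: T_def abs_le_iff)
  qed
  ultimately have "((\<lambda>R::real. arcsin (?t R)) \<longlongrightarrow> arcsin (- 1)) at_top"
    using continuous_on_tendsto_compose[OF continuous_on_arcsin', of "\<lambda>R::real. 2 / (1 + R ^ 2) - 1" "- 1" at_top] by simp
  then have "((\<lambda>R::real. ennreal (pi / 2 - arcsin (?t R))) \<longlongrightarrow> ennreal (pi / 2 - arcsin (- 1))) at_top"
    by (intro tendsto_ennrealI tendsto_diff tendsto_const)
  from tendsto_upperbound[OF this] far have "ennreal (pi / 2 - arcsin (- 1)) \<le> conformal_diameter u"
    by simp
  then show ?thesis by (simp add: arcsin_minus_1)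
qed

theorem bubble_diameter:
  assumes "k \<noteq> 0" "\<forall>z. u z = ln (norm k) + bubble (k * z + c)" "continuous_on UNIV u"
  shows "conformal_diameter u = ennreal pi"
  using bubble_diameter_le[OF assms] bubble_diameter_ge[OF assms] by (rule antisym)

theorem periodic_diameter:
  assumes "k \<noteq> 0" "\<forall>z. u z = ln (norm k) + periodic_profile S (k * z + c)" "S \<ge> 0" "continuous_on UNIV u"
  shows "conformal_diameter u = ennreal (pi + 2 * arctan S)"
  using periodic_diameter_le[OF assms] periodic_diameter_ge[OF assms] by (rule antisym)

section \<open>Diameters of solutions bounded above\<close>

theorem bounded_diameter_range:
  assumes sol: "liouville_solution u" and bdd: "bdd_above (range u)"
  shows "conformal_diameter u \<in> {ennreal pi ..< ennreal (2 * pi)}"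
  using sol bdd
proof (cases rule: bounded_liouville_classification)
  case bubble
  have "conformal_diameter u = ennreal pi"
    by (rule bubble_diameter[OF bubble liouville_solution_continuous[OF sol]])
  then show ?thesis by (simp add: ennreal_less_iff)
next
  case (periodic k c S)
  have "arctan S \<ge> 0" using periodic(2) by simp
  then show ?thesis
    unfolding periodic_diameter[OF periodic(1,3,2) liouville_solution_continuous[OF sol]]
    using arctan_ubound[of S] by (auto simp del: ennreal_plus intro!: ennreal_leI ennreal_lessI)
qed

text \<open>
  The diameter \<open>pi + 2 arctan S\<close> of the periodic profile takes all these values for \<open>S \<ge> 0\<close>.
\<close>
theorem every_diameter_attained:
  assumes "d \<in> {pi ..< 2 * pi}"
  shows "\<exists>v. liouville_solution v \<and> bdd_above (range v) \<and> conformal_diameter v = ennreal d"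
proof -
  define S where "S = tan ((d - pi) / 2)"
  have S: "arctan S = (d - pi) / 2" unfolding S_def using assms by (intro arctan_tan) auto
  have "arctan S \<ge> 0" unfolding S using assms by simp
  then have "S \<ge> 0" by (simp only: zero_le_arctan_iff)
  then have "conformal_diameter (periodic_profile S) = ennreal (pi + 2 * arctan S)"
    using liouville_solution_continuous[OF periodic_profile_liouville]
    by (intro periodic_diameter[where k = 1 and c = 0]) auto
  also have "pi + 2 * arctan S = d" by (simp add: S field_simps)
  finally show ?thesis
    using periodic_profile_liouville periodic_profile_bounded by (intro exI[of _ "periodic_profile S"]) auto
qed

theorem diameter_pi_iff:
  assumes sol: "liouville_solution u" and bdd: "bdd_above (range u)"
  shows "conformal_diameter u = ennreal pi \<longleftrightarrow> (\<exists>p. radial_about p u) \<or> one_dimensional u"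
  using sol bdd
proof (cases rule: bounded_liouville_classification)
  case bubble
  then show ?thesis
    using bubble_diameter bubble_solution_radial liouville_solution_continuous[OF sol] by blast
next
  case (periodic k c S)
  have "arctan S \<ge> 0" using periodic(2) by simp
  then have "conformal_diameter u = ennreal pi \<longleftrightarrow> S = 0"
    using periodic_diameter[OF periodic(1,3,2) liouville_solution_continuous[OF sol]] by simp
  then show ?thesis
    using periodic_solution_not_radial[OF periodic(1,3)] periodic_solution_one_dimensional_iff[OF periodic(1,3,2)] by blast
qed

theorem theorem1p7:
  fixes u :: "complex \<Rightarrow> real"
  assumes "liouville_solution u"
  shows "(filterlim u at_bot at_infinity \<longleftrightarrow> (\<exists>p. radial_about p u))
    \<and> ((\<forall>x y. u (Complex x y) = u (Complex x (- y)) \<and> u (Complex x y) = u (Complex (- x) y)) \<and>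
        (\<forall>z. Re z > 0 \<and> Im z > 0 \<longrightarrow> partial_x u z < 0 \<and> partial_y u z < 0)
        \<longrightarrow> radial_about 0 u)
    \<and> (concave_on UNIV u \<and> bdd_above (range u)
        \<longrightarrow> (\<exists>l z0 :: complex. l \<noteq> 0 \<and> (\<forall>z. u z = ln (cmod l) + log_sech (l * z + z0))))
    \<and> (bdd_above (range u) \<longrightarrow> conformal_diameter u \<in> {ennreal pi ..< ennreal (2 * pi)})
    \<and> (\<forall>d :: real. d \<in> {pi ..< 2 * pi} \<longrightarrow>
        (\<exists>v. liouville_solution v \<and> bdd_above (range v) \<and> conformal_diameter v = ennreal d))
    \<and> (bdd_above (range u) \<longrightarrow>
        (conformal_diameter u = ennreal pi \<longleftrightarrow> (\<exists>p. radial_about p u) \<or> one_dimensional u))"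
  by (intro conjI impI allI; (elim conjE)?;
      (rule vanishing_iff_radial[OF assms] every_diameter_attained monotone_symmetric_radial[OF assms]
         concave_bounded_strip[OF assms] bounded_diameter_range[OF assms] diameter_pi_iff[OF assms]; assumption?))

end
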